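(* Let $G$ be a connected real Lie group with Lie algebra $\mathfrak{g}$. Suppose $G$ is also a complex manifold, with left-invariant complex structure, and let $F:T^{1,0}G\to[0,+\infty)$ be a left-invariant strongly pseudoconvex complex Finsler metric on $G$. Then the holomorphic bisectional curvature in the directions $v,w\in\mathfrak{g}^{1,0}\setminus\{0\}$ is given by $$B(v,w)=\frac{g_v(R(w,\bar w)v,v)}{g_v(v,v)\,g_v(w,w)},$$ and the holomorphic sectional curvature in the direction $v\in\mathfrak{g}^{1,0}\setminus\{0\}$ is given by $$K(v)=2\,\frac{g_v(R(v,\bar v)v,v)}{F^4(v)},$$ where $R(w,\bar w)v$ is given by $$R(w,\bar w)v=\mathcal{D}_{[v,\bar w]^{1,0}}(\mathcal{N}(w))-\mathcal{D}_{\bar{\mathcal{N}}(\bar w)}(\mathcal{N}(w))+\mathcal{N}([w,\bar w]^{1,0})-[\mathcal{N}(w),\bar w]^{1,0}+[v,[\bar w,w]^{0,1}]^{1,0},$$ and $R(v,\bar v)v$ is the value of this expression at $w=v$ (the argument $w$ being held constant in the differentiations $\mathcal{D}$).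
   Context: Summation over repeated indices is used. **Complex Finsler metrics.** A complex Finsler metric on a complex manifold $M$ of complex dimension $n$ is a continuous $F:T^{1,0}M\to[0,+\infty)$, smooth off the zero section, with $F(\lambda v)=|\lambda|F(v)$ for $\lambda\in\mathbb{C}$. It is strongly pseudoconvex if the Levi matrix $(\partial^2F^2/\partial v^i\partial\bar v^j)$ in linear fiber coordinates is positive definite at every $v\ne0$. Let $\tilde M=T^{1,0}M\setminus\{\text{zero section}\}$ and $\pi:\tilde M\to M$. **Complex Chern-Rund connection.** Let $\{e_i\}$ be a smooth local frame of $T^{1,0}M$ (pulled back to a frame of $\pi^*T^{1,0}M$), $\{\varphi^i\}$ its dual coframe of $(1,0)$-forms (pulled back to $\tilde M$), and $v^i$ the fiber coordinates given by $v=v^ie_i$. Put $$g_{i\bar\jmath}=\frac{\partial^2F^2}{\partial v^i\partial\bar v^j},\quad g_{ij}=\frac{\partial^2F^2}{\partial v^i\partial v^j},\quad C_{i\bar\jmath l}=\frac{\partial^3F^2}{\partial v^i\partial\bar v^j\partial v^l},\quad C_{i\bar\jmath\bar l}=\frac{\partial^3F^2}{\partial v^i\partial\bar v^j\partial\bar v^l}.$$ There are unique horizontal $1$-forms $\omega^i_j=\Gamma^i_{jk}\varphi^k+\Gamma^i_{j\bar k}\bar\varphi^k$ on $\tilde M$ such that (a) $d\varphi^i=\varphi^j\wedge\omega^i_j+\tau^i$ with the $(1,1)$-component of $\tau^i$ zero, and (b) $dg_{i\bar\jmath}=g_{l\bar\jmath}\omega^l_i+g_{i\bar l}\overline{\omega^l_j}+C_{i\bar\jmath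 l}\boldsymbol{\varphi}^{n+l}+C_{i\bar\jmath\bar l}\overline{\boldsymbol{\varphi}^{n+l}}$, where $\boldsymbol{\varphi}^{n+i}=dv^i+v^j\omega^i_j$. **Curvature.** Put $\Omega^i_j=d\omega^i_j-\omega^k_j\wedge\omega^i_k$ and expand it in the coframe $\{\varphi^i,\bar\varphi^i,\boldsymbol{\varphi}^{n+i},\overline{\boldsymbol{\varphi}^{n+i}}\}$ of $\tilde M$; let ${}^2R^i_{\;lk\bar\jmath}$ be the coefficient of $\varphi^k\wedge\bar\varphi^j$ in $\Omega^i_l$, and ${}^2R^i_{\;l\bar\jmath k}=-{}^2R^i_{\;lk\bar\jmath}$ the corresponding coefficient of $\bar\varphi^j\wedge\varphi^k$. At $v\in\tilde M$, for $X,Y,W,Z\in\pi^*T^{1,0}M|_v\cong T^{1,0}_{\pi(v)}M$, define $$R(X,\bar Y)W=W^lX^k\bar Y^j\;{}^2R^i_{\;l\bar\jmath k}\,e_i,\qquad R(W,\bar Z,X,\bar Y)=g_v(R(X,\bar Y)W,Z),$$ where $g_v(u,w)=g_{i\bar\jmath}(v)u^i\bar w^j$. For $v,w\in T^{1,0}_{p}M\setminus\{0\}$, the holomorphic bisectional curvature at $v\in\tilde M$ in the directions $v,w$ is $$B(v,w)=\frac{R(v,\bar v,w,\bar w)}{g_v(v,v)g_v(w,w)},$$ and the holomorphic sectional curvature, in the normalization used in the theorem, is $K(v)=2R(v,\bar v,v,\bar v)/F^4(v)$. **Lie group setting.** $\mathfrak{g}$ is identified with the left-invariant vector fields on $G$;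 the left-invariant complex structure induces $I$ on $\mathfrak{g}$, and $\mathfrak{g}^{\mathbb{C}}=\mathfrak{g}\otimes\mathbb{C}=\mathfrak{g}^{1,0}\oplus\mathfrak{g}^{0,1}$ is the decomposition into the $\pm\sqrt{-1}$-eigenspaces of $I$; $\mathfrak{g}^{1,0}\cong T^{1,0}_eG$. The bar denotes conjugation $\mathfrak{g}^{1,0}\leftrightarrow\mathfrak{g}^{0,1}$; $x^{1,0},x^{0,1}$ are the components of $x\in\mathfrak{g}^{\mathbb{C}}$. $F$ is left-invariant if $F((L_g)_*v)=F(v)$ for all $g\in G$. Using a left-invariant frame $\{e_i\}$ coming from a basis of $\mathfrak{g}^{1,0}$, the functions $g_{i\bar\jmath}$, $g_{ij}$, $C_{i\bar\jmath l}$, $C_{i\bar\jmath\bar l}$, the connection coefficients $\Gamma^i_{jk}$, $\Gamma^i_{j\bar k}$ and the curvature coefficients ${}^2R^i_{\;l\bar\jmath k}$ of $F$ (taken with $M=G$) depend only on $v\in\mathfrak{g}^{1,0}\setminus\{0\}$, and $B$, $K$, $R$ are regarded as defined on $\mathfrak{g}^{1,0}\setminus\{0\}$. Put $\mathcal{S}_v(u,w)=g_{ij}(v)u^iw^j$ and $\bar{\mathcal{S}}_v(u,w)=\overline{\mathcal{S}_v(u,w)}$ for $u,w\in\mathfrak{g}^{1,0}$. The connection operator $\mathcal{N}:\mathfrak{g}^{1,0}\to\mathfrak{g}^{1,0}$ (depending on $v$) is the complex-linear map defined by $$g_v(\mathcal{N}(w),u)=g_v(v,[u,\bar w]^{1,0})+\bar{\mathcal{S}}_v(u,[v,\bar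 w]^{1,0}),\qquad u,w\in\mathfrak{g}^{1,0},$$ and $\bar{\mathcal{N}}(\bar w)=\overline{\mathcal{N}(w)}\in\mathfrak{g}^{0,1}$. $\mathcal{D}$ is the flat connection on $\mathfrak{g}^{1,0}\setminus\{0\}$ given by directional derivative in the variable $v$: for a smooth function $f=f^je_j:\mathfrak{g}^{1,0}\setminus\{0\}\to\mathfrak{g}^{1,0}$ and $x=x^ie_i\in\mathfrak{g}^{1,0}$, $$\mathcal{D}_xf=x^i\frac{\partial f^j}{\partial v^i}e_j,\qquad \mathcal{D}_{\bar x}f=\bar x^i\frac{\partial f^j}{\partial\bar v^i}e_j.$$ In $\mathcal{D}(\mathcal{N}(w))$ the vector $w$ is held constant. *)

theory Defs
  imports "HOL-Analysis.Analysis" "HOL-Algebra.Group"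
begin

section \<open>Smooth and holomorphic maps between open sets\<close>

text \<open>Both notions are only used on open sets.\<close>

primrec Ck_on :: "nat \<Rightarrow> 'a::real_normed_vector set \<Rightarrow> ('a \<Rightarrow> 'b::real_normed_vector) \<Rightarrow> bool" where
  "Ck_on 0 S f \<longleftrightarrow> continuous_on S f"
| "Ck_on (Suc k) S f \<longleftrightarrow>
     (\<forall>x\<in>S. f differentiable (at x)) \<and> (\<forall>h. Ck_on k S (\<lambda>x. frechet_derivative f (at x) h))"

definition smooth_on :: "'a::real_normed_vector set \<Rightarrow> ('a \<Rightarrow> 'b::real_normed_vector) \<Rightarrow> bool" where
  "smooth_on S f \<longleftrightarrow> (\<forall>k. Ck_on k S f)"

text \<open>Smoothness is automatic for maps with complex linear differential. It is part of the
  definition so that the underlying smooth structure of a complex manifold is at hand directly.\<close>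

definition holo_on :: "(complex^'n) set \<Rightarrow> (complex^'n \<Rightarrow> complex^'n) \<Rightarrow> bool" where
  "holo_on S f \<longleftrightarrow> smooth_on S f \<and>
     (\<forall>x\<in>S. \<forall>(a::complex) h. frechet_derivative f (at x) (a *s h) = a *s frechet_derivative f (at x) h)"


section \<open>Manifolds\<close>

text \<open>A chart is a pair of its domain and the coordinate map.\<close>

type_synonym ('m, 'e) chart = "'m set \<times> ('m \<Rightarrow> 'e)"

definition chart_inv :: "('m, 'e) chart \<Rightarrow> 'e \<Rightarrow> 'm" where
  "chart_inv c = inv_into (fst c) (snd c)"

definition is_chart :: "('m::topological_space, 'e::real_normed_vector) chart \<Rightarrow> bool" where
  "is_chart c \<longleftrightarrow> open (fst c) \<and> open (snd c ` fst c) \<and>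
     homeomorphism (fst c) (snd c ` fst c) (snd c) (chart_inv c)"

definition complex_atlas :: "('m::topological_space, complex^'n) chart set \<Rightarrow> bool" where
  "complex_atlas A \<longleftrightarrow> (\<forall>c\<in>A. is_chart c) \<and> (\<Union>c\<in>A. fst c) = UNIV \<and>
     (\<forall>c\<in>A. \<forall>d\<in>A. holo_on (snd c ` (fst c \<inter> fst d)) (snd d \<circ> chart_inv c))"

definition prod_atlas :: "('m, 'e) chart set \<Rightarrow> ('k, 'f) chart set \<Rightarrow> ('m \<times> 'k, 'e \<times> 'f) chart set" where
  "prod_atlas A B = {(fst c \<times> fst d, map_prod (snd c) (snd d)) | c d. c \<in> A \<and> d \<in> B}"

definition smooth_map ::
  "('m::topological_space, 'e::real_normed_vector) chart set \<Rightarrow>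
   ('k::topological_space, 'f::real_normed_vector) chart set \<Rightarrow> ('m \<Rightarrow> 'k) \<Rightarrow> bool" where
  "smooth_map A B f \<longleftrightarrow> continuous_on UNIV f \<and>
     (\<forall>c\<in>A. \<forall>d\<in>B. smooth_on (snd c ` (fst c \<inter> f -` fst d)) (snd d \<circ> f \<circ> chart_inv c))"

definition holo_map ::
  "('m::topological_space, complex^'n) chart set \<Rightarrow>
   ('k::topological_space, complex^'n) chart set \<Rightarrow> ('m \<Rightarrow> 'k) \<Rightarrow> bool" where
  "holo_map A B f \<longleftrightarrow> continuous_on UNIV f \<and>
     (\<forall>c\<in>A. \<forall>d\<in>B. holo_on (snd c ` (fst c \<inter> f -` fst d)) (snd d \<circ> f \<circ> chart_inv c))"


section \<open>Real tangent vectors and vector fields\<close>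

text \<open>The real tangent space at \<open>p\<close> is identified with the model space by means of one
  selected chart \<open>chart_at A p\<close> around \<open>p\<close>. For a complex manifold, the vector
  \<open>x :: complex^'n\<close> at \<open>p\<close> is the real vector with components \<open>Re (x $ k)\<close>, \<open>Im (x $ k)\<close> with
  respect to the real coordinates \<open>Re z\<^sup>k\<close>, \<open>Im z\<^sup>k\<close> of that chart.\<close>

definition chart_at :: "('m, 'e) chart set \<Rightarrow> 'm \<Rightarrow> ('m, 'e) chart" where
  "chart_at A p = (SOME c. c \<in> A \<and> p \<in> fst c)"

definition tangent_map ::
  "('m, 'e::real_normed_vector) chart set \<Rightarrow> ('m \<Rightarrow> 'm) \<Rightarrow> 'm \<Rightarrow> 'e \<Rightarrow> 'e" where
  "tangent_map A f p =
     frechet_derivative (snd (chart_at A (f p)) \<circ> f \<circ> chart_inv (chart_at A p))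
       (at (snd (chart_at A p) p))"

text \<open>Passing between a tangent vector and its components in an arbitrary chart \<open>c\<close>.\<close>

definition to_chart :: "('m, 'e::real_normed_vector) chart set \<Rightarrow> ('m, 'e) chart \<Rightarrow> 'm \<Rightarrow> 'e \<Rightarrow> 'e" where
  "to_chart A c p =
     frechet_derivative (snd c \<circ> chart_inv (chart_at A p)) (at (snd (chart_at A p) p))"

definition from_chart :: "('m, 'e::real_normed_vector) chart set \<Rightarrow> ('m, 'e) chart \<Rightarrow> 'e \<Rightarrow> 'e \<Rightarrow> 'e" where
  "from_chart A c z = frechet_derivative (snd (chart_at A (chart_inv c z)) \<circ> chart_inv c) (at z)"

definition field_in_chart ::
  "('m, 'e::real_normed_vector) chart set \<Rightarrow> ('m, 'e) chart \<Rightarrow> ('m \<Rightarrow> 'e) \<Rightarrow> 'e \<Rightarrow> 'e" where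
  "field_in_chart A c X z = to_chart A c (chart_inv c z) (X (chart_inv c z))"

definition field_bracket ::
  "('m, 'e::real_normed_vector) chart set \<Rightarrow> ('m \<Rightarrow> 'e) \<Rightarrow> ('m \<Rightarrow> 'e) \<Rightarrow> 'm \<Rightarrow> 'e" where
  "field_bracket A X Y p =
     (let c = chart_at A p; z = snd c p; X' = field_in_chart A c X; Y' = field_in_chart A c Y
      in frechet_derivative Y' (at z) (X' z) - frechet_derivative X' (at z) (Y' z))"


section \<open>Complexified tangent spaces\<close>

text \<open>The pair \<open>(x, y)\<close> stands for \<open>x + \<surd>-1 y\<close> in the complexification of a real vector space.\<close>

type_synonym 'a cplx = "'a \<times> 'a"

definition cscale :: "complex \<Rightarrow> 'a::real_vector cplx \<Rightarrow> 'a cplx" where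
  "cscale a \<xi> = (Re a *\<^sub>R fst \<xi> - Im a *\<^sub>R snd \<xi>, Re a *\<^sub>R snd \<xi> + Im a *\<^sub>R fst \<xi>)"

definition cbar :: "'a::real_vector cplx \<Rightarrow> 'a cplx" where
  "cbar \<xi> = (fst \<xi>, - snd \<xi>)"

definition cx_ext :: "('a \<Rightarrow> 'b) \<Rightarrow> 'a cplx \<Rightarrow> 'b cplx" where
  "cx_ext f = map_prod f f"

text \<open>The complex structure on the real tangent space and its \<open>\<plusminus>\<surd>-1\<close>-eigenspaces in the
  complexification. Charts being holomorphic, the complex structure is multiplication by
  \<open>\<i>\<close> in coordinates.\<close>

definition Icx :: "complex^'n \<Rightarrow> complex^'n" where
  "Icx x = \<i> *s x"

definition T10 :: "(complex^'n) cplx set" where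
  "T10 = {\<xi>. cx_ext Icx \<xi> = cscale \<i> \<xi>}"

definition T01 :: "(complex^'n) cplx set" where
  "T01 = {\<xi>. cx_ext Icx \<xi> = cscale (- \<i>) \<xi>}"

definition part10 :: "(complex^'n) cplx \<Rightarrow> (complex^'n) cplx" where
  "part10 \<xi> = cscale (1/2) (\<xi> - cscale \<i> (cx_ext Icx \<xi>))"

definition part01 :: "(complex^'n) cplx \<Rightarrow> (complex^'n) cplx" where
  "part01 \<xi> = cscale (1/2) (\<xi> + cscale \<i> (cx_ext Icx \<xi>))"

lemma part10_in_T10: "part10 \<xi> \<in> T10"
  by (cases \<xi>) (simp add: T10_def part10_def cscale_def cx_ext_def Icx_def vec_eq_iff complex_eq_iff field_simps)

lemma part01_in_T01: "part01 \<xi> \<in> T01"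
  by (cases \<xi>) (simp add: T01_def part01_def cscale_def cx_ext_def Icx_def vec_eq_iff complex_eq_iff field_simps)

lemma part10_plus_part01: "part10 \<xi> + part01 \<xi> = \<xi>"
  by (cases \<xi>) (simp add: part10_def part01_def cscale_def cx_ext_def Icx_def vec_eq_iff complex_eq_iff field_simps)

text \<open>\<open>vec10 a\<close> is \<open>\<Sum>\<^sub>k a\<^sup>k \<partial>/\<partial>z\<^sup>k\<close>: since \<open>\<partial>/\<partial>z\<^sup>k = (\<partial>/\<partial>x\<^sup>k - \<surd>-1 \<partial>/\<partial>y\<^sup>k)/2\<close>, it is the
  (1,0)-component of the real vector with complex components \<open>a\<^sup>k\<close>.\<close>

definition vec10 :: "complex^'n \<Rightarrow> (complex^'n) cplx" where
  "vec10 a = part10 (a, 0)"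

text \<open>Bases of \<open>T10\<close>, the vector with given components, and the components of a vector.\<close>

definition comb :: "('n \<Rightarrow> (complex^'n) cplx) \<Rightarrow> complex^'n \<Rightarrow> (complex^'n) cplx" where
  "comb b u = (\<Sum>i\<in>UNIV. cscale (u $ i) (b i))"

definition is_basis10 :: "('n \<Rightarrow> (complex^'n) cplx) \<Rightarrow> bool" where
  "is_basis10 b \<longleftrightarrow> (\<forall>i. b i \<in> T10) \<and> (\<forall>\<xi>\<in>T10. \<exists>!u. comb b u = \<xi>)"

definition comps :: "('n \<Rightarrow> (complex^'n) cplx) \<Rightarrow> (complex^'n) cplx \<Rightarrow> complex^'n" where
  "comps b \<xi> = (THE u. comb b u = \<xi>)"


section \<open>Complex Finsler metrics\<close>

definition wd :: "'n \<Rightarrow> (complex^'n \<Rightarrow> complex) \<Rightarrow> complex^'n \<Rightarrow> complex" where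
  "wd i f v = (frechet_derivative f (at v) (axis i 1)
                 - \<i> * frechet_derivative f (at v) (axis i \<i>)) / 2"

definition wdbar :: "'n \<Rightarrow> (complex^'n \<Rightarrow> complex) \<Rightarrow> complex^'n \<Rightarrow> complex" where
  "wdbar i f v = (frechet_derivative f (at v) (axis i 1)
                    + \<i> * frechet_derivative f (at v) (axis i \<i>)) / 2"

text \<open>In the following six definitions, \<open>\<Phi>\<close> is the restriction of \<open>F\<close> to one fibre \<open>T10\<close>,
  \<open>b\<close> is a basis of the fibre and \<open>v\<close> consists of the fibre coordinates with respect to \<open>b\<close>.\<close>

definition fsq :: "((complex^'n) cplx \<Rightarrow> real) \<Rightarrow> ('n \<Rightarrow> (complex^'n) cplx) \<Rightarrow> complex^'n \<Rightarrow> complex" where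
  "fsq \<Phi> b v = complex_of_real ((\<Phi> (comb b v))\<^sup>2)"

definition g_bar ::
  "((complex^'n) cplx \<Rightarrow> real) \<Rightarrow> ('n \<Rightarrow> (complex^'n) cplx) \<Rightarrow> 'n \<Rightarrow> 'n \<Rightarrow> complex^'n \<Rightarrow> complex" where
  "g_bar \<Phi> b i j v = wd i (wdbar j (fsq \<Phi> b)) v"

definition g_hol ::
  "((complex^'n) cplx \<Rightarrow> real) \<Rightarrow> ('n \<Rightarrow> (complex^'n) cplx) \<Rightarrow> 'n \<Rightarrow> 'n \<Rightarrow> complex^'n \<Rightarrow> complex" where
  "g_hol \<Phi> b i j v = wd i (wd j (fsq \<Phi> b)) v"

definition C_hol ::
  "((complex^'n) cplx \<Rightarrow> real) \<Rightarrow> ('n \<Rightarrow> (complex^'n) cplx) \<Rightarrow> 'n \<Rightarrow> 'n \<Rightarrow> 'n \<Rightarrow> complex^'n \<Rightarrow> complex" where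
  "C_hol \<Phi> b i j l v = wd i (wdbar j (wd l (fsq \<Phi> b))) v"

definition C_bar ::
  "((complex^'n) cplx \<Rightarrow> real) \<Rightarrow> ('n \<Rightarrow> (complex^'n) cplx) \<Rightarrow> 'n \<Rightarrow> 'n \<Rightarrow> 'n \<Rightarrow> complex^'n \<Rightarrow> complex" where
  "C_bar \<Phi> b i j l v = wd i (wdbar j (wdbar l (fsq \<Phi> b))) v"

definition gform ::
  "((complex^'n) cplx \<Rightarrow> real) \<Rightarrow> ('n \<Rightarrow> (complex^'n) cplx) \<Rightarrow>
   (complex^'n) cplx \<Rightarrow> (complex^'n) cplx \<Rightarrow> (complex^'n) cplx \<Rightarrow> complex" where
  "gform \<Phi> b v u w =
     (\<Sum>i\<in>UNIV. \<Sum>j\<in>UNIV. g_bar \<Phi> b i j (comps b v) * comps b u $ i * cnj (comps b w $ j))"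

definition sform ::
  "((complex^'n) cplx \<Rightarrow> real) \<Rightarrow> ('n \<Rightarrow> (complex^'n) cplx) \<Rightarrow>
   (complex^'n) cplx \<Rightarrow> (complex^'n) cplx \<Rightarrow> (complex^'n) cplx \<Rightarrow> complex" where
  "sform \<Phi> b v u w =
     (\<Sum>i\<in>UNIV. \<Sum>j\<in>UNIV. g_hol \<Phi> b i j (comps b v) * comps b u $ i * comps b w $ j)"

text \<open>A function \<open>F\<close> on the bundle \<open>T\<^sup>1\<^sup>,\<^sup>0M\<close> is written \<open>F p \<xi>\<close>, only its values for \<open>\<xi> \<in> T10\<close>
  being relevant. \<open>metric_in_chart A F c\<close> is \<open>F\<close> in the bundle coordinates \<open>(z, a)\<close> of the chart
  \<open>c\<close>, that is, at the vector \<open>\<Sum>\<^sub>k a\<^sup>k \<partial>/\<partial>z\<^sup>k\<close>.\<close>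

definition metric_in_chart ::
  "('m, complex^'n) chart set \<Rightarrow> ('m \<Rightarrow> (complex^'n) cplx \<Rightarrow> real) \<Rightarrow> ('m, complex^'n) chart \<Rightarrow>
   (complex^'n) \<times> (complex^'n) \<Rightarrow> real" where
  "metric_in_chart A F c = (\<lambda>(z, a). F (chart_inv c z) (cx_ext (from_chart A c z) (vec10 a)))"

definition complex_finsler_metric ::
  "('m, complex^'n) chart set \<Rightarrow> ('m \<Rightarrow> (complex^'n) cplx \<Rightarrow> real) \<Rightarrow> bool" where
  "complex_finsler_metric A F \<longleftrightarrow>
     (\<forall>p. \<forall>\<xi>\<in>T10. 0 \<le> F p \<xi>) \<and>
     (\<forall>c\<in>A. continuous_on ((snd c ` fst c) \<times> UNIV) (metric_in_chart A F c) \<and>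
             smooth_on ((snd c ` fst c) \<times> (UNIV - {0})) (metric_in_chart A F c)) \<and>
     (\<forall>p a. \<forall>\<xi>\<in>T10. F p (cscale a \<xi>) = cmod a * F p \<xi>)"

definition strongly_pseudoconvex :: "('m \<Rightarrow> (complex^'n) cplx \<Rightarrow> real) \<Rightarrow> bool" where
  "strongly_pseudoconvex F \<longleftrightarrow>
     (\<forall>p v u. v \<noteq> 0 \<longrightarrow> u \<noteq> 0 \<longrightarrow>
        (let q = (\<Sum>i\<in>UNIV. \<Sum>j\<in>UNIV.
                    g_bar (F p) (\<lambda>k. vec10 (axis k 1)) i j v * u $ i * cnj (u $ j))
         in Im q = 0 \<and> 0 < Re q))"


section \<open>The complex Chern-Rund connection and its curvature\<close>

text \<open>Let \<open>c\<close> be a chart of \<open>M\<close> and \<open>E\<close> a local frame, \<open>E i p\<close> being the value of the \<open>i\<close>-th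
  field at \<open>p\<close>. The part of the slit bundle over the domain of \<open>c\<close> has the smooth coordinates
  \<open>x = (z, v)\<close>, with \<open>z\<close> the coordinates of the base point in the chart \<open>c\<close> and \<open>v\<close> the fibre
  coordinates with respect to the frame. A real tangent vector \<open>X\<close> to the slit bundle is given in
  these coordinates, and complex valued 1-forms and 2-forms are functions
  \<open>\<alpha> x X\<close> and \<open>\<Omega> x X Y\<close> of real tangent vectors.\<close>

type_synonym 'n slit = "(complex^'n) \<times> (complex^'n)"

definition frame_at :: "('n \<Rightarrow> 'm \<Rightarrow> 'v) \<Rightarrow> 'm \<Rightarrow> 'n \<Rightarrow> 'v" where
  "frame_at E p = (\<lambda>i. E i p)"

definition base_pt :: "('m, complex^'n) chart \<Rightarrow> 'n slit \<Rightarrow> 'm" where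
  "base_pt c x = chart_inv c (fst x)"

definition wedge :: "('v \<Rightarrow> complex) \<Rightarrow> ('v \<Rightarrow> complex) \<Rightarrow> 'v \<Rightarrow> 'v \<Rightarrow> complex" where
  "wedge \<alpha> \<beta> X Y = \<alpha> X * \<beta> Y - \<alpha> Y * \<beta> X"

definition ext_d :: "('v::real_normed_vector \<Rightarrow> 'v \<Rightarrow> complex) \<Rightarrow> 'v \<Rightarrow> 'v \<Rightarrow> 'v \<Rightarrow> complex" where
  "ext_d \<alpha> x X Y =
     frechet_derivative (\<lambda>y. \<alpha> y Y) (at x) X - frechet_derivative (\<lambda>y. \<alpha> y X) (at x) Y"

text \<open>The dual coframe of (1,0)-forms, pulled back to the slit bundle: \<open>coframe10 A E c i\<close> is
  \<open>\<phi>\<^sup>i\<close>.\<close>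

definition coframe10 ::
  "('m, complex^'n) chart set \<Rightarrow> ('n \<Rightarrow> 'm \<Rightarrow> (complex^'n) cplx) \<Rightarrow> ('m, complex^'n) chart \<Rightarrow>
   'n \<Rightarrow> 'n slit \<Rightarrow> 'n slit \<Rightarrow> complex" where
  "coframe10 A E c i x X =
     comps (frame_at E (base_pt c x)) (part10 (from_chart A c (fst x) (fst X), 0)) $ i"

text \<open>At a fixed point, let \<open>\<phi>\<close> be the values of the coframe and let \<open>\<Gamma>\<close> consist of the
  coefficients of \<open>\<phi>\<^sup>k\<close> (first component) and of the conjugate of \<open>\<phi>\<^sup>k\<close> (second component). The
  horizontal form \<open>\<omega>\<^sup>i\<^sub>j\<close> is \<open>conn_form \<phi> \<Gamma> i j\<close>, and \<open>vert_form \<phi> \<Gamma> v i\<close> is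
  \<open>dv\<^sup>i + v\<^sup>j \<omega>\<^sup>i\<^sub>j\<close>.\<close>

type_synonym 'n conn_coeffs = "('n \<Rightarrow> 'n \<Rightarrow> 'n \<Rightarrow> complex) \<times> ('n \<Rightarrow> 'n \<Rightarrow> 'n \<Rightarrow> complex)"

definition conn_form ::
  "('n \<Rightarrow> 'n slit \<Rightarrow> complex) \<Rightarrow> 'n conn_coeffs \<Rightarrow> 'n \<Rightarrow> 'n \<Rightarrow> 'n slit \<Rightarrow> complex" where
  "conn_form \<phi> \<Gamma> i j X = (\<Sum>k\<in>UNIV. fst \<Gamma> i j k * \<phi> k X + snd \<Gamma> i j k * cnj (\<phi> k X))"

definition vert_form ::
  "('n \<Rightarrow> 'n slit \<Rightarrow> complex) \<Rightarrow> 'n conn_coeffs \<Rightarrow> complex^'n \<Rightarrow> 'n \<Rightarrow> 'n slit \<Rightarrow> complex" where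
  "vert_form \<phi> \<Gamma> v i X = snd X $ i + (\<Sum>j\<in>UNIV. v $ j * conn_form \<phi> \<Gamma> i j X)"

datatype 'n cof_index = Hor 'n | HorBar 'n | Ver 'n | VerBar 'n

instance cof_index :: (finite) finite
proof
  have "x \<in> range Hor \<union> range HorBar \<union> range Ver \<union> range VerBar" for x :: "'a cof_index"
    by (cases x) simp_all
  then have "(UNIV :: 'a cof_index set) = range Hor \<union> range HorBar \<union> range Ver \<union> range VerBar"
    by blast
  then show "finite (UNIV :: 'a cof_index set)"
    by (metis finite_UnI finite_imageI finite)
qed

definition full_coframe ::
  "('n \<Rightarrow> 'n slit \<Rightarrow> complex) \<Rightarrow> ('n \<Rightarrow> 'n slit \<Rightarrow> complex) \<Rightarrow> 'n cof_index \<Rightarrow> 'n slit \<Rightarrow> complex" where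
  "full_coframe \<phi> \<psi> a X =
     (case a of Hor i \<Rightarrow> \<phi> i X | HorBar i \<Rightarrow> cnj (\<phi> i X) | Ver i \<Rightarrow> \<psi> i X | VerBar i \<Rightarrow> cnj (\<psi> i X))"

text \<open>The coefficient of \<open>\<theta>\<^sub>a \<and> \<theta>\<^sub>b\<close> in a 2-form \<open>\<Omega>\<close>: in the expansion
  \<open>\<Omega> = 1/2 \<Sum> K\<^sub>a\<^sub>b \<theta>\<^sub>a \<and> \<theta>\<^sub>b\<close> with antisymmetric \<open>K\<close>, the two terms for \<open>(a, b)\<close> and \<open>(b, a)\<close>
  add up to \<open>K\<^sub>a\<^sub>b \<theta>\<^sub>a \<and> \<theta>\<^sub>b\<close>.\<close>

definition coeff2 ::
  "('a::finite \<Rightarrow> 'v \<Rightarrow> complex) \<Rightarrow> ('v \<Rightarrow> 'v \<Rightarrow> complex) \<Rightarrow> 'a \<Rightarrow> 'a \<Rightarrow> complex" where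
  "coeff2 \<theta> \<Omega> =
     (THE K. (\<forall>a b. K b a = - K a b) \<and>
             (\<forall>X Y. \<Omega> X Y = (1/2) * (\<Sum>a\<in>UNIV. \<Sum>b\<in>UNIV. K a b * wedge (\<theta> a) (\<theta> b) X Y)))"

text \<open>The two structure equations (a) and (b) at the point \<open>x\<close>. The torsion forms are
  horizontal, so the (1,1)-component of \<open>\<tau>\<^sup>i\<close> is given by the coefficients of \<open>\<phi>\<^sup>k\<close> wedge
  the conjugate of \<open>\<phi>\<^sup>j\<close>. Both equations only involve the values of the connection forms at \<open>x\<close>,
  hence determine the coefficients pointwise.\<close>

definition chern_rund_eqs ::
  "('m, complex^'n) chart set \<Rightarrow> ('m \<Rightarrow> (complex^'n) cplx \<Rightarrow> real) \<Rightarrow>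
   ('n \<Rightarrow> 'm \<Rightarrow> (complex^'n) cplx) \<Rightarrow> ('m, complex^'n) chart \<Rightarrow> 'n slit \<Rightarrow> 'n conn_coeffs \<Rightarrow> bool" where
  "chern_rund_eqs A F E c x \<Gamma> \<longleftrightarrow>
     (let \<phi> = (\<lambda>i. coframe10 A E c i x);
          \<omega> = conn_form \<phi> \<Gamma>;
          \<psi> = vert_form \<phi> \<Gamma> (snd x);
          \<tau> = (\<lambda>i X Y. ext_d (coframe10 A E c i) x X Y - (\<Sum>j\<in>UNIV. wedge (\<phi> j) (\<omega> i j) X Y));
          \<Phi> = F (base_pt c x);
          b = frame_at E (base_pt c x)
      in (\<forall>i k j. coeff2 (full_coframe \<phi> \<psi>) (\<tau> i) (Hor k) (HorBar j) = 0) \<and>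
         (\<forall>i j X.
            frechet_derivative
              (\<lambda>y. g_bar (F (base_pt c y)) (frame_at E (base_pt c y)) i j (snd y)) (at x) X
            = (\<Sum>l\<in>UNIV. g_bar \<Phi> b l j (snd x) * \<omega> l i X
                        + g_bar \<Phi> b i l (snd x) * cnj (\<omega> l j X)
                        + C_hol \<Phi> b i j l (snd x) * \<psi> l X
                        + C_bar \<Phi> b i j l (snd x) * cnj (\<psi> l X))))"

definition chern_rund_coeffs ::
  "('m, complex^'n) chart set \<Rightarrow> ('m \<Rightarrow> (complex^'n) cplx \<Rightarrow> real) \<Rightarrow>
   ('n \<Rightarrow> 'm \<Rightarrow> (complex^'n) cplx) \<Rightarrow> ('m, complex^'n) chart \<Rightarrow> 'n slit \<Rightarrow> 'n conn_coeffs" where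
  "chern_rund_coeffs A F E c x = (THE \<Gamma>. chern_rund_eqs A F E c x \<Gamma>)"

definition chern_rund_form ::
  "('m, complex^'n) chart set \<Rightarrow> ('m \<Rightarrow> (complex^'n) cplx \<Rightarrow> real) \<Rightarrow>
   ('n \<Rightarrow> 'm \<Rightarrow> (complex^'n) cplx) \<Rightarrow> ('m, complex^'n) chart \<Rightarrow>
   'n \<Rightarrow> 'n \<Rightarrow> 'n slit \<Rightarrow> 'n slit \<Rightarrow> complex" where
  "chern_rund_form A F E c i j x =
     conn_form (\<lambda>k. coframe10 A E c k x) (chern_rund_coeffs A F E c x) i j"

definition chern_rund_coframe ::
  "('m, complex^'n) chart set \<Rightarrow> ('m \<Rightarrow> (complex^'n) cplx \<Rightarrow> real) \<Rightarrow>
   ('n \<Rightarrow> 'm \<Rightarrow> (complex^'n) cplx) \<Rightarrow> ('m, complex^'n) chart \<Rightarrow>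
   'n slit \<Rightarrow> 'n cof_index \<Rightarrow> 'n slit \<Rightarrow> complex" where
  "chern_rund_coframe A F E c x =
     (let \<phi> = (\<lambda>i. coframe10 A E c i x)
      in full_coframe \<phi> (vert_form \<phi> (chern_rund_coeffs A F E c x) (snd x)))"

definition curv_form ::
  "('m, complex^'n) chart set \<Rightarrow> ('m \<Rightarrow> (complex^'n) cplx \<Rightarrow> real) \<Rightarrow>
   ('n \<Rightarrow> 'm \<Rightarrow> (complex^'n) cplx) \<Rightarrow> ('m, complex^'n) chart \<Rightarrow>
   'n \<Rightarrow> 'n \<Rightarrow> 'n slit \<Rightarrow> 'n slit \<Rightarrow> 'n slit \<Rightarrow> complex" where
  "curv_form A F E c i j x X Y =
     ext_d (chern_rund_form A F E c i j) x X Y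
     - (\<Sum>k\<in>UNIV. wedge (chern_rund_form A F E c k j x) (chern_rund_form A F E c i k x) X Y)"

text \<open>\<open>curv_coeff A F E c i l j k x\<close> is the coefficient of (conjugate of \<open>\<phi>\<^sup>j\<close>) wedge \<open>\<phi>\<^sup>k\<close>
  in \<open>\<Omega>\<^sup>i\<^sub>l\<close>.\<close>

definition curv_coeff ::
  "('m, complex^'n) chart set \<Rightarrow> ('m \<Rightarrow> (complex^'n) cplx \<Rightarrow> real) \<Rightarrow>
   ('n \<Rightarrow> 'm \<Rightarrow> (complex^'n) cplx) \<Rightarrow> ('m, complex^'n) chart \<Rightarrow>
   'n \<Rightarrow> 'n \<Rightarrow> 'n \<Rightarrow> 'n \<Rightarrow> 'n slit \<Rightarrow> complex" where
  "curv_coeff A F E c i l j k x =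
     - coeff2 (chern_rund_coframe A F E c x) (curv_form A F E c i l x) (Hor k) (HorBar j)"

text \<open>\<open>curv_op A F E c p v X Y W\<close> is \<open>R(X, cbar Y) W\<close> at the point \<open>v\<close> of the fibre over \<open>p\<close>, and
  \<open>curv4 A F E c p v W Z X Y\<close> is \<open>R(W, cbar Z, X, cbar Y)\<close>, for \<open>X, Y, W, Z \<in> T10\<close>.\<close>

definition curv_op ::
  "('m, complex^'n) chart set \<Rightarrow> ('m \<Rightarrow> (complex^'n) cplx \<Rightarrow> real) \<Rightarrow>
   ('n \<Rightarrow> 'm \<Rightarrow> (complex^'n) cplx) \<Rightarrow> ('m, complex^'n) chart \<Rightarrow> 'm \<Rightarrow> (complex^'n) cplx \<Rightarrow>
   (complex^'n) cplx \<Rightarrow> (complex^'n) cplx \<Rightarrow> (complex^'n) cplx \<Rightarrow> (complex^'n) cplx" where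
  "curv_op A F E c p v X Y W =
     (let b = frame_at E p; x = (snd c p, comps b v)
      in comb b (\<chi> i. \<Sum>l\<in>UNIV. \<Sum>k\<in>UNIV. \<Sum>j\<in>UNIV.
           comps b W $ l * comps b X $ k * cnj (comps b Y $ j) * curv_coeff A F E c i l j k x))"

definition curv4 ::
  "('m, complex^'n) chart set \<Rightarrow> ('m \<Rightarrow> (complex^'n) cplx \<Rightarrow> real) \<Rightarrow>
   ('n \<Rightarrow> 'm \<Rightarrow> (complex^'n) cplx) \<Rightarrow> ('m, complex^'n) chart \<Rightarrow> 'm \<Rightarrow> (complex^'n) cplx \<Rightarrow>
   (complex^'n) cplx \<Rightarrow> (complex^'n) cplx \<Rightarrow> (complex^'n) cplx \<Rightarrow> (complex^'n) cplx \<Rightarrow> complex" where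
  "curv4 A F E c p v W Z X Y =
     gform (F p) (frame_at E p) v (curv_op A F E c p v X Y W) Z"

definition hol_bisectional_curv ::
  "('m, complex^'n) chart set \<Rightarrow> ('m \<Rightarrow> (complex^'n) cplx \<Rightarrow> real) \<Rightarrow>
   ('n \<Rightarrow> 'm \<Rightarrow> (complex^'n) cplx) \<Rightarrow> ('m, complex^'n) chart \<Rightarrow> 'm \<Rightarrow>
   (complex^'n) cplx \<Rightarrow> (complex^'n) cplx \<Rightarrow> complex" where
  "hol_bisectional_curv A F E c p v w =
     curv4 A F E c p v v v w w
       / (gform (F p) (frame_at E p) v v v * gform (F p) (frame_at E p) v w w)"

definition hol_sectional_curv ::
  "('m, complex^'n) chart set \<Rightarrow> ('m \<Rightarrow> (complex^'n) cplx \<Rightarrow> real) \<Rightarrow>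
   ('n \<Rightarrow> 'm \<Rightarrow> (complex^'n) cplx) \<Rightarrow> ('m, complex^'n) chart \<Rightarrow> 'm \<Rightarrow>
   (complex^'n) cplx \<Rightarrow> complex" where
  "hol_sectional_curv A F E c p v =
     2 * curv4 A F E c p v v v v v / complex_of_real ((F p v) ^ 4)"


section \<open>Lie groups with left-invariant complex structure\<close>

text \<open>The smooth structure of the Lie group is the one underlying the complex manifold.\<close>

definition lie_group ::
  "('g::topological_space) monoid \<Rightarrow> ('g, 'e::real_normed_vector) chart set \<Rightarrow> bool" where
  "lie_group G A \<longleftrightarrow> group G \<and> carrier G = UNIV \<and>
     smooth_map (prod_atlas A A) A (\<lambda>(x, y). x \<otimes>\<^bsub>G\<^esub> y) \<and> smooth_map A A (\<lambda>x. inv\<^bsub>G\<^esub> x)"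

definition left_invariant_complex_structure ::
  "('g::topological_space) monoid \<Rightarrow> ('g, complex^'n) chart set \<Rightarrow> bool" where
  "left_invariant_complex_structure G A \<longleftrightarrow> (\<forall>g. holo_map A A (\<lambda>x. g \<otimes>\<^bsub>G\<^esub> x))"

definition left_invariant_metric ::
  "'g monoid \<Rightarrow> ('g, complex^'n) chart set \<Rightarrow> ('g \<Rightarrow> (complex^'n) cplx \<Rightarrow> real) \<Rightarrow> bool" where
  "left_invariant_metric G A F \<longleftrightarrow>
     (\<forall>g p. \<forall>\<xi>\<in>T10. F (g \<otimes>\<^bsub>G\<^esub> p) (cx_ext (tangent_map A (\<lambda>x. g \<otimes>\<^bsub>G\<^esub> x) p) \<xi>) = F p \<xi>)"

text \<open>The Lie algebra is the tangent space at the neutral element; \<open>left_field G A x\<close> is the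
  left-invariant vector field with value \<open>x\<close> there. The complexified Lie algebra consists of
  pairs as above, and its (1,0)-part is \<open>T10\<close>.\<close>

definition left_field :: "'g monoid \<Rightarrow> ('g, 'e::real_normed_vector) chart set \<Rightarrow> 'e \<Rightarrow> 'g \<Rightarrow> 'e" where
  "left_field G A x p = tangent_map A (\<lambda>q. p \<otimes>\<^bsub>G\<^esub> q) \<one>\<^bsub>G\<^esub> x"

definition lie_bracket :: "'g monoid \<Rightarrow> ('g, 'e::real_normed_vector) chart set \<Rightarrow> 'e \<Rightarrow> 'e \<Rightarrow> 'e" where
  "lie_bracket G A x y = field_bracket A (left_field G A x) (left_field G A y) \<one>\<^bsub>G\<^esub>"

definition cx_bracket ::
  "'g monoid \<Rightarrow> ('g, 'e::real_normed_vector) chart set \<Rightarrow> 'e cplx \<Rightarrow> 'e cplx \<Rightarrow> 'e cplx" where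
  "cx_bracket G A \<xi> \<eta> =
     (lie_bracket G A (fst \<xi>) (fst \<eta>) - lie_bracket G A (snd \<xi>) (snd \<eta>),
      lie_bracket G A (fst \<xi>) (snd \<eta>) + lie_bracket G A (snd \<xi>) (fst \<eta>))"

definition cx_left_field ::
  "'g monoid \<Rightarrow> ('g, 'e::real_normed_vector) chart set \<Rightarrow> 'e cplx \<Rightarrow> 'g \<Rightarrow> 'e cplx" where
  "cx_left_field G A \<xi> p = cx_ext (\<lambda>x. left_field G A x p) \<xi>"

definition left_frame ::
  "'g monoid \<Rightarrow> ('g, 'e::real_normed_vector) chart set \<Rightarrow> ('n \<Rightarrow> 'e cplx) \<Rightarrow> 'n \<Rightarrow> 'g \<Rightarrow> 'e cplx" where
  "left_frame G A e i = cx_left_field G A (e i)"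

text \<open>In the remaining definitions \<open>e\<close> is a basis of the (1,0)-part of the Lie algebra.
  \<open>conn_op G A F e v\<close> is the connection operator at \<open>v\<close>.\<close>

definition conn_op ::
  "'g monoid \<Rightarrow> ('g, complex^'n) chart set \<Rightarrow> ('g \<Rightarrow> (complex^'n) cplx \<Rightarrow> real) \<Rightarrow>
   ('n \<Rightarrow> (complex^'n) cplx) \<Rightarrow> (complex^'n) cplx \<Rightarrow> (complex^'n) cplx \<Rightarrow> (complex^'n) cplx" where
  "conn_op G A F e v w =
     (THE \<nu>. \<nu> \<in> T10 \<and>
        (\<forall>u\<in>T10. gform (F \<one>\<^bsub>G\<^esub>) e v \<nu> u =
           gform (F \<one>\<^bsub>G\<^esub>) e v v (part10 (cx_bracket G A u (cbar w)))
           + cnj (sform (F \<one>\<^bsub>G\<^esub>) e v u (part10 (cx_bracket G A v (cbar w))))))"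

text \<open>The directional derivatives \<open>\<D>\<^sub>x f\<close> for \<open>x\<close> of type (1,0) and \<open>\<D>\<^sub>y f\<close> for \<open>y\<close> of type (0,1),
  evaluated at \<open>v\<close>.\<close>

definition dir_deriv ::
  "('n \<Rightarrow> (complex^'n) cplx) \<Rightarrow> (complex^'n) cplx \<Rightarrow> ((complex^'n) cplx \<Rightarrow> (complex^'n) cplx) \<Rightarrow>
   (complex^'n) cplx \<Rightarrow> (complex^'n) cplx" where
  "dir_deriv e x f v =
     comb e (\<chi> j. \<Sum>i\<in>UNIV. comps e x $ i * wd i (\<lambda>u. comps e (f (comb e u)) $ j) (comps e v))"

definition dir_deriv_bar ::
  "('n \<Rightarrow> (complex^'n) cplx) \<Rightarrow> (complex^'n) cplx \<Rightarrow> ((complex^'n) cplx \<Rightarrow> (complex^'n) cplx) \<Rightarrow>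
   (complex^'n) cplx \<Rightarrow> (complex^'n) cplx" where
  "dir_deriv_bar e y f v =
     comb e (\<chi> j. \<Sum>i\<in>UNIV. cnj (comps e (cbar y) $ i)
                            * wdbar i (\<lambda>u. comps e (f (comb e u)) $ j) (comps e v))"

definition lie_curv ::
  "'g monoid \<Rightarrow> ('g, complex^'n) chart set \<Rightarrow> ('g \<Rightarrow> (complex^'n) cplx \<Rightarrow> real) \<Rightarrow>
   ('n \<Rightarrow> (complex^'n) cplx) \<Rightarrow> (complex^'n) cplx \<Rightarrow> (complex^'n) cplx \<Rightarrow> (complex^'n) cplx" where
  "lie_curv G A F e w v =
     (let N = conn_op G A F e; br = cx_bracket G A
      in dir_deriv e (part10 (br v (cbar w))) (\<lambda>u. N u w) v
         - dir_deriv_bar e (cbar (N v w)) (\<lambda>u. N u w) v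
         + N v (part10 (br w (cbar w)))
         - part10 (br (N v w) (cbar w))
         + part10 (br v (part01 (br (cbar w) w))))"

end

theory Submission
  imports Defs
begin

text \<open>In a left-invariant frame the metric coefficients depend on the fibre coordinate \<open>v\<close> only. The
  vanishing of the (1,1)-torsion makes the (0,1)-part of the connection forms the negative of the
  (1,0)-part of the bracket of a (1,0)-vector with a (0,1)-vector, and compatibility with the metric,
  contracted with \<open>v\<close>, gives \<open>v\<^sup>j \<omega>\<^sup>i\<^sub>j(w) = N(w)\<^sup>i - [v, cbar w]\<^sup>i\<close> by the Euler relations.
  Since \<open>v\<^sup>l \<Omega>\<^sup>i\<^sub>l = d(v\<^sup>j \<omega>\<^sup>i\<^sub>j) - \<psi>\<^sup>k \<and> \<omega>\<^sup>i\<^sub>k\<close> with \<open>\<psi>\<close> the vertical coframe, the contracted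
  curvature on horizontal vectors is the exterior derivative of this single form, which the
  Maurer--Cartan equation evaluates. For a complex valued two-form \<open>\<beta>\<close>, the coefficients of type (1,1)
  contracted with \<open>w\<close> and its conjugate amount to \<open>\<i>/2 \<beta>(w, \<i> w)\<close> on real horizontal lifts.\<close>


section \<open>Smooth functions and the symmetry of second derivatives\<close>

text \<open>The obstacle is that the metric equation is not solved for the connection: through
  \<open>vert_form\<close> it contains the contraction of the unknown forms with \<open>v\<close>,
  multiplied by third derivatives of the squared metric. Homogeneity breaks this circle. Contracting
  the equation with \<open>v\<close> annihilates the \<open>C_hol\<close> term and turns the
  \<open>C_bar\<close> term into second derivatives, so the contracted forms satisfy a system of
  their own, the defining equation of the connection operator. Fed back, they leave a linear system
  with the invertible matrix of \<open>g\<close>. Only the contracted forms are differentiated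
  explicitly; of the individual coefficients, which contain third derivatives, differentiability
  suffices, because both curvatures apply the curvature operator to \<open>v\<close> itself. Since
  connection coefficients and coefficients of two-forms are defined by \<open>THE\<close>, each is
  pinned down with uniqueness: the former by an equivalence, the latter by evaluation on a dual
  frame.\<close>

lemma frechet_derivative_eqI: "(f has_derivative f') (at x) \<Longrightarrow> frechet_derivative f (at x) = f'"
  using frechet_derivative_at by metis

lemma frechet_derivative_has_derivative:
  "f differentiable (at x) \<Longrightarrow> (f has_derivative frechet_derivative f (at x)) (at x)"
  by (simp add: frechet_derivative_works)

lemma frechet_derivative_cong_open:
  assumes "open S" "x \<in> S" "\<And>y. y \<in> S \<Longrightarrow> f y = g y"
  shows "frechet_derivative f (at x) = frechet_derivative g (at x)"
proof -
  have "(f has_derivative D) (at x) \<longleftrightarrow> (g has_derivative D) (at x)" for D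
    using assms has_derivative_transform_within_open[of f D x UNIV S g]
      has_derivative_transform_within_open[of g D x UNIV S f] by auto
  then show ?thesis by (simp add: frechet_derivative_def)
qed

lemma differentiable_cong_open:
  assumes "open S" "x \<in> S" "\<And>y. y \<in> S \<Longrightarrow> f y = g y"
  shows "f differentiable (at x) \<longleftrightarrow> g differentiable (at x)"
proof -
  have "(f has_derivative D) (at x) \<longleftrightarrow> (g has_derivative D) (at x)" for D
    using assms has_derivative_transform_within_open[of f D x UNIV S g]
      has_derivative_transform_within_open[of g D x UNIV S f] by auto
  then show ?thesis by (simp add: differentiable_def)
qed

section \<open>Closure properties of \<open>Ck_on\<close> and \<open>smooth_on\<close>\<close>

lemma Ck_on_cong:
  assumes "open S" "\<And>x. x \<in> S \<Longrightarrow> f x = g x"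
  shows "Ck_on k S f \<longleftrightarrow> Ck_on k S g"
  using assms(2)
proof (induction k arbitrary: f g)
  case 0
  then show ?case by (simp cong: continuous_on_cong)
next
  case (Suc k)
  have "Ck_on k S (\<lambda>x. frechet_derivative f (at x) h) \<longleftrightarrow> Ck_on k S (\<lambda>x. frechet_derivative g (at x) h)" for h
    by (rule Suc.IH) (simp add: frechet_derivative_cong_open[OF assms(1) _ Suc.prems])
  moreover have "f differentiable (at x) \<longleftrightarrow> g differentiable (at x)" if "x \<in> S" for x
    by (rule differentiable_cong_open[OF assms(1) that Suc.prems])
  ultimately show ?case by simp
qed

lemma Ck_on_SucD: "Ck_on (Suc k) S f \<Longrightarrow> Ck_on k S f"
proof (induction k arbitrary: f)
  case 0
  then show ?case
    by (auto intro!: continuous_at_imp_continuous_on differentiable_imp_continuous_within)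
qed simp

lemma Ck_on_bounded_linear:
  assumes L: "bounded_linear L" and S: "open S"
  shows "Ck_on k S f \<Longrightarrow> Ck_on k S (\<lambda>x. L (f x))"
proof (induction k arbitrary: f)
  case 0
  then show ?case by (simp add: bounded_linear.continuous_on[OF L])
next
  case (Suc k)
  have d: "((\<lambda>x. L (f x)) has_derivative (\<lambda>h. L (frechet_derivative f (at x) h))) (at x)" if "x \<in> S" for x
    using Suc.prems that
    by (intro bounded_linear.has_derivative[OF L] frechet_derivative_has_derivative) auto
  have "Ck_on k S (\<lambda>x. frechet_derivative (\<lambda>x. L (f x)) (at x) h)" for h
  proof -
    have "Ck_on k S (\<lambda>x. L (frechet_derivative f (at x) h))"
      using Suc by auto
    then show ?thesis
      by (subst Ck_on_cong[OF S, of _ "\<lambda>x. L (frechet_derivative f (at x) h)"])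
        (auto simp: frechet_derivative_eqI[OF d])
  qed
  then show ?case using d by (auto simp: differentiable_def)
qed

lemma Ck_on_add:
  assumes S: "open S"
  shows "Ck_on k S f \<Longrightarrow> Ck_on k S g \<Longrightarrow> Ck_on k S (\<lambda>x. f x + g x)"
proof (induction k arbitrary: f g)
  case 0
  then show ?case by (simp add: continuous_on_add)
next
  case (Suc k)
  have d: "((\<lambda>x. f x + g x) has_derivative
      (\<lambda>h. frechet_derivative f (at x) h + frechet_derivative g (at x) h)) (at x)" if "x \<in> S" for x
    using Suc.prems that
    by (intro has_derivative_add frechet_derivative_has_derivative) auto
  have "Ck_on k S (\<lambda>x. frechet_derivative (\<lambda>x. f x + g x) (at x) h)" for h
  proof -
    have "Ck_on k S (\<lambda>x. frechet_derivative f (at x) h + frechet_derivative g (at x) h)"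
      using Suc by auto
    then show ?thesis
      by (subst Ck_on_cong[OF S, of _ "\<lambda>x. frechet_derivative f (at x) h + frechet_derivative g (at x) h"])
        (auto simp: frechet_derivative_eqI[OF d])
  qed
  then show ?case using d by (auto simp: differentiable_def)
qed

lemma Ck_on_mult:
  fixes f g :: "'a::real_normed_vector \<Rightarrow> 'b::real_normed_algebra"
  assumes S: "open S"
  shows "Ck_on k S f \<Longrightarrow> Ck_on k S g \<Longrightarrow> Ck_on k S (\<lambda>x. f x * g x)"
proof (induction k arbitrary: f g)
  case 0
  then show ?case by (simp add: continuous_on_mult)
next
  case (Suc k)
  let ?D = "\<lambda>x h. f x * frechet_derivative g (at x) h + frechet_derivative f (at x) h * g x"
  have d: "((\<lambda>x. f x * g x) has_derivative ?D x) (at x)" if "x \<in> S" for x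
    using Suc.prems that
    by (intro has_derivative_mult frechet_derivative_has_derivative) auto
  have "Ck_on k S (\<lambda>x. frechet_derivative (\<lambda>x. f x * g x) (at x) h)" for h
  proof -
    have "Ck_on k S (\<lambda>x. ?D x h)"
      using Suc.prems Ck_on_SucD[OF Suc.prems(1)] Ck_on_SucD[OF Suc.prems(2)]
      by (intro Ck_on_add[OF S] Suc.IH) auto
    then show ?thesis
      by (subst Ck_on_cong[OF S, of _ "\<lambda>x. ?D x h"]) (auto simp: frechet_derivative_eqI[OF d])
  qed
  then show ?case using d by (auto simp: differentiable_def)
qed

lemma Ck_on_affine:
  assumes L: "bounded_linear L" and S: "open S" "open R" and R: "\<And>x. x \<in> R \<Longrightarrow> q + L x \<in> S"
  shows "Ck_on k S f \<Longrightarrow> Ck_on k R (\<lambda>x. f (q + L x))"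
proof (induction k arbitrary: f)
  case 0
  have "continuous_on R (\<lambda>x. q + L x)"
    by (intro continuous_intros bounded_linear.continuous_on[OF L])
  with 0 R show ?case
    using continuous_on_compose2[of S f R "\<lambda>x. q + L x"] by auto
next
  case (Suc k)
  have d: "((\<lambda>x. f (q + L x)) has_derivative (\<lambda>h. frechet_derivative f (at (q + L x)) (L h))) (at x)"
    if "x \<in> R" for x
  proof -
    have "((\<lambda>x. q + L x) has_derivative L) (at x)"
      using has_derivative_add[OF has_derivative_const bounded_linear_imp_has_derivative[OF L]] by simp
    moreover have "(f has_derivative frechet_derivative f (at (q + L x))) (at (q + L x))"
      using Suc.prems R[OF that] by (intro frechet_derivative_has_derivative) auto
    ultimately show ?thesis by (rule has_derivative_compose)
  qed
  have "Ck_on k R (\<lambda>x. frechet_derivative (\<lambda>x. f (q + L x)) (at x) h)" for h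
  proof -
    have "Ck_on k R (\<lambda>x. frechet_derivative f (at (q + L x)) (L h))"
      using Suc.prems by (intro Suc.IH[of "\<lambda>y. frechet_derivative f (at y) (L h)"]) auto
    then show ?thesis
      by (subst Ck_on_cong[OF S(2), of _ "\<lambda>x. frechet_derivative f (at (q + L x)) (L h)"])
        (auto simp: frechet_derivative_eqI[OF d])
  qed
  then show ?case using d by (auto simp: differentiable_def)
qed

lemma smooth_on_differentiable: "smooth_on S f \<Longrightarrow> x \<in> S \<Longrightarrow> f differentiable (at x)"
  unfolding smooth_on_def by (metis Ck_on.simps(2))

lemma smooth_on_frechet_derivative: "smooth_on S f \<Longrightarrow> smooth_on S (\<lambda>x. frechet_derivative f (at x) h)"
  unfolding smooth_on_def by (metis Ck_on.simps(2))

lemma smooth_on_add: "open S \<Longrightarrow> smooth_on S f \<Longrightarrow> smooth_on S g \<Longrightarrow> smooth_on S (\<lambda>x. f x + g x)"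
  unfolding smooth_on_def using Ck_on_add by blast

lemma smooth_on_mult:
  fixes f g :: "'a::real_normed_vector \<Rightarrow> 'b::real_normed_algebra"
  shows "open S \<Longrightarrow> smooth_on S f \<Longrightarrow> smooth_on S g \<Longrightarrow> smooth_on S (\<lambda>x. f x * g x)"
  unfolding smooth_on_def using Ck_on_mult by blast

lemma smooth_on_bounded_linear:
  "bounded_linear L \<Longrightarrow> open S \<Longrightarrow> smooth_on S f \<Longrightarrow> smooth_on S (\<lambda>x. L (f x))"
  unfolding smooth_on_def using Ck_on_bounded_linear by blast

lemma smooth_on_affine:
  "bounded_linear L \<Longrightarrow> open S \<Longrightarrow> open R \<Longrightarrow> (\<And>x. x \<in> R \<Longrightarrow> q + L x \<in> S) \<Longrightarrow> smooth_on S f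
    \<Longrightarrow> smooth_on R (\<lambda>x. f (q + L x))"
  unfolding smooth_on_def using Ck_on_affine by blast

section \<open>Symmetry of second derivatives\<close>

lemma second_difference:
  fixes f :: "'a::real_normed_vector \<Rightarrow> real"
  assumes h: "0 < h" and C: "Ck_on 2 S f"
    and S: "\<And>s t. 0 \<le> s \<Longrightarrow> s \<le> h \<Longrightarrow> 0 \<le> t \<Longrightarrow> t \<le> h \<Longrightarrow> x + s *\<^sub>R a + t *\<^sub>R b \<in> S"
  obtains s t where "0 \<le> s" "s \<le> h" "0 \<le> t" "t \<le> h"
    "f (x + h *\<^sub>R a + h *\<^sub>R b) - f (x + h *\<^sub>R a) - f (x + h *\<^sub>R b) + f x
      = h * h * frechet_derivative (\<lambda>y. frechet_derivative f (at y) a) (at (x + s *\<^sub>R a + t *\<^sub>R b)) b"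
proof -
  let ?Da = "\<lambda>y. frechet_derivative f (at y) a"
  have f: "(f has_derivative frechet_derivative f (at y)) (at y)" if "y \<in> S" for y
    using C that by (intro frechet_derivative_has_derivative) (auto simp: numeral_2_eq_2)
  have Da: "(?Da has_derivative frechet_derivative ?Da (at y)) (at y)" if "y \<in> S" for y
    using C that by (intro frechet_derivative_has_derivative) (auto simp: numeral_2_eq_2)
  have lin: "linear (frechet_derivative f (at y))" "linear (frechet_derivative ?Da (at y))" if "y \<in> S" for y
    using has_derivative_linear[OF f[OF that]] has_derivative_linear[OF Da[OF that]] by auto
  \<comment> \<open>The mean value theorem is used twice: on the increment in direction
    \<open>b\<close>, as a function along \<open>a\<close>, and then on the derivative in direction
    \<open>a\<close>, as a function along \<open>b\<close>.\<close>
  let ?g = "\<lambda>s. f (x + s *\<^sub>R a + h *\<^sub>R b) - f (x + s *\<^sub>R a)"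
  have g: "(?g has_real_derivative (?Da (x + s *\<^sub>R a + h *\<^sub>R b) - ?Da (x + s *\<^sub>R a))) (at s)"
    if "0 \<le> s" "s \<le> h" for s
  proof -
    have 1: "((\<lambda>s. x + s *\<^sub>R a + h *\<^sub>R b) has_derivative (\<lambda>d. d *\<^sub>R a)) (at s)"
      "((\<lambda>s. x + s *\<^sub>R a) has_derivative (\<lambda>d. d *\<^sub>R a)) (at s)"
      by (auto intro!: derivative_eq_intros)
    have 2: "x + s *\<^sub>R a + h *\<^sub>R b \<in> S" "x + s *\<^sub>R a \<in> S"
      using S[of s h] S[of s 0] that h by auto
    have "(?g has_derivative (\<lambda>d. frechet_derivative f (at (x + s *\<^sub>R a + h *\<^sub>R b)) (d *\<^sub>R a)
         - frechet_derivative f (at (x + s *\<^sub>R a)) (d *\<^sub>R a))) (at s)"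
      by (intro has_derivative_diff has_derivative_compose[OF 1(1) f] has_derivative_compose[OF 1(2) f] 2)
    then show ?thesis
      by (rule has_derivative_imp_has_field_derivative)
        (use lin 2 in \<open>simp add: linear_cmul algebra_simps\<close>)
  qed
  obtain s where s: "0 < s" "s < h" "?g h - ?g 0 = (h - 0) * (?Da (x + s *\<^sub>R a + h *\<^sub>R b) - ?Da (x + s *\<^sub>R a))"
    using MVT2[OF h g] by blast
  let ?k = "\<lambda>t. ?Da (x + s *\<^sub>R a + t *\<^sub>R b)"
  have k: "(?k has_real_derivative frechet_derivative ?Da (at (x + s *\<^sub>R a + t *\<^sub>R b)) b) (at t)"
    if "0 \<le> t" "t \<le> h" for t
  proof -
    have 1: "((\<lambda>t. x + s *\<^sub>R a + t *\<^sub>R b) has_derivative (\<lambda>d. d *\<^sub>R b)) (at t)"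
      by (auto intro!: derivative_eq_intros)
    have 2: "x + s *\<^sub>R a + t *\<^sub>R b \<in> S"
      using S[of s t] that s by auto
    have "(?k has_derivative (\<lambda>d. frechet_derivative ?Da (at (x + s *\<^sub>R a + t *\<^sub>R b)) (d *\<^sub>R b))) (at t)"
      by (intro has_derivative_compose[OF 1 Da] 2)
    then show ?thesis
      by (rule has_derivative_imp_has_field_derivative)
        (use lin 2 in \<open>simp add: linear_cmul algebra_simps\<close>)
  qed
  obtain t where t: "0 < t" "t < h" "?k h - ?k 0 = (h - 0) * frechet_derivative ?Da (at (x + s *\<^sub>R a + t *\<^sub>R b)) b"
    using MVT2[OF h k] by blast
  show ?thesis
    by (rule that[of s t]) (use s t in \<open>auto simp: algebra_simps\<close>)
qed

text \<open>The second difference is symmetric in \<open>a\<close> and \<open>b\<close>, and after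
  division by \<open>h * h\<close> it is a value of either iterated derivative at a point close to
  \<open>x\<close>. Continuity at \<open>x\<close> then rules out a gap.\<close>

lemma frechet_derivative_commute_real:
  fixes f :: "'a::real_normed_vector \<Rightarrow> real"
  assumes S: "open S" "x \<in> S" and C: "Ck_on 2 S f"
  shows "frechet_derivative (\<lambda>y. frechet_derivative f (at y) a) (at x) b
       = frechet_derivative (\<lambda>y. frechet_derivative f (at y) b) (at x) a"
    (is "?P x = ?Q x")
proof (rule ccontr)
  assume ne: "?P x \<noteq> ?Q x"
  \<comment> \<open>Half the gap: a common value within \<open>e\<close> of both sides would make
    the gap smaller than itself.\<close>
  define e where "e = \<bar>?P x - ?Q x\<bar> / 2"
  have e: "0 < e" using ne by (simp add: e_def)
  have cont: "isCont ?P x" "isCont ?Q x"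
    using C S by (auto simp: numeral_2_eq_2 continuous_on_eq_continuous_at)
  obtain d1 where d1: "0 < d1" "\<And>y. dist y x < d1 \<Longrightarrow> dist (?P y) (?P x) < e"
    using cont(1) e unfolding continuous_at_eps_delta by blast
  obtain d2 where d2: "0 < d2" "\<And>y. dist y x < d2 \<Longrightarrow> dist (?Q y) (?Q x) < e"
    using cont(2) e unfolding continuous_at_eps_delta by blast
  obtain d3 where d3: "0 < d3" "ball x d3 \<subseteq> S"
    using S open_contains_ball by blast
  define d where "d = min d1 (min d2 d3)"
  have d: "0 < d" using d1 d2 d3 by (simp add: d_def)
  \<comment> \<open>With this \<open>h\<close> the parallelogram spanned by
    \<open>h *\<^sub>R a\<close> and \<open>h *\<^sub>R b\<close> at \<open>x\<close> stays within
    distance \<open>d\<close>; the summand 1 covers \<open>a = b = 0\<close>.\<close>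
  define h where "h = d / (2 * (norm a + norm b + 1))"
  have h: "0 < h" using d by (auto simp: h_def add_nonneg_pos)
  have near: "dist (x + s *\<^sub>R a + t *\<^sub>R b) x < d" if "0 \<le> s" "s \<le> h" "0 \<le> t" "t \<le> h" for s t
  proof -
    have "norm (s *\<^sub>R a + t *\<^sub>R b) \<le> norm (s *\<^sub>R a) + norm (t *\<^sub>R b)" by (rule norm_triangle_ineq)
    also have "\<dots> \<le> h * norm a + h * norm b"
      using that by (intro add_mono) (auto intro!: mult_right_mono)
    also have "\<dots> < h * (2 * (norm a + norm b + 1))"
    proof -
      have "0 < h * (norm a + norm b + 2)" using h by (intro mult_pos_pos) (auto intro: add_nonneg_pos)
      then show ?thesis by (simp add: algebra_simps)
    qed
    also have "\<dots> = d" using norm_ge_zero[of a] norm_ge_zero[of b] unfolding h_def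
      by (metis (no_types, opaque_lifting) add_nonneg_nonneg add_nonneg_pos less_irrefl mult_eq_0_iff
          nonzero_eq_divide_eq zero_less_one zero_neq_numeral)
    finally show ?thesis by (simp add: dist_norm add.assoc)
  qed
  have inS: "x + s *\<^sub>R a + t *\<^sub>R b \<in> S" if "0 \<le> s" "s \<le> h" "0 \<le> t" "t \<le> h" for s t
    using near[OF that] d3 by (auto simp: d_def dist_commute)
  obtain s t where st: "0 \<le> s" "s \<le> h" "0 \<le> t" "t \<le> h"
    "f (x + h *\<^sub>R a + h *\<^sub>R b) - f (x + h *\<^sub>R a) - f (x + h *\<^sub>R b) + f x = h * h * ?P (x + s *\<^sub>R a + t *\<^sub>R b)"
    using second_difference[OF h C, of x a b] inS by metis
  obtain s' t' where st': "0 \<le> s'" "s' \<le> h" "0 \<le> t'" "t' \<le> h"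
    "f (x + h *\<^sub>R b + h *\<^sub>R a) - f (x + h *\<^sub>R b) - f (x + h *\<^sub>R a) + f x = h * h * ?Q (x + s' *\<^sub>R b + t' *\<^sub>R a)"
  proof (rule second_difference[OF h C, of x b a])
    show "x + s *\<^sub>R b + t *\<^sub>R a \<in> S" if "0 \<le> s" "s \<le> h" "0 \<le> t" "t \<le> h" for s t
      using inS[OF that(3,4,1,2)] by (simp add: add.assoc add.commute[of "s *\<^sub>R b"])
  qed blast
  have "h * h * ?P (x + s *\<^sub>R a + t *\<^sub>R b) = h * h * ?Q (x + s' *\<^sub>R b + t' *\<^sub>R a)"
    using st(5) st'(5) by (simp only: add.assoc add.commute[of "h *\<^sub>R b"])
  then have eq: "?P (x + s *\<^sub>R a + t *\<^sub>R b) = ?Q (x + t' *\<^sub>R a + s' *\<^sub>R b)"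
    using h by (simp add: add.assoc add.commute[of "s' *\<^sub>R b"])
  have "dist (?P (x + s *\<^sub>R a + t *\<^sub>R b)) (?P x) < e"
    using near[OF st(1-4)] d1 by (auto simp: d_def)
  moreover have "dist (?Q (x + t' *\<^sub>R a + s' *\<^sub>R b)) (?Q x) < e"
    using near[OF st'(3,4,1,2)] d2 by (auto simp: d_def)
  ultimately show False
    using eq by (simp add: e_def dist_real_def abs_if field_simps split: if_splits)
qed

lemma frechet_derivative_commute:
  fixes f :: "'a::real_normed_vector \<Rightarrow> 'b::euclidean_space"
  assumes S: "open S" "x \<in> S" and C: "smooth_on S f"
  shows "frechet_derivative (\<lambda>y. frechet_derivative f (at y) a) (at x) b
       = frechet_derivative (\<lambda>y. frechet_derivative f (at y) b) (at x) a"
proof (rule euclidean_eqI)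
  fix c :: 'b
  let ?f = "\<lambda>y. f y \<bullet> c"
  have L: "bounded_linear (\<lambda>v::'b. v \<bullet> c)" by (rule bounded_linear_inner_left)
  have C2: "Ck_on 2 S ?f"
    using C Ck_on_bounded_linear[OF L S(1)] unfolding smooth_on_def by blast
  have 1: "frechet_derivative ?f (at y) a = frechet_derivative f (at y) a \<bullet> c" if "y \<in> S" for y a
    by (subst frechet_derivative_eqI[OF bounded_linear.has_derivative[OF L
        frechet_derivative_has_derivative[OF smooth_on_differentiable[OF C that]]]]) simp
  have 2: "frechet_derivative (\<lambda>y. frechet_derivative ?f (at y) a) (at x) b
      = frechet_derivative (\<lambda>y. frechet_derivative f (at y) a) (at x) b \<bullet> c" for a b
  proof -
    have "frechet_derivative (\<lambda>y. frechet_derivative ?f (at y) a) (at x)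
      = frechet_derivative (\<lambda>y. frechet_derivative f (at y) a \<bullet> c) (at x)"
      by (rule frechet_derivative_cong_open[OF S 1])
    also have "\<dots> = (\<lambda>h. frechet_derivative (\<lambda>y. frechet_derivative f (at y) a) (at x) h \<bullet> c)"
      by (rule frechet_derivative_eqI[OF bounded_linear.has_derivative[OF L
        frechet_derivative_has_derivative[OF smooth_on_differentiable[OF smooth_on_frechet_derivative[OF C] S(2)]]]])
    finally show ?thesis by simp
  qed
  show "frechet_derivative (\<lambda>y. frechet_derivative f (at y) a) (at x) b \<bullet> c
      = frechet_derivative (\<lambda>y. frechet_derivative f (at y) b) (at x) a \<bullet> c"
    using frechet_derivative_commute_real[OF S C2, of a b] 2 by simp
qed

text \<open>A product rule for a family \<open>L z\<close> of linear maps that is known to be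
  differentiable only for each fixed argument. Expanding the argument in a finite basis reduces it
  to products with scalar functions.\<close>

lemma has_derivative_linear_apply:
  fixes L :: "'c::real_normed_vector \<Rightarrow> 'a::euclidean_space \<Rightarrow> 'b::real_normed_vector"
  assumes U: "open U" "z0 \<in> U" and lin: "\<And>z. z \<in> U \<Longrightarrow> linear (L z)"
    and L': "\<And>a. ((\<lambda>z. L z a) has_derivative L' a) (at z0)"
    and k: "(k has_derivative k') (at z0)"
  shows "((\<lambda>z. L z (k z)) has_derivative (\<lambda>h. L' (k z0) h + L z0 (k' h))) (at z0)"
proof -
  have exp: "L z a = (\<Sum>b\<in>Basis. (a \<bullet> b) *\<^sub>R L z b)" if "z \<in> U" for z a
    using lin[OF that] euclidean_representation[of a]
    by (metis (no_types, lifting) linear_cmul linear_sum sum.cong)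
  have D: "((\<lambda>z. \<Sum>b\<in>Basis. (m z \<bullet> b) *\<^sub>R L z b) has_derivative
     (\<lambda>h. \<Sum>b\<in>Basis. (m z0 \<bullet> b) *\<^sub>R L' b h + (m' h \<bullet> b) *\<^sub>R L z0 b)) (at z0)"
    if "(m has_derivative m') (at z0)" for m m'
    by (intro has_derivative_sum has_derivative_scaleR L'
        bounded_linear.has_derivative[OF bounded_linear_inner_left] that)
  have D2: "((\<lambda>z. L z (m z)) has_derivative
     (\<lambda>h. \<Sum>b\<in>Basis. (m z0 \<bullet> b) *\<^sub>R L' b h + (m' h \<bullet> b) *\<^sub>R L z0 b)) (at z0)"
    if "(m has_derivative m') (at z0)" for m m'
    by (rule has_derivative_transform_within_open[OF D[OF that] U]) (simp add: exp)
  \<comment> \<open>The derivatives \<open>L' a\<close> are given separately for every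
    \<open>a\<close>; the rule for a constant argument shows that they too expand in the
    basis.\<close>
  have "L' (k z0) = (\<lambda>h. \<Sum>b\<in>Basis. (k z0 \<bullet> b) *\<^sub>R L' b h)"
    using has_derivative_unique[OF L' D2[OF has_derivative_const[of "k z0"]]] by simp
  then have "(\<lambda>h. \<Sum>b\<in>Basis. (k z0 \<bullet> b) *\<^sub>R L' b h + (k' h \<bullet> b) *\<^sub>R L z0 b)
    = (\<lambda>h. L' (k z0) h + L z0 (k' h))"
    by (simp add: sum.distrib fun_eq_iff exp[OF U(2), of "k' _"])
  with D2[OF k] show ?thesis by simp
qed

section \<open>Wirtinger derivatives\<close>

lemma vec_real_basis:
  fixes u :: "complex^'n"
  shows "u = (\<Sum>i\<in>UNIV. Re (u $ i) *\<^sub>R axis i 1 + Im (u $ i) *\<^sub>R axis i \<i>)"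
proof -
  have "(\<Sum>i\<in>UNIV. Re (u $ i) *\<^sub>R axis i 1 + Im (u $ i) *\<^sub>R axis i \<i>) $ k = u $ k" for k
  proof -
    have "(\<Sum>i\<in>UNIV. Re (u $ i) *\<^sub>R axis i 1 + Im (u $ i) *\<^sub>R axis i \<i>) $ k
      = (\<Sum>i\<in>UNIV. if i = k then Re (u $ i) *\<^sub>R 1 + Im (u $ i) *\<^sub>R \<i> else 0)"
      by (simp only: sum_component) (rule sum.cong, auto simp: axis_def)
    also have "\<dots> = u $ k" by (simp add: complex_eq_iff)
    finally show ?thesis .
  qed
  then show ?thesis by (simp add: vec_eq_iff)
qed

lemma linear_wirtinger:
  fixes D :: "complex^'n \<Rightarrow> complex"
  assumes "linear D"
  shows "D u = (\<Sum>i\<in>UNIV. u $ i * ((D (axis i 1) - \<i> * D (axis i \<i>)) / 2)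
                 + cnj (u $ i) * ((D (axis i 1) + \<i> * D (axis i \<i>)) / 2))"
proof -
  have "D u = D (\<Sum>i\<in>UNIV. Re (u $ i) *\<^sub>R axis i 1 + Im (u $ i) *\<^sub>R axis i \<i>)"
    using vec_real_basis[of u] by simp
  also have "\<dots> = (\<Sum>i\<in>UNIV. Re (u $ i) *\<^sub>R D (axis i 1) + Im (u $ i) *\<^sub>R D (axis i \<i>))"
    by (simp add: linear_sum[OF assms] linear_add[OF assms] linear_cmul[OF assms])
  also have "\<dots> = (\<Sum>i\<in>UNIV. u $ i * ((D (axis i 1) - \<i> * D (axis i \<i>)) / 2)
                 + cnj (u $ i) * ((D (axis i 1) + \<i> * D (axis i \<i>)) / 2))"
    by (rule sum.cong) (auto simp: complex_eq_iff field_simps)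
  finally show ?thesis .
qed

lemma frechet_derivative_wirtinger:
  assumes "h differentiable (at x)"
  shows "frechet_derivative h (at x) u = (\<Sum>i\<in>UNIV. u $ i * wd i h x + cnj (u $ i) * wdbar i h x)"
  using linear_wirtinger[OF linear_frechet_derivative[OF assms], of u] by (simp add: wd_def wdbar_def)

lemma wirtinger_cong_open:
  assumes "open S" "x \<in> S" "\<And>y. y \<in> S \<Longrightarrow> f y = g y"
  shows "wd i f x = wd i g x" "wdbar i f x = wdbar i g x"
  using frechet_derivative_cong_open[OF assms] by (simp_all add: wd_def wdbar_def)

lemma wirtinger_cnj:
  assumes "h differentiable (at x)"
  shows "cnj (wd i h x) = wdbar i (\<lambda>y. cnj (h y)) x" "cnj (wdbar i h x) = wd i (\<lambda>y. cnj (h y)) x"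
proof -
  have "frechet_derivative (\<lambda>y. cnj (h y)) (at x) = (\<lambda>u. cnj (frechet_derivative h (at x) u))"
    by (rule frechet_derivative_eqI[OF bounded_linear.has_derivative[OF bounded_linear_cnj
        frechet_derivative_has_derivative[OF assms]]])
  then show "cnj (wd i h x) = wdbar i (\<lambda>y. cnj (h y)) x" "cnj (wdbar i h x) = wd i (\<lambda>y. cnj (h y)) x"
    by (simp_all add: wd_def wdbar_def)
qed

lemma wirtinger_sum_cmult:
  fixes k :: "'a::finite \<Rightarrow> complex^'n \<Rightarrow> complex"
  assumes "\<And>l. k l differentiable (at x)"
  shows "wd i (\<lambda>y. \<Sum>l\<in>UNIV. k l y * c l) x = (\<Sum>l\<in>UNIV. wd i (k l) x * c l)"
    and "wdbar i (\<lambda>y. \<Sum>l\<in>UNIV. k l y * c l) x = (\<Sum>l\<in>UNIV. wdbar i (k l) x * c l)"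
proof -
  have "frechet_derivative (\<lambda>y. \<Sum>l\<in>UNIV. k l y * c l) (at x)
    = (\<lambda>u. \<Sum>l\<in>UNIV. frechet_derivative (k l) (at x) u * c l)"
    by (intro frechet_derivative_eqI has_derivative_sum has_derivative_mult_left
        frechet_derivative_has_derivative assms)
  then show "wd i (\<lambda>y. \<Sum>l\<in>UNIV. k l y * c l) x = (\<Sum>l\<in>UNIV. wd i (k l) x * c l)"
    and "wdbar i (\<lambda>y. \<Sum>l\<in>UNIV. k l y * c l) x = (\<Sum>l\<in>UNIV. wdbar i (k l) x * c l)"
    by (simp_all add: wd_def wdbar_def sum_distrib_left sum_divide_distrib
        flip: sum_subtractf sum.distrib) (auto intro!: sum.cong simp: field_simps)
qed

lemma has_derivative_wirtinger_op:
  fixes h :: "complex^'n \<Rightarrow> complex"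
  assumes "open S" "x \<in> S" "smooth_on S h"
  shows "frechet_derivative (wd i h) (at x) u
       = (frechet_derivative (\<lambda>y. frechet_derivative h (at y) (axis i 1)) (at x) u
          - \<i> * frechet_derivative (\<lambda>y. frechet_derivative h (at y) (axis i \<i>)) (at x) u) / 2"
    and "frechet_derivative (wdbar i h) (at x) u
       = (frechet_derivative (\<lambda>y. frechet_derivative h (at y) (axis i 1)) (at x) u
          + \<i> * frechet_derivative (\<lambda>y. frechet_derivative h (at y) (axis i \<i>)) (at x) u) / 2"
proof -
  have d: "((\<lambda>y. frechet_derivative h (at y) a) has_derivative
      frechet_derivative (\<lambda>y. frechet_derivative h (at y) a) (at x)) (at x)" for a
    using smooth_on_differentiable[OF smooth_on_frechet_derivative[OF assms(3)] assms(2)]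
    by (rule frechet_derivative_has_derivative)
  have "(wd i h has_derivative (\<lambda>u.
       (frechet_derivative (\<lambda>y. frechet_derivative h (at y) (axis i 1)) (at x) u
          - \<i> * frechet_derivative (\<lambda>y. frechet_derivative h (at y) (axis i \<i>)) (at x) u) / 2)) (at x)"
    unfolding wd_def[abs_def]
    by (intro bounded_linear.has_derivative[OF bounded_linear_divide]
        has_derivative_diff has_derivative_mult_right d)
  then show "frechet_derivative (wd i h) (at x) u
       = (frechet_derivative (\<lambda>y. frechet_derivative h (at y) (axis i 1)) (at x) u
          - \<i> * frechet_derivative (\<lambda>y. frechet_derivative h (at y) (axis i \<i>)) (at x) u) / 2"
    by (simp add: frechet_derivative_eqI)
  have "(wdbar i h has_derivative (\<lambda>u.
       (frechet_derivative (\<lambda>y. frechet_derivative h (at y) (axis i 1)) (at x) u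
          + \<i> * frechet_derivative (\<lambda>y. frechet_derivative h (at y) (axis i \<i>)) (at x) u) / 2)) (at x)"
    unfolding wdbar_def[abs_def]
    by (intro bounded_linear.has_derivative[OF bounded_linear_divide]
        has_derivative_add has_derivative_mult_right d)
  then show "frechet_derivative (wdbar i h) (at x) u
       = (frechet_derivative (\<lambda>y. frechet_derivative h (at y) (axis i 1)) (at x) u
          + \<i> * frechet_derivative (\<lambda>y. frechet_derivative h (at y) (axis i \<i>)) (at x) u) / 2"
    by (simp add: frechet_derivative_eqI)
qed

lemma wirtinger_commute:
  fixes h :: "complex^'n \<Rightarrow> complex"
  assumes "open S" "x \<in> S" "smooth_on S h"
  shows "wd i (wd j h) x = wd j (wd i h) x"
    and "wdbar i (wd j h) x = wd j (wdbar i h) x"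
    and "wdbar i (wdbar j h) x = wdbar j (wdbar i h) x"
proof -
  note c = frechet_derivative_commute[OF assms]
  show "wd i (wd j h) x = wd j (wd i h) x"
    unfolding wd_def[of _ "wd _ _"] has_derivative_wirtinger_op[OF assms]
    by (simp add: c[of "axis j _" "axis i _"] field_simps)
  show "wdbar i (wd j h) x = wd j (wdbar i h) x"
    unfolding wd_def[of _ "wdbar _ _"] wdbar_def[of _ "wd _ _"] has_derivative_wirtinger_op[OF assms]
    by (simp add: c[of "axis j _" "axis i _"] field_simps)
  show "wdbar i (wdbar j h) x = wdbar j (wdbar i h) x"
    unfolding wdbar_def[of _ "wdbar _ _"] has_derivative_wirtinger_op[OF assms]
    by (simp add: c[of "axis j _" "axis i _"] field_simps)
qed

lemma smooth_on_wirtinger: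
  fixes h :: "complex^'n \<Rightarrow> complex"
  assumes S: "open S" and h: "smooth_on S h"
  shows "smooth_on S (wd i h)" "smooth_on S (wdbar i h)"
proof -
  have 1: "smooth_on S (\<lambda>x. c * frechet_derivative h (at x) u)" for c u
    by (intro smooth_on_bounded_linear[OF bounded_linear_mult_right S] smooth_on_frechet_derivative h)
  have eq: "wd i h = (\<lambda>x. (1/2) * frechet_derivative h (at x) (axis i 1)
      + (-\<i>/2) * frechet_derivative h (at x) (axis i \<i>))"
    "wdbar i h = (\<lambda>x. (1/2) * frechet_derivative h (at x) (axis i 1)
      + (\<i>/2) * frechet_derivative h (at x) (axis i \<i>))"
    by (auto simp: wd_def wdbar_def field_simps)
  show "smooth_on S (wd i h)" "smooth_on S (wdbar i h)"
    unfolding eq by (intro smooth_on_add[OF S] 1)+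
qed

text \<open>Product rule with the coordinate functions: \<open>wdbar j\<close> annihilates them,
  while \<open>wd j\<close> of the \<open>i\<close>-th one is the Kronecker delta. The extra term is
  the source of the shift of degree in the Euler relations.\<close>

lemma wirtinger_euler_op:
  fixes k :: "'n \<Rightarrow> complex^'n \<Rightarrow> complex"
  assumes "\<And>i. k i differentiable (at v)"
  shows "wd j (\<lambda>y. \<Sum>i\<in>UNIV. y $ i * k i y) v = (\<Sum>i\<in>UNIV. v $ i * wd j (k i) v) + k j v"
    and "wdbar j (\<lambda>y. \<Sum>i\<in>UNIV. y $ i * k i y) v = (\<Sum>i\<in>UNIV. v $ i * wdbar j (k i) v)"
proof -
  let ?D = "\<lambda>i. frechet_derivative (k i) (at v)"
  have D: "frechet_derivative (\<lambda>y. \<Sum>i\<in>UNIV. y $ i * k i y) (at v)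
    = (\<lambda>u. \<Sum>i\<in>UNIV. v $ i * ?D i u + u $ i * k i v)"
    by (intro frechet_derivative_eqI has_derivative_sum has_derivative_mult
        bounded_linear_imp_has_derivative bounded_linear_vec_nth
        frechet_derivative_has_derivative assms)
  have *: "(\<Sum>i\<in>UNIV. axis j a $ i * k i v) = a * k j v" for a
  proof -
    have "(\<Sum>i\<in>UNIV. axis j a $ i * k i v) = (\<Sum>i\<in>UNIV. if i = j then a * k i v else 0)"
      by (rule sum.cong) (auto simp: axis_def)
    then show ?thesis by simp
  qed
  have Dax: "frechet_derivative (\<lambda>y. \<Sum>i\<in>UNIV. y $ i * k i y) (at v) (axis j a)
    = (\<Sum>i\<in>UNIV. v $ i * ?D i (axis j a)) + a * k j v" for a
    unfolding D by (simp add: sum.distrib *)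
  have "(\<Sum>i\<in>UNIV. v $ i * wd j (k i) v)
      = ((\<Sum>i\<in>UNIV. v $ i * ?D i (axis j 1)) - \<i> * (\<Sum>i\<in>UNIV. v $ i * ?D i (axis j \<i>))) / 2"
    "(\<Sum>i\<in>UNIV. v $ i * wdbar j (k i) v)
      = ((\<Sum>i\<in>UNIV. v $ i * ?D i (axis j 1)) + \<i> * (\<Sum>i\<in>UNIV. v $ i * ?D i (axis j \<i>))) / 2"
    by (simp_all add: wd_def wdbar_def sum_distrib_left sum_divide_distrib flip: sum_subtractf sum.distrib)
      (auto intro!: sum.cong simp: field_simps)
  then show "wd j (\<lambda>y. \<Sum>i\<in>UNIV. y $ i * k i y) v = (\<Sum>i\<in>UNIV. v $ i * wd j (k i) v) + k j v"
    and "wdbar j (\<lambda>y. \<Sum>i\<in>UNIV. y $ i * k i y) v = (\<Sum>i\<in>UNIV. v $ i * wdbar j (k i) v)"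
    by (simp_all add: wd_def[of j "\<lambda>y. \<Sum>i\<in>UNIV. y $ i * k i y"]
        wdbar_def[of j "\<lambda>y. \<Sum>i\<in>UNIV. y $ i * k i y"] Dax field_simps)
qed

lemma wirtinger_linear_change:
  fixes M :: "complex^'n^'n"
  assumes "h differentiable (at (M *v v))"
  shows "wd i (\<lambda>v. h (M *v v)) v = (\<Sum>k\<in>UNIV. wd k h (M *v v) * M $ k $ i)"
    and "wdbar i (\<lambda>v. h (M *v v)) v = (\<Sum>k\<in>UNIV. wdbar k h (M *v v) * cnj (M $ k $ i))"
proof -
  let ?D = "frechet_derivative h (at (M *v v))"
  have D: "frechet_derivative (\<lambda>v. h (M *v v)) (at v) = (\<lambda>u. ?D (M *v u))"
    by (intro frechet_derivative_eqI has_derivative_compose[OF _ frechet_derivative_has_derivative]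
        linear_imp_has_derivative matrix_vector_mul_linear assms)
  have ax: "(M *v axis i a) $ k = a * M $ k $ i" for a k
    by (simp add: matrix_vector_mult_def axis_def if_distrib cong: if_cong)
  show "wd i (\<lambda>v. h (M *v v)) v = (\<Sum>k\<in>UNIV. wd k h (M *v v) * M $ k $ i)"
    unfolding wd_def[of i] D frechet_derivative_wirtinger[OF assms]
    by (simp add: ax sum_distrib_left sum_divide_distrib flip: sum_subtractf)
       (rule sum.cong, auto simp: field_simps)
  show "wdbar i (\<lambda>v. h (M *v v)) v = (\<Sum>k\<in>UNIV. wdbar k h (M *v v) * cnj (M $ k $ i))"
    unfolding wdbar_def[of i] D frechet_derivative_wirtinger[OF assms]
    by (simp add: ax sum_distrib_left sum_divide_distrib flip: sum.distrib)
       (rule sum.cong, auto simp: field_simps)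
qed

text \<open>A complex linear substitution creates no second order terms, so the Levi form changes as
  a Hermitian form. This carries strong pseudoconvexity from the coordinate basis to an arbitrary
  basis of the fibre.\<close>

lemma levi_linear_change:
  fixes M :: "complex^'n^'n"
  assumes h: "smooth_on (UNIV - {0}) h" and M: "\<And>u. u \<noteq> 0 \<Longrightarrow> M *v u \<noteq> 0" and v: "v \<noteq> 0"
  shows "(\<Sum>i\<in>UNIV. \<Sum>j\<in>UNIV. wd i (wdbar j (\<lambda>v. h (M *v v))) v * u $ i * cnj (u $ j))
    = (\<Sum>i\<in>UNIV. \<Sum>j\<in>UNIV. wd i (wdbar j h) (M *v v) * (M *v u) $ i * cnj ((M *v u) $ j))"
proof -
  have o: "open (UNIV - {0::complex^'n})" by (simp add: open_delete)
  have wdbar: "wdbar j (\<lambda>v. h (M *v v)) y = (\<Sum>k\<in>UNIV. wdbar k h (M *v y) * cnj (M $ k $ j))"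
    if "y \<in> UNIV - {0}" for y j
    using that M by (intro wirtinger_linear_change smooth_on_differentiable[OF h]) auto
  have d: "wdbar k h differentiable (at (M *v v))" for k
    using M[OF v] by (intro smooth_on_differentiable[OF smooth_on_wirtinger(2)[OF o h]]) auto
  have d': "(\<lambda>y. wdbar k h (M *v y)) differentiable (at v)" for k
    by (rule differentiable_compose[of "wdbar k h" "\<lambda>y. M *v y"])
      (simp_all add: d linear_imp_differentiable[OF matrix_vector_mul_linear])
  have "wd i (wdbar j (\<lambda>v. h (M *v v))) v
    = (\<Sum>k\<in>UNIV. (\<Sum>m\<in>UNIV. wd m (wdbar k h) (M *v v) * M $ m $ i) * cnj (M $ k $ j))" for i j
  proof -
    have "wd i (wdbar j (\<lambda>v. h (M *v v))) v
      = wd i (\<lambda>y. \<Sum>k\<in>UNIV. wdbar k h (M *v y) * cnj (M $ k $ j)) v"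
      by (rule wirtinger_cong_open(1)[OF o]) (use v wdbar in auto)
    then show ?thesis
      by (simp add: wirtinger_sum_cmult(1)[OF d'] wirtinger_linear_change(1)[OF d])
  qed
  then have "(\<Sum>i\<in>UNIV. \<Sum>j\<in>UNIV. wd i (wdbar j (\<lambda>v. h (M *v v))) v * u $ i * cnj (u $ j))
    = (\<Sum>i\<in>UNIV. \<Sum>j\<in>UNIV. \<Sum>k\<in>UNIV. \<Sum>m\<in>UNIV.
        wd m (wdbar k h) (M *v v) * (M $ m $ i * u $ i) * cnj (M $ k $ j * u $ j))"
    by (simp add: sum_distrib_left sum_distrib_right mult_ac)
  also have "\<dots> = (\<Sum>i\<in>UNIV. \<Sum>k\<in>UNIV. \<Sum>j\<in>UNIV. \<Sum>m\<in>UNIV.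
        wd m (wdbar k h) (M *v v) * (M $ m $ i * u $ i) * cnj (M $ k $ j * u $ j))"
    by (rule sum.cong[OF refl], rule sum.swap)
  also have "\<dots> = (\<Sum>k\<in>UNIV. \<Sum>i\<in>UNIV. \<Sum>m\<in>UNIV. \<Sum>j\<in>UNIV.
        wd m (wdbar k h) (M *v v) * (M $ m $ i * u $ i) * cnj (M $ k $ j * u $ j))"
    by (subst sum.swap, rule sum.cong[OF refl], rule sum.cong[OF refl], rule sum.swap)
  also have "\<dots> = (\<Sum>k\<in>UNIV. \<Sum>m\<in>UNIV. \<Sum>i\<in>UNIV. \<Sum>j\<in>UNIV.
        wd m (wdbar k h) (M *v v) * (M $ m $ i * u $ i) * cnj (M $ k $ j * u $ j))"
    by (rule sum.cong[OF refl], rule sum.swap)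
  also have "\<dots> = (\<Sum>m\<in>UNIV. \<Sum>k\<in>UNIV. \<Sum>i\<in>UNIV. \<Sum>j\<in>UNIV.
        wd m (wdbar k h) (M *v v) * (M $ m $ i * u $ i) * cnj (M $ k $ j * u $ j))"
    by (rule sum.swap)
  also have "\<dots> = (\<Sum>i\<in>UNIV. \<Sum>j\<in>UNIV. wd i (wdbar j h) (M *v v) * (M *v u) $ i * cnj ((M *v u) $ j))"
  proof -
    have "(\<Sum>i\<in>UNIV. \<Sum>j\<in>UNIV. g * x i * cnj (y j)) = g * (\<Sum>i\<in>UNIV. x i) * cnj (\<Sum>j\<in>UNIV. y j)"
      for g and x y :: "'n \<Rightarrow> complex"
      by (subst sum.swap) (simp add: sum_distrib_left sum_distrib_right)
    then show ?thesis by (simp only: matrix_vector_mult_def[of M u] vec_lambda_beta)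
  qed
  finally show ?thesis .
qed

text \<open>Cramer's rule as an explicit solution operator, so that solutions depend differentiably on the data.\<close>

definition solve :: "complex^'n^'n \<Rightarrow> complex^'n \<Rightarrow> complex^'n" where
  "solve M r = (\<chi> k. det (\<chi> i j. if j = k then r $ i else M $ i $ j) / det M)"

lemma solve_iff: "det M \<noteq> 0 \<Longrightarrow> M *v x = r \<longleftrightarrow> x = solve M r"
  unfolding solve_def by (rule cramer)

lemma differentiable_prod:
  fixes f :: "'i \<Rightarrow> 'a::real_normed_vector \<Rightarrow> 'b::real_normed_field"
  assumes "\<And>i. i \<in> I \<Longrightarrow> f i differentiable (at x)"
  shows "(\<lambda>y. \<Prod>i\<in>I. f i y) differentiable (at x)"
  using has_derivative_prod[of I f "\<lambda>i. frechet_derivative (f i) (at x)" x UNIV]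
    frechet_derivative_has_derivative[OF assms] unfolding differentiable_def by blast

lemma differentiable_det:
  fixes M :: "'a::real_normed_vector \<Rightarrow> complex^'n^'n"
  assumes "\<And>i j. (\<lambda>y. M y $ i $ j) differentiable (at x)"
  shows "(\<lambda>y. det (M y)) differentiable (at x)"
  unfolding det_def
  by (intro differentiable_sum ballI differentiable_mult differentiable_prod assms differentiable_const)
    (simp add: finite_permutations)

lemma differentiable_solve:
  fixes M :: "'a::real_normed_vector \<Rightarrow> complex^'n^'n"
  assumes "\<And>i j. (\<lambda>y. M y $ i $ j) differentiable (at x)"
    and "\<And>i. (\<lambda>y. r y $ i) differentiable (at x)" and "det (M x) \<noteq> 0"
  shows "(\<lambda>y. solve (M y) (r y) $ k) differentiable (at x)"
proof -
  have "(\<lambda>y. (\<chi> i j. if j = k then r y $ i else M y $ i $ j) $ i $ j) differentiable (at x)" for i j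
    using assms(1,2) by (cases "j = k") simp_all
  then show ?thesis
    unfolding solve_def using assms(1,3) by (auto intro!: differentiable_divide differentiable_det)
qed

section \<open>Coefficients of two-forms in a coframe\<close>

lemma sum_cof_index:
  fixes h :: "'n::finite cof_index \<Rightarrow> 'b::comm_monoid_add"
  shows "(\<Sum>a\<in>UNIV. h a) = (\<Sum>i\<in>UNIV. h (Hor i)) + (\<Sum>i\<in>UNIV. h (HorBar i))
    + (\<Sum>i\<in>UNIV. h (Ver i)) + (\<Sum>i\<in>UNIV. h (VerBar i))"
proof -
  have U: "(UNIV :: 'n cof_index set) = ((range Hor \<union> range HorBar) \<union> range Ver) \<union> range VerBar"
  proof -
    have "x \<in> ((range Hor \<union> range HorBar) \<union> range Ver) \<union> range VerBar" for x :: "'n cof_index"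
      by (cases x) auto
    then show ?thesis by blast
  qed
  have "inj (Hor :: 'n \<Rightarrow> _)" "inj (HorBar :: 'n \<Rightarrow> _)" "inj (Ver :: 'n \<Rightarrow> _)" "inj (VerBar :: 'n \<Rightarrow> _)"
    by (auto intro: injI)
  moreover have "(range Hor \<union> range HorBar \<union> range Ver) \<inter> range VerBar = ({} :: 'n cof_index set)"
    "(range Hor \<union> range HorBar) \<inter> range Ver = ({} :: 'n cof_index set)"
    "range Hor \<inter> range HorBar = ({} :: 'n cof_index set)"
    by auto
  ultimately show ?thesis
    by (subst U) (simp add: sum.union_disjoint sum.reindex)
qed

text \<open>\<open>P a + \<i> Q a\<close> is the complex frame dual to the coframe \<open>\<theta>\<close>.\<close>

lemma coeff2_eq:
  fixes \<theta> :: "'a::finite \<Rightarrow> 'v::real_vector \<Rightarrow> complex"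
  assumes dual: "\<And>a b. \<theta> b (P a) + \<i> * \<theta> b (Q a) = (if a = b then 1 else 0)"
    and expand: "\<And>X. (\<Sum>a\<in>UNIV. Re (\<theta> a X) *\<^sub>R P a - Im (\<theta> a X) *\<^sub>R Q a) = X"
    and zero: "\<And>X. (\<Sum>a\<in>UNIV. Re (\<theta> a X) *\<^sub>R Q a + Im (\<theta> a X) *\<^sub>R P a) = 0"
    and lin: "\<And>Y. linear (\<lambda>X. \<Omega> X Y)" and alt: "\<And>X Y. \<Omega> X Y = - \<Omega> Y X"
  shows "coeff2 \<theta> \<Omega> a b = \<Omega> (P a) (P b) - \<Omega> (Q a) (Q b) + \<i> * (\<Omega> (P a) (Q b) + \<Omega> (Q a) (P b))"
proof -
  let ?K = "\<lambda>a b. \<Omega> (P a) (P b) - \<Omega> (Q a) (Q b) + \<i> * (\<Omega> (P a) (Q b) + \<Omega> (Q a) (P b))"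
  \<comment> \<open>The complex linear extension of \<open>L\<close> on the expansion of
    \<open>X\<close> in the dual frame; \<open>expand\<close> and \<open>zero\<close> are the real
    and imaginary parts of that expansion.\<close>
  have ex: "(\<Sum>a\<in>UNIV. \<theta> a X * (L (P a) + \<i> * L (Q a))) = L X" if L: "linear L" for L :: "'v \<Rightarrow> complex" and X
  proof -
    have "L X = L (\<Sum>a\<in>UNIV. Re (\<theta> a X) *\<^sub>R P a - Im (\<theta> a X) *\<^sub>R Q a)
      + \<i> * L (\<Sum>a\<in>UNIV. Re (\<theta> a X) *\<^sub>R Q a + Im (\<theta> a X) *\<^sub>R P a)"
      by (simp add: expand zero linear_0[OF L])
    also have "\<dots> = (\<Sum>a\<in>UNIV. \<theta> a X * (L (P a) + \<i> * L (Q a)))"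
      unfolding linear_sum[OF L] sum_distrib_left sum.distrib[symmetric]
      by (rule sum.cong) (simp_all add: linear_diff[OF L] linear_add[OF L] linear_cmul[OF L] complex_eq_iff algebra_simps)
    finally show ?thesis by simp
  qed
  have lin2: "linear (\<lambda>Y. \<Omega> X Y)" for X
    using linear_compose_neg[OF lin[of X]] by (subst alt) simp
  have full: "(\<Sum>a\<in>UNIV. \<Sum>b\<in>UNIV. ?K a b * (\<theta> a X * \<theta> b Y)) = \<Omega> X Y" for X Y
  proof -
    have "(\<Sum>b\<in>UNIV. ?K a b * (\<theta> a X * \<theta> b Y)) = \<theta> a X * (\<Omega> (P a) Y + \<i> * \<Omega> (Q a) Y)" for a
    proof -
      have "(\<Sum>b\<in>UNIV. ?K a b * (\<theta> a X * \<theta> b Y))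
        = \<theta> a X * ((\<Sum>b\<in>UNIV. \<theta> b Y * (\<Omega> (P a) (P b) + \<i> * \<Omega> (P a) (Q b)))
          + \<i> * (\<Sum>b\<in>UNIV. \<theta> b Y * (\<Omega> (Q a) (P b) + \<i> * \<Omega> (Q a) (Q b))))"
        unfolding sum_distrib_left sum.distrib[symmetric]
        by (rule sum.cong) (simp_all add: complex_eq_iff algebra_simps)
      then show ?thesis by (simp add: ex[OF lin2])
    qed
    then show ?thesis by (simp add: ex[OF lin])
  qed
  have anti: "?K b a = - ?K a b" for a b
    using alt[of "P b" "P a"] alt[of "Q b" "Q a"] alt[of "P b" "Q a"] alt[of "Q b" "P a"]
    by (simp add: algebra_simps)
  have rep: "\<Omega> X Y = (1/2) * (\<Sum>a\<in>UNIV. \<Sum>b\<in>UNIV. ?K a b * wedge (\<theta> a) (\<theta> b) X Y)" for X Y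
  proof -
    have "(\<Sum>a\<in>UNIV. \<Sum>b\<in>UNIV. ?K a b * wedge (\<theta> a) (\<theta> b) X Y)
      = (\<Sum>a\<in>UNIV. \<Sum>b\<in>UNIV. ?K a b * (\<theta> a X * \<theta> b Y)) - (\<Sum>a\<in>UNIV. \<Sum>b\<in>UNIV. ?K a b * (\<theta> a Y * \<theta> b X))"
      by (simp add: wedge_def right_diff_distrib sum_subtractf)
    also have "\<dots> = \<Omega> X Y - \<Omega> Y X" by (simp only: full)
    also have "\<dots> = 2 * \<Omega> X Y" using alt[of Y X] by simp
    finally show ?thesis by simp
  qed
  have gen: "(p * s - r * q) - (p' * s' - r' * q') + \<i> * ((p * s' - r' * q) + (p' * s - r * q'))
      = (p + \<i> * p') * (s + \<i> * s') - (r + \<i> * r') * (q + \<i> * q')" for p q r s p' q' r' s' :: complex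
    by (simp add: algebra_simps)
  \<comment> \<open>Evaluating the given expansion on the dual frame vectors with indices
    \<open>c\<close> and \<open>d\<close> isolates \<open>K c d - K d c\<close>; antisymmetry and
    the factor 1/2 leave \<open>K c d\<close>.\<close>
  have uniq: "K c d = ?K c d"
    if K: "\<forall>a b. K b a = - K a b"
      "\<forall>X Y. \<Omega> X Y = (1/2) * (\<Sum>a\<in>UNIV. \<Sum>b\<in>UNIV. K a b * wedge (\<theta> a) (\<theta> b) X Y)" for K c d
  proof -
    let ?w = "\<lambda>a b. wedge (\<theta> a) (\<theta> b)"
    have w: "?w a b (P c) (P d) - ?w a b (Q c) (Q d) + \<i> * (?w a b (P c) (Q d) + ?w a b (Q c) (P d))
      = (if a = c \<and> b = d then 1 else 0) - (if a = d \<and> b = c then 1 else 0)" for a b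
    proof -
      have "?w a b (P c) (P d) - ?w a b (Q c) (Q d) + \<i> * (?w a b (P c) (Q d) + ?w a b (Q c) (P d))
        = (\<theta> a (P c) + \<i> * \<theta> a (Q c)) * (\<theta> b (P d) + \<i> * \<theta> b (Q d))
          - (\<theta> a (P d) + \<i> * \<theta> a (Q d)) * (\<theta> b (P c) + \<i> * \<theta> b (Q c))"
        unfolding wedge_def by (rule gen)
      also have "\<dots> = (if a = c \<and> b = d then 1 else 0) - (if a = d \<and> b = c then 1 else 0)"
        unfolding dual by (cases "a = c"; cases "b = d"; cases "a = d"; cases "b = c"; simp)
      finally show ?thesis .
    qed
    have "?K c d = (1/2) * (\<Sum>a\<in>UNIV. \<Sum>b\<in>UNIV. K a b *
       (?w a b (P c) (P d) - ?w a b (Q c) (Q d) + \<i> * (?w a b (P c) (Q d) + ?w a b (Q c) (P d))))"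
    proof -
      have "(\<Sum>a\<in>UNIV. \<Sum>b\<in>UNIV. K a b * (w1 a b - w2 a b + \<i> * (w3 a b + w4 a b)))
        = (\<Sum>a\<in>UNIV. \<Sum>b\<in>UNIV. K a b * w1 a b) - (\<Sum>a\<in>UNIV. \<Sum>b\<in>UNIV. K a b * w2 a b)
        + \<i> * ((\<Sum>a\<in>UNIV. \<Sum>b\<in>UNIV. K a b * w3 a b) + (\<Sum>a\<in>UNIV. \<Sum>b\<in>UNIV. K a b * w4 a b))"
        for w1 w2 w3 w4 :: "'a \<Rightarrow> 'a \<Rightarrow> complex"
        unfolding sum_distrib_left sum.distrib[symmetric] sum_subtractf[symmetric]
        by (intro sum.cong refl) (simp add: algebra_simps)
      note ev = this
      have \<Omega>2: "\<Omega> X Y = (1/2) * (\<Sum>a\<in>UNIV. \<Sum>b\<in>UNIV. K a b * ?w a b X Y)" for X Y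
        using K(2) by blast
      have half: "h * x - h * y + \<i> * (h * z + h * u) = h * (x - y + \<i> * (z + u))" for h x y z u :: complex
        by (simp add: algebra_simps)
      show ?thesis by (simp only: \<Omega>2 ev half)
    qed
    also have "\<dots> = (1/2) * ((\<Sum>a\<in>UNIV. \<Sum>b\<in>UNIV. if a = c then if b = d then K a b else 0 else 0)
        - (\<Sum>a\<in>UNIV. \<Sum>b\<in>UNIV. if a = d then if b = c then K a b else 0 else 0))"
      unfolding w sum_subtractf[symmetric]
      by (intro arg_cong[where f = "\<lambda>h. (1/2) * h"] sum.cong refl) simp
    also have "\<dots> = (1/2) * (K c d - K d c)"
    proof -
      have "(\<Sum>a\<in>UNIV. \<Sum>b\<in>UNIV. if a = c then if b = d then K a b else 0 else 0) = K c d" for c d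
      proof -
        have "(\<Sum>b\<in>UNIV. if a = c then if b = d then K a b else 0 else 0) = (if a = c then K a d else 0)" for a
          by simp
        then show ?thesis by simp
      qed
      then show ?thesis by simp
    qed
    also have "\<dots> = K c d" using K(1)[rule_format, of c d] by simp
    finally show ?thesis by simp
  qed
  have "coeff2 \<theta> \<Omega> = ?K"
    unfolding coeff2_def
  proof (rule the_equality)
    show "(\<forall>a b. ?K b a = - ?K a b) \<and>
        (\<forall>X Y. \<Omega> X Y = (1/2) * (\<Sum>a\<in>UNIV. \<Sum>b\<in>UNIV. ?K a b * wedge (\<theta> a) (\<theta> b) X Y))"
      by (intro conjI allI anti rep)
    show "K = ?K" if "(\<forall>a b. K b a = - K a b) \<and>
        (\<forall>X Y. \<Omega> X Y = (1/2) * (\<Sum>a\<in>UNIV. \<Sum>b\<in>UNIV. K a b * wedge (\<theta> a) (\<theta> b) X Y))" for K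
      using that uniq by (intro ext) blast
  qed
  then show ?thesis by simp
qed

text \<open>The complex bilinear extension of \<open>B\<close>, evaluated at the (1,0)-part of the real vector \<open>a\<close>
  and the (0,1)-part of the real vector \<open>b\<close>.\<close>

definition p11 :: "(complex^'n \<Rightarrow> complex^'n \<Rightarrow> complex) \<Rightarrow> complex^'n \<Rightarrow> complex^'n \<Rightarrow> complex" where
  "p11 B a b = (B a b + B (\<i> *s a) (\<i> *s b) + \<i> * B a (\<i> *s b) - \<i> * B (\<i> *s a) b) / 4"

lemma scale_complex_real: "c *s a = Re c *\<^sub>R a + Im c *\<^sub>R (\<i> *s a)" for a :: "complex^'n"
  by (simp add: vec_eq_iff complex_eq_iff)

lemma p11_add:
  assumes "bilinear B"
  shows "p11 B (a + a') b = p11 B a b + p11 B a' b" "p11 B a (b + b') = p11 B a b + p11 B a b'"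
  by (simp_all add: p11_def vector_add_ldistrib bilinear_ladd[OF assms] bilinear_radd[OF assms] field_simps)

text \<open>On the (1,0)-part of a real vector, multiplication of that vector by \<open>\<i>\<close>
  acts as the scalar \<open>\<i>\<close>, on the (0,1)-part as \<open>-\<i>\<close>. A merely real
  bilinear \<open>B\<close> thus becomes sesquilinear.\<close>

lemma p11_scale:
  assumes B: "bilinear B"
  shows "p11 B (c *s a) b = c * p11 B a b" "p11 B a (c *s b) = cnj c * p11 B a b"
proof -
  have ii: "\<i> *s (\<i> *s a) = - a" for a :: "complex^'n"
    by (simp add: vec_eq_iff)
  have sc: "\<i> *s (r *\<^sub>R a) = r *\<^sub>R (\<i> *s a)" for r and a :: "complex^'n"
    by (simp add: vec_eq_iff)
  have i: "p11 B (\<i> *s a) b = \<i> * p11 B a b" "p11 B a (\<i> *s b) = - \<i> * p11 B a b" for a b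
    by (simp_all add: p11_def ii bilinear_lneg[OF B] bilinear_rneg[OF B] field_simps)
  have r: "p11 B (r *\<^sub>R a) b = r * p11 B a b" "p11 B a (r *\<^sub>R b) = r * p11 B a b" for a b and r :: real
    by (simp_all add: p11_def sc bilinear_lmul[OF B] bilinear_rmul[OF B] scaleR_conv_of_real[where 'a=complex] field_simps)
  show "p11 B (c *s a) b = c * p11 B a b"
    by (subst scale_complex_real) (simp add: p11_add[OF B] i r complex_eq_iff)
  show "p11 B a (c *s b) = cnj c * p11 B a b"
    by (subst scale_complex_real) (simp add: p11_add[OF B] i r complex_eq_iff)
qed

lemma complex_linear_expand:
  fixes h :: "complex^'n \<Rightarrow> complex"
  assumes "\<And>a b. h (a + b) = h a + h b" "\<And>c a. h (c *s a) = c * h a"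
  shows "h u = (\<Sum>k\<in>UNIV. u $ k * h (axis k 1))"
proof -
  have 0: "h 0 = 0" using assms(2)[of 0 0] by simp
  have "h (\<Sum>k\<in>S. u $ k *s axis k 1) = (\<Sum>k\<in>S. u $ k * h (axis k 1))" if "finite S" for S
    using that by induction (simp_all add: 0 assms)
  from this[of UNIV] show ?thesis by (simp add: basis_expansion)
qed

lemma p11_expand:
  assumes B: "bilinear B"
  shows "p11 B u w = (\<Sum>k\<in>UNIV. u $ k * p11 B (axis k 1) w)"
    and "p11 B u w = (\<Sum>j\<in>UNIV. cnj (w $ j) * p11 B u (axis j 1))"
proof -
  show "p11 B u w = (\<Sum>k\<in>UNIV. u $ k * p11 B (axis k 1) w)"
    by (rule complex_linear_expand) (simp_all add: p11_add[OF B] p11_scale[OF B])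
  have "cnj (p11 B u w) = (\<Sum>j\<in>UNIV. w $ j * cnj (p11 B u (axis j 1)))"
    by (rule complex_linear_expand[of "\<lambda>w. cnj (p11 B u w)"]) (simp_all add: p11_add[OF B] p11_scale[OF B])
  then have "cnj (cnj (p11 B u w)) = (\<Sum>j\<in>UNIV. cnj (w $ j) * p11 B u (axis j 1))" by simp
  then show "p11 B u w = (\<Sum>j\<in>UNIV. cnj (w $ j) * p11 B u (axis j 1))" by simp
qed

text \<open>The two diagonal terms vanish and the two mixed ones, of weight \<open>\<i>/4\<close>
  each, coincide.\<close>

lemma p11_alternating:
  assumes "bilinear B" "\<And>a b. B a b = - B b a"
  shows "p11 B w w = (\<i> / 2) * B w (\<i> *s w)"
proof -
  have "B w w = 0" "B (\<i> *s w) (\<i> *s w) = 0" using assms(2)[of w w] assms(2)[of "\<i> *s w" "\<i> *s w"] by auto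
  then show ?thesis using assms(2)[of "\<i> *s w" w] by (simp add: p11_def field_simps)
qed

text \<open>The real horizontal lift of \<open>T y\<close>, that is, the lift annihilated by the vertical forms
  \<open>dv\<^sup>i + \<theta>\<^sup>i\<close>.\<close>

definition hor_lift ::
  "(complex^'n \<Rightarrow> complex^'n) \<Rightarrow> (complex^'n \<Rightarrow> complex^'n) \<Rightarrow> complex^'n \<Rightarrow> 'n slit" where
  "hor_lift T \<theta> y = (T y, - \<theta> y)"

text \<open>The (1,0)- and (0,1)-parts of horizontal lifts and of vertical vectors form the frame
  dual to the full coframe, whatever the linear map \<open>\<theta>\<close>. One computation
  therefore serves the torsion, with connection coefficients still unknown, and the
  curvature.\<close>

lemma coeff2_full_coframe:
  fixes T Ph \<theta> :: "complex^'n \<Rightarrow> complex^'n"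
  assumes T: "linear T" "\<And>y. Ph (T y) = y" "\<And>h. T (Ph h) = h" and th: "linear \<theta>"
    and \<phi>: "\<And>i X. \<phi> i X = Ph (fst X) $ i" and \<psi>: "\<And>i X. \<psi> i X = snd X $ i + \<theta> (Ph (fst X)) $ i"
    and lin: "\<And>Y. linear (\<lambda>X. \<Omega> X Y)" and alt: "\<And>X Y. \<Omega> X Y = - \<Omega> Y X"
  shows "coeff2 (full_coframe \<phi> \<psi>) \<Omega> (Hor k) (HorBar j)
       = p11 (\<lambda>a b. \<Omega> (hor_lift T \<theta> a) (hor_lift T \<theta> b)) (axis k 1) (axis j 1)"
proof -
  let ?H = "hor_lift T \<theta>"
  let ?V = "\<lambda>y::complex^'n. (0::complex^'n, y)"
  have Hl: "linear ?H" unfolding hor_lift_def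
    by (intro linearI) (simp_all add: linear_add[OF T(1)] linear_add[OF th] linear_cmul[OF T(1)] linear_cmul[OF th])
  have Vl: "linear ?V" by (intro linearI) simp_all
  have Phl: "linear Ph"
  proof (rule linearI)
    show "Ph (a + b) = Ph a + Ph b" for a b by (metis T linear_add)
    show "Ph (r *\<^sub>R a) = r *\<^sub>R Ph a" for r a by (metis T linear_cmul)
  qed
  have \<phi>H: "\<phi> i (?H y) = y $ i" "\<psi> i (?H y) = 0" "\<phi> i (?V y) = 0" "\<psi> i (?V y) = y $ i" for i y
    by (simp_all add: \<phi> \<psi> hor_lift_def T(2) linear_0[OF Phl] linear_0[OF th])
  have sc: "\<phi> i (r *\<^sub>R X) = r * \<phi> i X" "\<psi> i (r *\<^sub>R X) = r * \<psi> i X" for r :: real and i X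
    by (simp_all add: \<phi> \<psi> linear_cmul[OF Phl] linear_cmul[OF th] scaleR_conv_of_real[where 'a=complex] algebra_simps)
  have ng: "\<phi> i (- X) = - \<phi> i X" "\<psi> i (- X) = - \<psi> i X" for i X
    by (simp_all add: \<phi> \<psi> linear_neg[OF Phl] linear_neg[OF th])
  \<comment> \<open>For \<open>X\<close> the lift of a basis vector, or a vertical basis vector, and
    \<open>X'\<close> the one belonging to \<open>\<i>\<close> times that vector,
    \<open>?P + \<i> ?Q\<close> is \<open>(X - \<i> X')/2\<close> at the indices \<open>Hor\<close>
    and \<open>Ver\<close> and its conjugate at the barred ones.\<close>
  let ?P = "\<lambda>a. (1/2) *\<^sub>R (case a of Hor i \<Rightarrow> ?H (axis i 1) | HorBar i \<Rightarrow> ?H (axis i 1)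
    | Ver i \<Rightarrow> ?V (axis i 1) | VerBar i \<Rightarrow> ?V (axis i 1))"
  let ?Q = "\<lambda>a. case a of Hor i \<Rightarrow> (-1/2) *\<^sub>R ?H (axis i \<i>) | HorBar i \<Rightarrow> (1/2) *\<^sub>R ?H (axis i \<i>)
    | Ver i \<Rightarrow> (-1/2) *\<^sub>R ?V (axis i \<i>) | VerBar i \<Rightarrow> (1/2) *\<^sub>R ?V (axis i \<i>)"
  let ?\<theta> = "full_coframe \<phi> \<psi>"
  have dual: "?\<theta> b (?P a) + \<i> * ?\<theta> b (?Q a) = (if a = b then 1 else 0)" for a b
    by (cases a; cases b) (simp_all add: full_coframe_def \<phi>H sc ng axis_def scaleR_conv_of_real[where 'a=complex])
  have recH: "(\<Sum>i\<in>UNIV. Re (u $ i) *\<^sub>R ?H (axis i 1) + Im (u $ i) *\<^sub>R ?H (axis i \<i>)) = ?H u" for u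
    by (subst (3) vec_real_basis[of u]) (simp add: linear_sum[OF Hl] linear_add[OF Hl] linear_cmul[OF Hl])
  have recV: "(\<Sum>i\<in>UNIV. Re (u $ i) *\<^sub>R ?V (axis i 1) + Im (u $ i) *\<^sub>R ?V (axis i \<i>)) = ?V u" for u
    by (subst (3) vec_real_basis[of u]) (simp only: linear_sum[OF Vl] linear_add[OF Vl] linear_cmul[OF Vl])
  have expand: "(\<Sum>a\<in>UNIV. Re (?\<theta> a X) *\<^sub>R ?P a - Im (?\<theta> a X) *\<^sub>R ?Q a) = X" for X
  proof -
    let ?y = "\<chi> i. \<phi> i X" and ?z = "\<chi> i. \<psi> i X"
    have "(\<Sum>a\<in>UNIV. Re (?\<theta> a X) *\<^sub>R ?P a - Im (?\<theta> a X) *\<^sub>R ?Q a)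
      = (\<Sum>i\<in>UNIV. Re (?y $ i) *\<^sub>R ?H (axis i 1) + Im (?y $ i) *\<^sub>R ?H (axis i \<i>))
      + (\<Sum>i\<in>UNIV. Re (?z $ i) *\<^sub>R ?V (axis i 1) + Im (?z $ i) *\<^sub>R ?V (axis i \<i>))"
    proof -
      have "(\<Sum>a\<in>UNIV. Re (?\<theta> a X) *\<^sub>R ?P a - Im (?\<theta> a X) *\<^sub>R ?Q a)
       = (\<Sum>i\<in>UNIV. (Re (\<phi> i X) *\<^sub>R (1/2) *\<^sub>R ?H (axis i 1) - Im (\<phi> i X) *\<^sub>R (-1/2) *\<^sub>R ?H (axis i \<i>))
          + (Re (\<phi> i X) *\<^sub>R (1/2) *\<^sub>R ?H (axis i 1) + Im (\<phi> i X) *\<^sub>R (1/2) *\<^sub>R ?H (axis i \<i>)))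
       + (\<Sum>i\<in>UNIV. (Re (\<psi> i X) *\<^sub>R (1/2) *\<^sub>R ?V (axis i 1) - Im (\<psi> i X) *\<^sub>R (-1/2) *\<^sub>R ?V (axis i \<i>))
          + (Re (\<psi> i X) *\<^sub>R (1/2) *\<^sub>R ?V (axis i 1) + Im (\<psi> i X) *\<^sub>R (1/2) *\<^sub>R ?V (axis i \<i>)))"
        by (simp only: sum_cof_index full_coframe_def cof_index.case cnj.sel scaleR_minus_left
            diff_minus_eq_add sum.distrib add.assoc)
      also have "\<dots> = (\<Sum>i\<in>UNIV. Re (?y $ i) *\<^sub>R ?H (axis i 1) + Im (?y $ i) *\<^sub>R ?H (axis i \<i>))
        + (\<Sum>i\<in>UNIV. Re (?z $ i) *\<^sub>R ?V (axis i 1) + Im (?z $ i) *\<^sub>R ?V (axis i \<i>))"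
      proof -
        have "(r *\<^sub>R (1/2) *\<^sub>R a - s *\<^sub>R (-1/2) *\<^sub>R b) + (r *\<^sub>R (1/2) *\<^sub>R a + s *\<^sub>R (1/2) *\<^sub>R b)
          = r *\<^sub>R a + s *\<^sub>R b" for r s and a b :: "'n slit"
        proof -
          have "(r *\<^sub>R (1/2) *\<^sub>R a - s *\<^sub>R (-1/2) *\<^sub>R b) + (r *\<^sub>R (1/2) *\<^sub>R a + s *\<^sub>R (1/2) *\<^sub>R b)
            = (r/2 + r/2) *\<^sub>R a + (s/2 + s/2) *\<^sub>R b"
            unfolding scaleR_add_left by (simp add: algebra_simps)
          then show ?thesis by simp
        qed
        then show ?thesis by (simp only: vec_lambda_beta)
      qed
      finally show ?thesis .
    qed
    also have "\<dots> = ?H ?y + ?V ?z" unfolding recH recV ..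
    also have "\<dots> = X"
    proof -
      have "?y = Ph (fst X)" "?z = snd X + \<theta> (Ph (fst X))" by (simp_all add: \<phi> \<psi> vec_eq_iff)
      then show ?thesis by (simp add: hor_lift_def T prod_eq_iff)
    qed
    finally show ?thesis .
  qed
  have zero: "(\<Sum>a\<in>UNIV. Re (?\<theta> a X) *\<^sub>R ?Q a + Im (?\<theta> a X) *\<^sub>R ?P a) = 0" for X
  proof -
    let ?h = "\<lambda>a. Re (?\<theta> a X) *\<^sub>R ?Q a + Im (?\<theta> a X) *\<^sub>R ?P a"
    have "?h (Hor i) + ?h (HorBar i) = 0" "?h (Ver i) + ?h (VerBar i) = 0" for i
      by (simp_all add: full_coframe_def zero_prod_def)
    then have "(\<Sum>i\<in>UNIV. ?h (Hor i) + ?h (HorBar i)) + (\<Sum>i\<in>UNIV. ?h (Ver i) + ?h (VerBar i)) = 0"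
      by (simp only: sum.neutral_const add_0)
    then show ?thesis unfolding sum_cof_index by (simp only: sum.distrib add.assoc)
  qed
  have i1: "\<i> *s axis i 1 = axis i \<i>" for i :: 'n
    by (simp add: vec_eq_iff axis_def)
  have lin2: "linear (\<lambda>Y. \<Omega> X Y)" for X
    using linear_compose_neg[OF lin[of X]] by (subst alt) simp
  show ?thesis
    unfolding coeff2_eq[OF dual expand zero lin alt]
    by (simp add: p11_def i1 linear_cmul[OF lin] linear_cmul[OF lin2] linear_neg[OF lin] linear_neg[OF lin2]
        scaleR_conv_of_real[where 'a=complex] field_simps)
qed

section \<open>The fibre metric and the Chern-Rund connection\<close>

text \<open>The function \<open>f\<close> plays the part of the squared metric on one fibre, in the
  coordinates of a fixed basis. Of positivity only nonvanishing is recorded, as it serves to invert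
  the matrix of \<open>g\<close>.\<close>

locale finsler_fibre =
  fixes f :: "complex^'n \<Rightarrow> complex"
  assumes smooth: "smooth_on (UNIV - {0}) f"
    and real_valued: "cnj (f v) = f v"
    and homogeneous: "f (a *s v) = a * cnj a * f v"
    and positive: "v \<noteq> 0 \<Longrightarrow> u \<noteq> 0 \<Longrightarrow>
      (\<Sum>i\<in>UNIV. \<Sum>j\<in>UNIV. wd i (wdbar j f) v * u $ i * cnj (u $ j)) \<noteq> 0"
begin

abbreviation gb where "gb i j \<equiv> wd i (wdbar j f)"
abbreviation gh where "gh i j \<equiv> wd i (wd j f)"
abbreviation Ch where "Ch i j l \<equiv> wd i (wdbar j (wd l f))"
abbreviation Cb where "Cb i j l \<equiv> wd i (wdbar j (wdbar l f))"

section \<open>Symmetries of the second and third fibre derivatives\<close>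

lemma open_slit: "open (UNIV - {0::complex^'n})"
  by (simp add: open_delete)

lemmas smooth_wirtinger = smooth_on_wirtinger[OF open_slit]
lemmas commute_slit = wirtinger_commute[OF open_slit]

lemma smooth_first: "smooth_on (UNIV - {0}) (wd i f)" "smooth_on (UNIV - {0}) (wdbar i f)"
  by (intro smooth_wirtinger smooth)+

lemma smooth_second:
  "smooth_on (UNIV - {0}) (gb i j)" "smooth_on (UNIV - {0}) (gh i j)"
  "smooth_on (UNIV - {0}) (wdbar i (wd j f))" "smooth_on (UNIV - {0}) (wdbar i (wdbar j f))"
  by (intro smooth_wirtinger smooth)+

lemma smooth_third: "smooth_on (UNIV - {0}) (Ch i j l)" "smooth_on (UNIV - {0}) (Cb i j l)"
  by (intro smooth_wirtinger smooth)+

lemma diff_slit: "smooth_on (UNIV - {0}) h \<Longrightarrow> v \<noteq> 0 \<Longrightarrow> h differentiable (at v)"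
  for h :: "complex^'n \<Rightarrow> complex"
  by (rule smooth_on_differentiable) auto

lemma cong_slit:
  fixes h k :: "complex^'n \<Rightarrow> complex"
  assumes "v \<noteq> 0" "\<And>y. y \<noteq> 0 \<Longrightarrow> h y = k y"
  shows "wd i h v = wd i k v" "wdbar i h v = wdbar i k v"
  using wirtinger_cong_open[OF open_slit, of v h k] assms by auto

lemma cnj_slit:
  fixes h :: "complex^'n \<Rightarrow> complex"
  assumes "smooth_on (UNIV - {0}) h" "v \<noteq> 0" "\<And>y. y \<noteq> 0 \<Longrightarrow> cnj (h y) = k y"
  shows "cnj (wd i h v) = wdbar i k v" "cnj (wdbar i h v) = wd i k v"
  using wirtinger_cnj[OF diff_slit[OF assms(1,2)], of i] cong_slit[OF assms(2), of "\<lambda>y. cnj (h y)" k i] assms(3)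
  by auto

lemma gb_commute: "v \<noteq> 0 \<Longrightarrow> wdbar i (wd j f) v = gb j i v"
  by (rule commute_slit(2)[OF _ smooth]) auto

lemma gb_cnj: assumes v: "v \<noteq> 0" shows "cnj (gb i j v) = gb j i v"
proof -
  have 1: "cnj (wdbar j f y) = wd j f y" if "y \<noteq> 0" for y
    by (rule cnj_slit(2)[OF smooth that]) (simp add: real_valued)
  show ?thesis
    using cnj_slit(1)[OF smooth_first(2) v 1] gb_commute[OF v] by simp
qed

lemma gh_cnj: assumes v: "v \<noteq> 0" shows "cnj (gh i j v) = wdbar i (wdbar j f) v"
proof -
  have 1: "cnj (wd j f y) = wdbar j f y" if "y \<noteq> 0" for y
    by (rule cnj_slit(1)[OF smooth that]) (simp add: real_valued)
  show ?thesis by (rule cnj_slit(1)[OF smooth_first(1) v 1])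
qed

lemma Cb_cnj: assumes v: "v \<noteq> 0" shows "cnj (Cb i j l v) = Ch j i l v"
proof -
  have 1: "cnj (wdbar l f y) = wd l f y" if "y \<noteq> 0" for y
    by (rule cnj_slit(2)[OF smooth that]) (simp add: real_valued)
  have 2: "cnj (wdbar j (wdbar l f) y) = wd j (wd l f) y" if "y \<noteq> 0" for y
    by (rule cnj_slit(2)[OF smooth_first(2) that 1])
  have "cnj (Cb i j l v) = wdbar i (wd j (wd l f)) v"
    by (rule cnj_slit(1)[OF smooth_second(4) v 2])
  also have "\<dots> = Ch j i l v" by (rule commute_slit(2)[OF _ smooth_first(1)]) (use v in auto)
  finally show ?thesis .
qed

lemma Ch_cnj: "v \<noteq> 0 \<Longrightarrow> cnj (Ch i j l v) = Cb j i l v"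
  using Cb_cnj[of v j i l] by (metis complex_cnj_cnj)

lemma Cb_sym: assumes v: "v \<noteq> 0" shows "Cb i j l v = wdbar l (gb i j) v"
proof -
  have "wdbar l (gb i j) v = wd i (wdbar l (wdbar j f)) v"
    by (rule commute_slit(2)[OF _ smooth_first(2)]) (use v in auto)
  also have "\<dots> = Cb i j l v"
    by (rule cong_slit(1)[OF v]) (auto intro: commute_slit(3)[OF _ smooth])
  finally show ?thesis by simp
qed

lemma Ch_sym: assumes v: "v \<noteq> 0" shows "Ch i j l v = wd l (gb i j) v"
proof -
  have "Ch i j l v = wd i (wd l (wdbar j f)) v"
    by (rule cong_slit(1)[OF v]) (auto intro: commute_slit(2)[OF _ smooth])
  also have "\<dots> = wd l (gb i j) v"
    by (rule commute_slit(1)[OF _ smooth_first(2)]) (use v in auto)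
  finally show ?thesis .
qed

lemma gb_deriv:
  assumes v: "v \<noteq> 0"
  shows "frechet_derivative (gb i j) (at v) u = (\<Sum>l\<in>UNIV. Ch i j l v * u $ l + Cb i j l v * cnj (u $ l))"
  by (simp add: frechet_derivative_wirtinger[OF diff_slit[OF smooth_second(1) v]] Ch_sym[OF v] Cb_sym[OF v] mult.commute)

text \<open>Differentiate \<open>f (v + t a v) = |1 + t a|^2 f v\<close> in the real variable
  \<open>t\<close> at 0. The choices \<open>a = 1\<close> and \<open>a = \<i>\<close> separate the
  holomorphic from the antiholomorphic part of the differential.\<close>

lemma euler: assumes v: "v \<noteq> 0" shows "(\<Sum>i\<in>UNIV. v $ i * wd i f v) = f v"
proof -
  let ?D = "frechet_derivative f (at v)"
  have f: "(f has_derivative ?D) (at v)"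
    by (rule frechet_derivative_has_derivative[OF diff_slit[OF smooth v]])
  have lin: "linear ?D" using f by (rule has_derivative_linear)
  have curve: "?D (a *s v) = (a + cnj a) * f v" for a
  proof -
    have p: "((\<lambda>t::real. v + t *\<^sub>R (a *s v)) has_derivative (\<lambda>t. t *\<^sub>R (a *s v))) (at 0)"
      by (auto intro!: derivative_eq_intros)
    have f': "(f has_derivative ?D) (at (v + 0 *\<^sub>R (a *s v)))" using f by simp
    have 1: "((\<lambda>t::real. f (v + t *\<^sub>R (a *s v))) has_derivative (\<lambda>t. ?D (t *\<^sub>R (a *s v)))) (at 0)"
      by (rule has_derivative_compose[OF p f'])
    have eq: "f (v + t *\<^sub>R (a *s v)) = (1 + t * a) * (1 + t * cnj a) * f v" for t :: real
    proof -
      have "v + t *\<^sub>R (a *s v) = (1 + t * a) *s v"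
        by (simp add: vec_eq_iff scaleR_conv_of_real[where 'a=complex] algebra_simps)
      then show ?thesis by (simp only: homogeneous) simp
    qed
    have 2: "((\<lambda>t::real. (1 + t * a) * (1 + t * cnj a) * f v) has_derivative (\<lambda>t. (t * a + t * cnj a) * f v)) (at 0)"
      by (auto intro!: derivative_eq_intros ext simp: algebra_simps)
    have "(\<lambda>t. ?D (t *\<^sub>R (a *s v))) = (\<lambda>t. (complex_of_real t * a + t * cnj a) * f v)"
      using has_derivative_unique[OF 1[unfolded eq] 2] .
    from fun_cong[OF this, of 1] show ?thesis by simp
  qed
  have w: "?D u = (\<Sum>i\<in>UNIV. u $ i * wd i f v) + (\<Sum>i\<in>UNIV. cnj (u $ i) * wdbar i f v)" for u
    by (simp add: frechet_derivative_wirtinger[OF diff_slit[OF smooth v]] sum.distrib)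
  have "?D v = 2 * f v" using curve[of 1] by (simp add: vec_eq_iff)
  moreover have "?D (\<i> *s v) = 0" using curve[of \<i>] by simp
  ultimately have "(\<Sum>i\<in>UNIV. v $ i * wd i f v) + (\<Sum>i\<in>UNIV. cnj (v $ i) * wdbar i f v) = 2 * f v"
    "\<i> * (\<Sum>i\<in>UNIV. v $ i * wd i f v) - \<i> * (\<Sum>i\<in>UNIV. cnj (v $ i) * wdbar i f v) = 0"
    using w[of v] w[of "\<i> *s v"] by (simp_all add: sum_distrib_left sum_negf mult.assoc)
  then show ?thesis by (simp add: right_diff_distrib[symmetric])
qed

text \<open>The operator \<open>wdbar j\<close> commutes with the holomorphic Euler operator and so
  preserves the degree \<open>c\<close>; in \<open>euler_wd\<close> the degree drops by one.\<close>

lemma euler_wdbar: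
  fixes h :: "complex^'n \<Rightarrow> complex"
  assumes h: "smooth_on (UNIV - {0}) h" and e: "\<And>v. v \<noteq> 0 \<Longrightarrow> (\<Sum>i\<in>UNIV. v $ i * wd i h v) = c * h v"
    and v: "v \<noteq> 0"
  shows "(\<Sum>i\<in>UNIV. v $ i * wd i (wdbar j h) v) = c * wdbar j h v"
proof -
  have "(\<Sum>i\<in>UNIV. v $ i * wd i (wdbar j h) v) = (\<Sum>i\<in>UNIV. v $ i * wdbar j (wd i h) v)"
    by (rule sum.cong) (use commute_slit(2)[OF _ h] v in auto)
  also have "\<dots> = wdbar j (\<lambda>v. \<Sum>i\<in>UNIV. v $ i * wd i h v) v"
    using wirtinger_euler_op(2)[of "\<lambda>i. wd i h" v j, OF diff_slit[OF smooth_wirtinger(1)[OF h] v]] by simp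
  \<comment> \<open>The sum over the one-element type \<open>unit\<close> makes
    \<open>wirtinger_sum_cmult\<close> applicable to multiplication by \<open>c\<close>.\<close>
  also have "\<dots> = wdbar j (\<lambda>v. \<Sum>l\<in>(UNIV::unit set). h v * c) v"
    by (rule cong_slit(2)[OF v]) (simp add: e)
  also have "\<dots> = c * wdbar j h v"
    using wirtinger_sum_cmult(2)[of "\<lambda>l::unit. h" v j "\<lambda>l. c", OF diff_slit[OF h v]] by simp
  finally show ?thesis .
qed

lemma euler_wd:
  fixes h :: "complex^'n \<Rightarrow> complex"
  assumes h: "smooth_on (UNIV - {0}) h" and e: "\<And>v. v \<noteq> 0 \<Longrightarrow> (\<Sum>i\<in>UNIV. v $ i * wd i h v) = c * h v"
    and v: "v \<noteq> 0"
  shows "(\<Sum>i\<in>UNIV. v $ i * wd i (wd j h) v) = (c - 1) * wd j h v"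
proof -
  have "(\<Sum>i\<in>UNIV. v $ i * wd i (wd j h) v) + wd j h v = (\<Sum>i\<in>UNIV. v $ i * wd j (wd i h) v) + wd j h v"
    by (simp, rule sum.cong) (use commute_slit(1)[OF _ h] v in auto)
  also have "\<dots> = wd j (\<lambda>v. \<Sum>i\<in>UNIV. v $ i * wd i h v) v"
    using wirtinger_euler_op(1)[of "\<lambda>i. wd i h" v j, OF diff_slit[OF smooth_wirtinger(1)[OF h] v]] by simp
  also have "\<dots> = wd j (\<lambda>v. \<Sum>l\<in>(UNIV::unit set). h v * c) v"
    by (rule cong_slit(1)[OF v]) (simp add: e)
  also have "\<dots> = c * wd j h v"
    using wirtinger_sum_cmult(1)[of "\<lambda>l::unit. h" v j "\<lambda>l. c", OF diff_slit[OF h v]] by simp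
  finally show ?thesis by (simp add: algebra_simps)
qed

text \<open>For the holomorphic Euler operator \<open>f\<close> has degree 1, hence
  \<open>wd l f\<close> has degree 0 and \<open>wdbar l f\<close> degree 1, and a further
  \<open>wdbar j\<close> changes neither.\<close>

lemma euler_C:
  assumes v: "v \<noteq> 0"
  shows "(\<Sum>i\<in>UNIV. v $ i * Ch i j l v) = 0" "(\<Sum>i\<in>UNIV. v $ i * Cb i j l v) = cnj (gh j l v)"
proof -
  have 1: "(\<Sum>i\<in>UNIV. v $ i * wd i f v) = 1 * f v" if "v \<noteq> 0" for v using euler[OF that] by simp
  have 2: "(\<Sum>i\<in>UNIV. v $ i * wd i (wd l f) v) = 0 * wd l f v" if "v \<noteq> 0" for v
    using euler_wd[OF smooth 1 that] by simp
  have 3: "(\<Sum>i\<in>UNIV. v $ i * wd i (wdbar l f) v) = 1 * wdbar l f v" if "v \<noteq> 0" for v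
    using euler_wdbar[OF smooth 1 that] by simp
  show "(\<Sum>i\<in>UNIV. v $ i * Ch i j l v) = 0"
    using euler_wdbar[OF smooth_first(1) 2 v] by simp
  show "(\<Sum>i\<in>UNIV. v $ i * Cb i j l v) = cnj (gh j l v)"
    using euler_wdbar[OF smooth_first(2) 3 v] gh_cnj[OF v] by simp
qed

text \<open>The barred index numbers the rows, so that \<open>GM v *v x\<close> lists the products
  of \<open>x\<close> with the basis vectors under \<open>g\<close>.\<close>

definition GM :: "complex^'n \<Rightarrow> complex^'n^'n" where
  "GM v = (\<chi> j l. gb l j v)"

lemma GM_mult: "(GM v *v x) $ j = (\<Sum>l\<in>UNIV. gb l j v * x $ l)"
  by (simp add: GM_def matrix_vector_mult_def)

text \<open>A nonzero kernel vector would be a null vector of the Levi form.\<close>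

lemma det_GM: assumes v: "v \<noteq> 0" shows "det (GM v) \<noteq> 0"
proof -
  have "x = 0" if "GM v *v x = 0" for x
  proof (rule ccontr)
    assume "x \<noteq> 0"
    have "(\<Sum>i\<in>UNIV. \<Sum>j\<in>UNIV. gb i j v * x $ i * cnj (x $ j)) = (\<Sum>j\<in>UNIV. (GM v *v x) $ j * cnj (x $ j))"
      unfolding GM_mult by (subst sum.swap) (simp add: sum_distrib_right)
    also have "\<dots> = 0" by (simp add: that)
    finally show False using positive[OF v \<open>x \<noteq> 0\<close>] by simp
  qed
  then have "\<exists>B. B ** GM v = mat 1" by (simp add: matrix_left_invertible_ker)
  then have "invertible (GM v)" by (simp add: invertible_left_inverse)
  then show ?thesis by (simp add: invertible_det_nz)
qed

lemma GM_solve: "v \<noteq> 0 \<Longrightarrow> GM v *v x = r \<longleftrightarrow> x = solve (GM v) r"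
  by (rule solve_iff[OF det_GM])

lemma differentiable_GM_solve:
  assumes "v \<noteq> 0" "\<And>j. (\<lambda>v. r v $ j) differentiable (at v)"
  shows "(\<lambda>v. solve (GM v) (r v) $ k) differentiable (at v)"
  by (rule differentiable_solve) (simp_all add: GM_def det_GM[unfolded GM_def] assms diff_slit[OF smooth_second(1)])

end

section \<open>Bracket and connection operator in components\<close>

locale lie_fibre = finsler_fibre f for f :: "complex^'n \<Rightarrow> complex" +
  fixes br :: "complex^'n \<Rightarrow> complex^'n \<Rightarrow> complex^'n"
  assumes bilinear_br: "bilinear br" and br_alt: "br a b = - br b a"
begin

text \<open>For (1,0)-vectors with components \<open>u\<close> and \<open>w\<close>, \<open>mixed_br u w\<close> consists of the components of the
  (1,0)-part of the bracket of the first with the conjugate of the second.\<close>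

definition mixed_br :: "complex^'n \<Rightarrow> complex^'n \<Rightarrow> complex^'n" where
  "mixed_br u w = (\<chi> l. p11 (\<lambda>a b. br a b $ l) u w)"

lemma bilinear_br_comp: "bilinear (\<lambda>a b. br a b $ l)"
  unfolding bilinear_def
  by (auto intro!: linearI simp: bilinear_ladd[OF bilinear_br] bilinear_radd[OF bilinear_br]
      bilinear_lmul[OF bilinear_br] bilinear_rmul[OF bilinear_br])

lemma mixed_br_add: "mixed_br (u + u') w = mixed_br u w + mixed_br u' w" "mixed_br u (w + w') = mixed_br u w + mixed_br u w'"
  by (simp_all add: mixed_br_def vec_eq_iff p11_add[OF bilinear_br_comp])

lemma mixed_br_scale: "mixed_br (c *s u) w = c *s mixed_br u w" "mixed_br u (c *s w) = cnj c *s mixed_br u w"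
  by (simp_all add: mixed_br_def vec_eq_iff p11_scale[OF bilinear_br_comp])

lemma mixed_br_expand:
  "mixed_br u w $ l = (\<Sum>k\<in>UNIV. u $ k * mixed_br (axis k 1) w $ l)"
  "mixed_br u w $ l = (\<Sum>k\<in>UNIV. cnj (w $ k) * mixed_br u (axis k 1) $ l)"
  unfolding mixed_br_def vec_lambda_beta by (rule p11_expand[OF bilinear_br_comp])+

lemma mixed_br_alt: "mixed_br w w = (\<i> / 2) *s br w (\<i> *s w)"
proof -
  have alt: "br a b $ l = - br b a $ l" for a b l by (subst br_alt) simp
  show ?thesis by (simp add: mixed_br_def vec_eq_iff p11_alternating[OF bilinear_br_comp alt])
qed

text \<open>The right-hand side of the defining equation of the connection operator, tested on the
  basis vector \<open>u = axis j 1\<close>.\<close>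

definition conn_rhs :: "complex^'n \<Rightarrow> complex^'n \<Rightarrow> complex^'n" where
  "conn_rhs v w = (\<chi> j. (\<Sum>i\<in>UNIV. \<Sum>l\<in>UNIV. gb i l v * v $ i * cnj (mixed_br (axis j 1) w $ l))
     + cnj (\<Sum>l\<in>UNIV. gh j l v * mixed_br v w $ l))"

definition N :: "complex^'n \<Rightarrow> complex^'n \<Rightarrow> complex^'n" where
  "N v w = solve (GM v) (conn_rhs v w)"

lemma conn_rhs_add: "conn_rhs v (w + w') = conn_rhs v w + conn_rhs v w'"
  by (simp add: conn_rhs_def vec_eq_iff mixed_br_add algebra_simps sum.distrib)

lemma conn_rhs_scale: "conn_rhs v (c *s w) = c *s conn_rhs v w"
  by (simp add: conn_rhs_def vec_eq_iff mixed_br_scale algebra_simps sum_distrib_left)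

lemma N_iff: "v \<noteq> 0 \<Longrightarrow> GM v *v x = conn_rhs v w \<longleftrightarrow> x = N v w"
  unfolding N_def by (rule GM_solve)

lemma N_add: "v \<noteq> 0 \<Longrightarrow> N v (w + w') = N v w + N v w'"
  by (metis N_iff matrix_vector_right_distrib conn_rhs_add)

lemma N_scale: assumes "v \<noteq> 0" shows "N v (c *s w) = c *s N v w"
proof -
  have "GM v *v (c *s N v w) = c *s (GM v *v N v w)"
    by (simp add: vec_eq_iff GM_mult sum_distrib_left mult_ac)
  also have "\<dots> = conn_rhs v (c *s w)" using N_iff[OF assms] by (metis conn_rhs_scale)
  finally show ?thesis using N_iff[OF assms] by metis
qed

lemma N_expand: "v \<noteq> 0 \<Longrightarrow> N v w $ l = (\<Sum>k\<in>UNIV. w $ k * N v (axis k 1) $ l)"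
  by (rule complex_linear_expand[of "\<lambda>w. N v w $ l"]) (simp_all add: N_add N_scale)

text \<open>Both sides are conjugate linear in \<open>u\<close>, so testing on basis vectors
  suffices, and there the equation reads \<open>GM v *v x = conn_rhs v w\<close>.\<close>

lemma connection_operator_iff:
  assumes v: "v \<noteq> 0"
  shows "(\<forall>u. (\<Sum>i\<in>UNIV. \<Sum>j\<in>UNIV. gb i j v * x $ i * cnj (u $ j))
      = (\<Sum>i\<in>UNIV. \<Sum>j\<in>UNIV. gb i j v * v $ i * cnj (mixed_br u w $ j))
        + cnj (\<Sum>i\<in>UNIV. \<Sum>j\<in>UNIV. gh i j v * u $ i * mixed_br v w $ j)) \<longleftrightarrow> x = N v w"
    (is "(\<forall>u. ?L u = ?R u) \<longleftrightarrow> _")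
proof -
  have L: "?L u = (\<Sum>j\<in>UNIV. cnj (u $ j) * (GM v *v x) $ j)" for u
    unfolding GM_mult by (subst sum.swap) (simp add: sum_distrib_left mult_ac)
  have R1: "(\<Sum>i\<in>UNIV. gh i j v * axis k 1 $ i) = gh k j v" for j k
    by (simp add: axis_def if_distrib cong: if_cong)
  have Rax: "?R (axis k 1) = conn_rhs v w $ k" for k
    unfolding conn_rhs_def vec_lambda_beta
    by (subst (2) sum.swap) (simp add: sum_distrib_right[symmetric] R1)
  have R: "?R u = (\<Sum>j\<in>UNIV. cnj (u $ j) * conn_rhs v w $ j)" for u
  proof -
    have "cnj (?R u) = (\<Sum>j\<in>UNIV. u $ j * cnj (?R (axis j 1)))"
    proof (rule complex_linear_expand[of "\<lambda>u. cnj (?R u)"])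
      show "cnj (?R (a + b)) = cnj (?R a) + cnj (?R b)" for a b
        by (simp add: mixed_br_add algebra_simps sum.distrib)
      show "cnj (?R (c *s a)) = c * cnj (?R a)" for a c
        by (simp add: mixed_br_scale algebra_simps sum_distrib_left)
    qed
    then have "cnj (cnj (?R u)) = (\<Sum>j\<in>UNIV. cnj (u $ j) * conn_rhs v w $ j)"
      unfolding Rax by (simp only: cnj_sum complex_cnj_mult complex_cnj_cnj)
    then show ?thesis by (simp only: complex_cnj_cnj)
  qed
  have "(\<forall>u. ?L u = ?R u) \<longleftrightarrow> GM v *v x = conn_rhs v w"
  proof
    assume eq: "\<forall>u. ?L u = ?R u"
    have ax: "(\<Sum>j\<in>UNIV. cnj (axis k 1 $ j) * y $ j) = y $ k" for k and y :: "complex^'n"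
    proof -
      have "(\<Sum>j\<in>UNIV. cnj (axis k 1 $ j) * y $ j) = (\<Sum>j\<in>UNIV. if j = k then y $ j else 0)"
        by (rule sum.cong) (auto simp: axis_def)
      then show ?thesis by simp
    qed
    have "(GM v *v x) $ k = conn_rhs v w $ k" for k
      using eq[rule_format, of "axis k 1"] unfolding L R ax .
    then show "GM v *v x = conn_rhs v w" unfolding vec_eq_iff by blast
  qed (simp only: L R simp_thms)
  then show ?thesis using N_iff[OF v] by simp
qed

text \<open>This is what the coefficient of the \<open>k\<close>-th (1,0)-form in the metric
  equation leaves on the right when it is solved for its first term. The (0,1)-coefficients have
  been inserted, and \<open>n\<close> stands for the contraction of the unknown (1,0)-coefficients
  with \<open>v\<close>.\<close>

definition coeff_rhs :: "complex^'n \<Rightarrow> complex^'n \<Rightarrow> 'n \<Rightarrow> 'n \<Rightarrow> 'n \<Rightarrow> complex" where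
  "coeff_rhs v n k i j = (\<Sum>l\<in>UNIV. gb i l v * cnj (mixed_br (axis j 1) (axis k 1) $ l))
     - (\<Sum>l\<in>UNIV. Ch i j l v * n $ l) + (\<Sum>l\<in>UNIV. Cb i j l v * cnj (mixed_br v (axis k 1) $ l))"

text \<open>The contraction is known beforehand to be \<open>N v (axis k 1)\<close>, which turns the
  remaining equation into a linear system with matrix \<open>GM v\<close>.\<close>

definition Gam :: "complex^'n \<Rightarrow> 'n \<Rightarrow> 'n \<Rightarrow> 'n \<Rightarrow> complex" where
  "Gam v l i k = solve (GM v) (\<chi> j. coeff_rhs v (N v (axis k 1)) k i j) $ l"

definition conn :: "complex^'n \<Rightarrow> 'n conn_coeffs" where
  "conn v = (Gam v, \<lambda>l i k. - mixed_br (axis i 1) (axis k 1) $ l)"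

definition om :: "'n conn_coeffs \<Rightarrow> 'n \<Rightarrow> 'n \<Rightarrow> complex^'n \<Rightarrow> complex" where
  "om \<Gamma> i l y = (\<Sum>k\<in>UNIV. fst \<Gamma> i l k * y $ k + snd \<Gamma> i l k * cnj (y $ k))"

lemma linear_om: "linear (om \<Gamma> i l)"
  by (rule linearI) (simp_all add: om_def algebra_simps sum.distrib sum_distrib_left scaleR_conv_of_real[where 'a=complex])

lemma om_axis:
  "om \<Gamma> i l (axis k 1) = fst \<Gamma> i l k + snd \<Gamma> i l k"
  "om \<Gamma> i l (axis k \<i>) = \<i> * (fst \<Gamma> i l k - snd \<Gamma> i l k)"
proof -
  have "om \<Gamma> i l (axis k c) = (\<Sum>m\<in>UNIV. if m = k then fst \<Gamma> i l m * c + snd \<Gamma> i l m * cnj c else 0)" for c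
    unfolding om_def by (rule sum.cong) (auto simp: axis_def)
  then show "om \<Gamma> i l (axis k 1) = fst \<Gamma> i l k + snd \<Gamma> i l k"
    "om \<Gamma> i l (axis k \<i>) = \<i> * (fst \<Gamma> i l k - snd \<Gamma> i l k)"
    by (simp_all add: algebra_simps)
qed

text \<open>By Euler's relations the contraction with \<open>v\<close> does not depend on \<open>n\<close>.\<close>

lemma coeff_rhs_contract:
  assumes v: "v \<noteq> 0"
  shows "(\<Sum>i\<in>UNIV. v $ i * coeff_rhs v n k i j) = conn_rhs v (axis k 1) $ j"
proof -
  have swap: "(\<Sum>i\<in>UNIV. v $ i * (\<Sum>l\<in>UNIV. q i l * x l)) = (\<Sum>l\<in>UNIV. (\<Sum>i\<in>UNIV. v $ i * q i l) * x l)"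
    for q :: "'n \<Rightarrow> 'n \<Rightarrow> complex" and x
    by (simp add: sum_distrib_left sum_distrib_right mult.assoc) (rule sum.swap)
  have 1: "(\<Sum>i\<in>UNIV. v $ i * (\<Sum>l\<in>UNIV. gb i l v * cnj (mixed_br (axis j 1) (axis k 1) $ l)))
    = (\<Sum>i\<in>UNIV. \<Sum>l\<in>UNIV. gb i l v * v $ i * cnj (mixed_br (axis j 1) (axis k 1) $ l))"
    by (simp add: sum_distrib_left mult_ac)
  have "(\<Sum>i\<in>UNIV. v $ i * coeff_rhs v n k i j)
    = (\<Sum>i\<in>UNIV. v $ i * (\<Sum>l\<in>UNIV. gb i l v * cnj (mixed_br (axis j 1) (axis k 1) $ l)))
    - (\<Sum>i\<in>UNIV. v $ i * (\<Sum>l\<in>UNIV. Ch i j l v * n $ l))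
    + (\<Sum>i\<in>UNIV. v $ i * (\<Sum>l\<in>UNIV. Cb i j l v * cnj (mixed_br v (axis k 1) $ l)))"
    by (simp only: coeff_rhs_def distrib_left right_diff_distrib sum.distrib sum_subtractf)
  also have "\<dots> = conn_rhs v (axis k 1) $ j"
    unfolding swap[of "\<lambda>i l. Ch i j l v"] swap[of "\<lambda>i l. Cb i j l v"] euler_C[OF v] 1 conn_rhs_def by simp
  finally show ?thesis .
qed

text \<open>Contracting the system with \<open>v\<close> produces the equation of the connection
  operator, whatever \<open>n\<close> is. This removes the self-reference of the metric equation,
  where \<open>n\<close> is itself the contraction of the solution.\<close>

lemma contract_solution:
  assumes v: "v \<noteq> 0" and eq: "\<And>i j. (\<Sum>l\<in>UNIV. gb l j v * X l i) = coeff_rhs v n k i j"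
  shows "(\<Sum>i\<in>UNIV. v $ i * X l i) = N v (axis k 1) $ l"
proof -
  let ?x = "\<chi> l. \<Sum>i\<in>UNIV. v $ i * X l i"
  have "(GM v *v ?x) $ j = conn_rhs v (axis k 1) $ j" for j
  proof -
    have "(GM v *v ?x) $ j = (\<Sum>l\<in>UNIV. \<Sum>i\<in>UNIV. gb l j v * (v $ i * X l i))"
      by (simp add: GM_mult sum_distrib_left)
    also have "\<dots> = (\<Sum>i\<in>UNIV. v $ i * (\<Sum>l\<in>UNIV. gb l j v * X l i))"
      by (subst sum.swap) (simp add: sum_distrib_left mult_ac)
    also have "\<dots> = conn_rhs v (axis k 1) $ j" by (simp add: eq coeff_rhs_contract[OF v])
    finally show ?thesis .
  qed
  then have "GM v *v ?x = conn_rhs v (axis k 1)" unfolding vec_eq_iff by blast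
  then have "?x = N v (axis k 1)" using N_iff[OF v] by blast
  then show ?thesis by (metis vec_lambda_beta)
qed

lemma Gam_eq:
  assumes v: "v \<noteq> 0"
  shows "(\<Sum>l\<in>UNIV. gb l j v * Gam v l i k) = coeff_rhs v (N v (axis k 1)) k i j"
proof -
  have "GM v *v solve (GM v) (\<chi> j. coeff_rhs v (N v (axis k 1)) k i j) = (\<chi> j. coeff_rhs v (N v (axis k 1)) k i j)"
    using GM_solve[OF v] by blast
  then show ?thesis by (simp add: vec_eq_iff GM_mult Gam_def)
qed

lemma Gam_contract:
  assumes v: "v \<noteq> 0"
  shows "(\<Sum>i\<in>UNIV. v $ i * Gam v l i k) = N v (axis k 1) $ l"
  by (rule contract_solution[OF v Gam_eq[OF v]])

text \<open>A real linear form in \<open>y\<close> vanishes exactly when its (1,0)- and (0,1)-parts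
  do. Here the second is the conjugate of the first with \<open>i\<close> and \<open>j\<close>
  exchanged, so a single system for the (1,0)-coefficients remains.\<close>

lemma connection_equation_iff:
  assumes v: "v \<noteq> 0"
  shows "(\<forall>l i k. snd \<Gamma> l i k = - mixed_br (axis i 1) (axis k 1) $ l) \<and>
      (\<forall>i j y. (\<Sum>l\<in>UNIV. gb l j v * om \<Gamma> l i y + gb i l v * cnj (om \<Gamma> l j y)
          + Ch i j l v * (\<Sum>m\<in>UNIV. v $ m * om \<Gamma> l m y)
          + Cb i j l v * cnj (\<Sum>m\<in>UNIV. v $ m * om \<Gamma> l m y)) = 0)
    \<longleftrightarrow> \<Gamma> = conn v"
    (is "?A \<and> (\<forall>i j y. ?L i j y = 0) \<longleftrightarrow> _")
proof -
  have linL: "linear (?L i j)" for i j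
    by (rule linearI)
      (simp_all add: linear_add[OF linear_om] linear_cmul[OF linear_om] scaleR_conv_of_real[where 'a=complex]
        algebra_simps sum.distrib sum_distrib_left)
  have key: "(\<forall>i j y. ?L i j y = 0) \<longleftrightarrow> (\<forall>i j k. (\<Sum>l\<in>UNIV. gb l j v * fst \<Gamma> l i k)
      = coeff_rhs v (\<chi> l. \<Sum>m\<in>UNIV. v $ m * fst \<Gamma> l m k) k i j)" (is "_ \<longleftrightarrow> (\<forall>i j k. ?S i j k = ?s i j k)")
    if A: ?A
  proof -
    define n where "n l k = (\<Sum>m\<in>UNIV. v $ m * fst \<Gamma> l m k)" for l k
    have a: "(\<Sum>m\<in>UNIV. v $ m * (fst \<Gamma> l m k + snd \<Gamma> l m k))
        = n l k - mixed_br v (axis k 1) $ l"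
      "(\<Sum>m\<in>UNIV. v $ m * (\<i> * (fst \<Gamma> l m k - snd \<Gamma> l m k)))
        = \<i> * (n l k + mixed_br v (axis k 1) $ l)" for l k
      by (simp_all add: n_def A mixed_br_expand(1)[of v] sum_distrib_left sum.distrib sum_subtractf sum_negf algebra_simps)
    have 1: "?L i j (axis k 1) - \<i> * ?L i j (axis k \<i>) = 2 * (?S i j k - ?s i j k)" for i j k
      unfolding coeff_rhs_def om_axis a n_def[symmetric]
      unfolding sum_distrib_left right_diff_distrib distrib_left sum_subtractf[symmetric]
        sum.distrib[symmetric] vec_lambda_beta
      by (rule sum.cong) (simp_all add: A algebra_simps)
    \<comment> \<open>Conjugation exchanges the two indices of \<open>gb\<close> and the two
      families of third derivatives, hence the swapped \<open>i\<close> and \<open>j\<close> on the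
      right.\<close>
    have 2: "?L i j (axis k 1) + \<i> * ?L i j (axis k \<i>) = 2 * cnj (?S j i k - ?s j i k)" for i j k
      unfolding coeff_rhs_def om_axis a n_def[symmetric]
      unfolding complex_cnj_diff complex_cnj_add cnj_sum complex_cnj_mult complex_cnj_cnj vec_lambda_beta
        gb_cnj[OF v] Ch_cnj[OF v] Cb_cnj[OF v]
      unfolding sum_distrib_left right_diff_distrib distrib_left sum_subtractf[symmetric]
        sum.distrib[symmetric] vec_lambda_beta
      by (rule sum.cong) (simp_all add: A algebra_simps)
    show ?thesis
    proof
      assume L: "\<forall>i j y. ?L i j y = 0"
      have "2 * (?S i j k - ?s i j k) = 0" for i j k
        unfolding 1[symmetric] L[rule_format] by simp
      then show "\<forall>i j k. ?S i j k = ?s i j k" by simp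
    next
      assume S: "\<forall>i j k. ?S i j k = ?s i j k"
      show "\<forall>i j y. ?L i j y = 0"
      proof (intro allI)
        fix i j y
        have "?L i j (axis k 1) - \<i> * ?L i j (axis k \<i>) = 0" "?L i j (axis k 1) + \<i> * ?L i j (axis k \<i>) = 0" for k
          unfolding 1 2 using S by simp_all
        then show "?L i j y = 0"
          by (subst linear_wirtinger[OF linL]) (simp only: mult_zero_right div_0 add_0 sum.neutral_const)
      qed
    qed
  qed
  show ?thesis
  proof
    assume h: "?A \<and> (\<forall>i j y. ?L i j y = 0)"
    then have S: "(\<Sum>l\<in>UNIV. gb l j v * fst \<Gamma> l i k)
      = coeff_rhs v (\<chi> l. \<Sum>m\<in>UNIV. v $ m * fst \<Gamma> l m k) k i j" for i j k
      using key by blast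
    \<comment> \<open>The contraction is identified before the coefficients themselves are
      determined.\<close>
    have n: "(\<chi> l. \<Sum>m\<in>UNIV. v $ m * fst \<Gamma> l m k) = N v (axis k 1)" for k
      using contract_solution[OF v S] by (simp add: vec_eq_iff)
    have "GM v *v (\<chi> l. fst \<Gamma> l i k) = (\<chi> j. coeff_rhs v (N v (axis k 1)) k i j)" for i k
      by (simp add: vec_eq_iff GM_mult S n)
    then have "(\<chi> l. fst \<Gamma> l i k) = solve (GM v) (\<chi> j. coeff_rhs v (N v (axis k 1)) k i j)" for i k
      using GM_solve[OF v] by blast
    then have "fst \<Gamma> l i k = Gam v l i k" for l i k
      unfolding Gam_def by (metis vec_lambda_beta)
    then show "\<Gamma> = conn v" using h by (simp add: conn_def prod_eq_iff fun_eq_iff)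
  next
    assume \<Gamma>: "\<Gamma> = conn v"
    then have A: ?A by (simp add: conn_def)
    have "(\<Sum>l\<in>UNIV. gb l j v * fst \<Gamma> l i k) = coeff_rhs v (\<chi> l. \<Sum>m\<in>UNIV. v $ m * fst \<Gamma> l m k) k i j" for i j k
      by (simp add: \<Gamma> conn_def Gam_contract[OF v] Gam_eq[OF v])
    then show "?A \<and> (\<forall>i j y. ?L i j y = 0)" using key[OF A] A by blast
  qed
qed

lemma differentiable_vec_nth: "(\<lambda>v::complex^'n. v $ i) differentiable (at x within S)"
  by (rule bounded_linear_imp_differentiable[OF bounded_linear_vec_nth])

lemma differentiable_Am: "(\<lambda>v. mixed_br v w $ l) differentiable (at x within S)"
  by (subst mixed_br_expand(1)) (auto intro!: differentiable_sum differentiable_mult differentiable_vec_nth)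

lemma differentiable_N:
  assumes v: "v \<noteq> 0" shows "(\<lambda>v. N v w $ l) differentiable (at v)"
  unfolding N_def
  by (rule differentiable_GM_solve[OF v])
    (auto simp: conn_rhs_def intro!: differentiable_sum differentiable_mult differentiable_add differentiable_vec_nth
      iffD2[OF differentiable_cnj_iff] differentiable_Am diff_slit[OF smooth_second(1) v] diff_slit[OF smooth_second(2) v])

lemma differentiable_Gam:
  assumes v: "v \<noteq> 0" shows "(\<lambda>v. Gam v l i k) differentiable (at v)"
  unfolding Gam_def
  by (rule differentiable_GM_solve[OF v])
    (auto simp: coeff_rhs_def intro!: differentiable_sum differentiable_mult differentiable_add differentiable_diff
      differentiable_vec_nth iffD2[OF differentiable_cnj_iff] differentiable_Am differentiable_N[OF v]
      diff_slit[OF smooth_second(1) v] diff_slit[OF smooth_third(1) v] diff_slit[OF smooth_third(2) v])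

text \<open>The components of \<open>R(w, cbar w) v\<close>, with the bracket of \<open>v\<close> and
  \<open>part01 [cbar w, w]\<close> written as \<open>mixed_br v (mixed_br w w)\<close>: the latter (0,1)-vector is the conjugate of
  \<open>part10 [w, cbar w]\<close>.\<close>

definition curv_vec :: "complex^'n \<Rightarrow> complex^'n \<Rightarrow> 'n \<Rightarrow> complex" where
  "curv_vec v w i = (\<Sum>l\<in>UNIV. mixed_br v w $ l * wd l (\<lambda>u. N u w $ i) v)
     - (\<Sum>l\<in>UNIV. cnj (N v w $ l) * wdbar l (\<lambda>u. N u w $ i) v)
     + N v (mixed_br w w) $ i - mixed_br (N v w) w $ i + mixed_br v (mixed_br w w) $ i"

end

section \<open>Curvature in coordinates\<close>

lemma differentiable_vecI:
  fixes h :: "'a::real_normed_vector \<Rightarrow> complex^'n"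
  assumes "\<And>k. (\<lambda>x. h x $ k) differentiable F"
  shows "h differentiable F"
proof -
  have "bounded_linear (\<lambda>a::complex. axis k a :: complex^'n)" for k
  proof -
    have "linear (\<lambda>a::complex. axis k a :: complex^'n)"
      by (rule linearI) (simp_all add: vec_eq_iff axis_def)
    then show ?thesis by (rule linear_conv_bounded_linear[THEN iffD1])
  qed
  then have "(\<lambda>x. axis k (h x $ k) :: complex^'n) differentiable F" for k
    using assms[of k] bounded_linear.has_derivative unfolding differentiable_def by blast
  then have "(\<lambda>x. \<Sum>k\<in>UNIV. axis k (h x $ k) :: complex^'n) differentiable F"
    by (intro differentiable_sum) auto
  moreover have "(\<Sum>k\<in>UNIV. axis k (y $ k)) = y" for y :: "complex^'n"
  proof -
    have "(\<Sum>k\<in>UNIV. axis k (y $ k)) = (\<Sum>k\<in>UNIV. y $ k *s axis k 1)"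
      by (rule sum.cong) (auto simp: vec_eq_iff axis_def)
    then show ?thesis by (simp add: basis_expansion)
  qed
  ultimately show ?thesis by simp
qed

lemma complex_linear_matrix:
  fixes L :: "complex^'n \<Rightarrow> complex^'m"
  assumes "linear L" "\<And>c y. L (c *s y) = c *s L y"
  shows "L y = (\<chi> i j. L (axis j 1) $ i) *v y"
proof -
  have "L y $ i = (\<Sum>k\<in>UNIV. y $ k * L (axis k 1) $ i)" for i
    by (rule complex_linear_expand[of "\<lambda>y. L y $ i"]) (simp_all add: linear_add[OF assms(1)] assms(2))
  then show ?thesis by (simp add: vec_eq_iff matrix_vector_mult_def mult.commute)
qed

text \<open>Near \<open>x\<close> the function belonging to a sum of arguments is the sum of the
  functions, so the derivatives add as well, although differentiability is assumed only for each
  fixed argument.\<close>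

lemma linear_ext_d:
  fixes \<alpha> :: "'v::real_normed_vector \<Rightarrow> 'v \<Rightarrow> complex"
  assumes S: "open S" "x \<in> S" and lin: "\<And>y. y \<in> S \<Longrightarrow> linear (\<alpha> y)"
    and d: "\<And>X. (\<lambda>y. \<alpha> y X) differentiable (at x)"
  shows "linear (\<lambda>X. ext_d \<alpha> x X Y)"
proof -
  let ?D = "\<lambda>X. frechet_derivative (\<lambda>y. \<alpha> y X) (at x)"
  have D: "((\<lambda>y. \<alpha> y X) has_derivative ?D X) (at x)" for X
    by (rule frechet_derivative_has_derivative[OF d])
  have add: "?D (X + X') Y = ?D X Y + ?D X' Y" for X X'
  proof -
    have "((\<lambda>y. \<alpha> y (X + X')) has_derivative (\<lambda>h. ?D X h + ?D X' h)) (at x)"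
      by (rule has_derivative_transform_within_open[OF has_derivative_add[OF D D] S])
        (simp add: linear_add[OF lin])
    then show ?thesis by (simp add: frechet_derivative_eqI)
  qed
  have scale: "?D (r *\<^sub>R X) Y = r *\<^sub>R ?D X Y" for r X
  proof -
    have "((\<lambda>y. \<alpha> y (r *\<^sub>R X)) has_derivative (\<lambda>h. r *\<^sub>R ?D X h)) (at x)"
      by (rule has_derivative_transform_within_open[OF has_derivative_scaleR_right[OF D] S])
        (simp add: linear_cmul[OF lin])
    then show ?thesis by (simp add: frechet_derivative_eqI)
  qed
  have l: "linear (?D Y)" by (rule has_derivative_linear[OF D])
  show ?thesis
    by (rule linearI) (simp_all add: ext_d_def add scale linear_add[OF l] linear_cmul[OF l] algebra_simps)
qed

text \<open>The family \<open>T\<close> of left-invariant frames over an open set \<open>U\<close> of coordinates,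
  \<open>Ph z\<close> being the Maurer--Cartan form, with the structure constants \<open>br\<close>.\<close>

locale local_model = lie_fibre f br for f :: "complex^'n \<Rightarrow> complex" and br +
  fixes U :: "(complex^'n) set" and T Ph :: "complex^'n \<Rightarrow> complex^'n \<Rightarrow> complex^'n"
  assumes open_U: "open U"
    and linear_T: "z \<in> U \<Longrightarrow> linear (T z)"
    and T_scale: "z \<in> U \<Longrightarrow> T z (c *s y) = c *s T z y"
    and Ph_T: "z \<in> U \<Longrightarrow> Ph z (T z y) = y"
    and T_Ph: "z \<in> U \<Longrightarrow> T z (Ph z h) = h"
    and differentiable_T: "z \<in> U \<Longrightarrow> (\<lambda>z. T z y) differentiable (at z)"
    and bracket: "z \<in> U \<Longrightarrow> frechet_derivative (\<lambda>z. T z y) (at z) (T z x)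
        - frechet_derivative (\<lambda>z. T z x) (at z) (T z y) = T z (br x y)"
begin

lemma linear_Ph: assumes "z \<in> U" shows "linear (Ph z)"
proof (rule linearI)
  show "Ph z (a + b) = Ph z a + Ph z b" for a b
    using Ph_T[OF assms, of "Ph z a + Ph z b"] by (simp add: linear_add[OF linear_T[OF assms]] T_Ph[OF assms])
  show "Ph z (r *\<^sub>R a) = r *\<^sub>R Ph z a" for r a
    using Ph_T[OF assms, of "r *\<^sub>R Ph z a"] by (simp add: linear_cmul[OF linear_T[OF assms]] T_Ph[OF assms])
qed

text \<open>As \<open>Ph z\<close> inverts the complex linear map \<open>T z\<close>, Cramer's rule
  expresses it by entries that are differentiable in \<open>z\<close>.\<close>

lemma differentiable_Ph: assumes z: "z \<in> U" shows "(\<lambda>z. Ph z h) differentiable (at z)"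
proof -
  define M where "M z = (\<chi> i j. T z (axis j 1) $ i)" for z
  have TM: "T z y = M z *v y" if "z \<in> U" for z y
    unfolding M_def by (rule complex_linear_matrix[OF linear_T[OF that] T_scale[OF that]])
  have det: "det (M z) \<noteq> 0" if "z \<in> U" for z
  proof -
    have "x = 0" if "M z *v x = 0" for x
      using TM[OF \<open>z \<in> U\<close>, of x] TM[OF \<open>z \<in> U\<close>, of 0] that Ph_T[OF \<open>z \<in> U\<close>, of x] Ph_T[OF \<open>z \<in> U\<close>, of 0] by simp
    then have "\<exists>B. B ** M z = mat 1" by (simp add: matrix_left_invertible_ker)
    then have "invertible (M z)" by (simp add: invertible_left_inverse)
    then show ?thesis by (simp add: invertible_det_nz)
  qed
  have "Ph z h = solve (M z) h" if "z \<in> U" for z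
    using TM[OF that, of "Ph z h"] T_Ph[OF that, of h] solve_iff[OF det[OF that], of "Ph z h" h] by simp
  then have "(\<lambda>z. Ph z h) differentiable (at z) \<longleftrightarrow> (\<lambda>z. solve (M z) h) differentiable (at z)"
    by (intro differentiable_cong_open[OF open_U z]) auto
  moreover have "(\<lambda>z. solve (M z) h) differentiable (at z)"
  proof (intro differentiable_vecI differentiable_solve det[OF z])
    show "(\<lambda>y. M y $ i $ j) differentiable (at z)" for i j
      using differentiable_compose[OF bounded_linear_imp_differentiable[OF bounded_linear_vec_nth]
          differentiable_T[OF z, of "axis j 1"]] by (simp add: M_def)
  qed simp
  ultimately show ?thesis by simp
qed

text \<open>Differentiating \<open>T z (Ph z Y) = Y\<close> expresses the derivative of
  \<open>Ph\<close> by that of \<open>T\<close>, whose antisymmetrisation is the bracket of the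
  frame fields.\<close>

lemma maurer_cartan:
  assumes z: "z \<in> U"
  shows "frechet_derivative (\<lambda>z. Ph z Y) (at z) X - frechet_derivative (\<lambda>z. Ph z X) (at z) Y
    = - br (Ph z X) (Ph z Y)"
proof -
  let ?DT = "\<lambda>a. frechet_derivative (\<lambda>z. T z a) (at z)"
  let ?DP = "\<lambda>Y. frechet_derivative (\<lambda>z. Ph z Y) (at z)"
  have DT: "((\<lambda>z. T z a) has_derivative ?DT a) (at z)" for a
    by (rule frechet_derivative_has_derivative[OF differentiable_T[OF z]])
  have DP: "((\<lambda>z. Ph z Y) has_derivative ?DP Y) (at z)" for Y
    by (rule frechet_derivative_has_derivative[OF differentiable_Ph[OF z]])
  have *: "?DP Y X = - Ph z (?DT (Ph z Y) X)" for X Y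
  proof -
    have 1: "((\<lambda>z. T z (Ph z Y)) has_derivative (\<lambda>h. ?DT (Ph z Y) h + T z (?DP Y h))) (at z)"
      by (rule has_derivative_linear_apply[OF open_U z linear_T DT DP])
    have 2: "((\<lambda>z. T z (Ph z Y)) has_derivative (\<lambda>h. 0)) (at z)"
      by (rule has_derivative_transform_within_open[OF has_derivative_const[of Y] open_U z]) (simp add: T_Ph)
    have "?DT (Ph z Y) X + T z (?DP Y X) = 0"
      using fun_cong[OF has_derivative_unique[OF 1 2], of X] .
    then have "T z (?DP Y X) = - ?DT (Ph z Y) X" by (simp add: add_eq_0_iff)
    then have "Ph z (T z (?DP Y X)) = Ph z (- ?DT (Ph z Y) X)" by simp
    then show ?thesis by (simp add: Ph_T[OF z] linear_neg[OF linear_Ph[OF z]])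
  qed
  have "?DP Y X - ?DP X Y = - (Ph z (?DT (Ph z Y) X) - Ph z (?DT (Ph z X) Y))"
    by (simp add: *)
  also have "\<dots> = - Ph z (?DT (Ph z Y) (T z (Ph z X)) - ?DT (Ph z X) (T z (Ph z Y)))"
    by (simp only: linear_diff[OF linear_Ph[OF z]] T_Ph[OF z])
  also have "\<dots> = - br (Ph z X) (Ph z Y)" by (simp only: bracket[OF z] Ph_T[OF z])
  finally show ?thesis .
qed

section \<open>Connection and curvature forms on the slit bundle\<close>

definition slit :: "'n slit set" where
  "slit = U \<times> (UNIV - {0})"

lemma open_slit_bundle: "open slit"
  unfolding slit_def by (intro open_Times open_U open_slit)

lemma has_derivative_Ph_fst:
  assumes "x \<in> slit"
  shows "((\<lambda>y. Ph (fst y) h) has_derivative (\<lambda>X. frechet_derivative (\<lambda>z. Ph z h) (at (fst x)) (fst X))) (at x)"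
  by (rule has_derivative_compose[OF has_derivative_fst[OF has_derivative_ident]
        frechet_derivative_has_derivative[OF differentiable_Ph]])
    (use assms in \<open>auto simp: slit_def\<close>)

definition cform :: "'n \<Rightarrow> 'n \<Rightarrow> 'n slit \<Rightarrow> 'n slit \<Rightarrow> complex" where
  "cform i l y X = om (conn (snd y)) i l (Ph (fst y) (fst X))"

definition curv :: "'n \<Rightarrow> 'n \<Rightarrow> 'n slit \<Rightarrow> 'n slit \<Rightarrow> 'n slit \<Rightarrow> complex" where
  "curv i l x X Y = ext_d (cform i l) x X Y
     - (\<Sum>k\<in>UNIV. wedge (cform k l x) (cform i k x) X Y)"

lemma linear_cform: "y \<in> slit \<Longrightarrow> linear (cform i l y)"
  unfolding cform_def
  by (rule linear_compose[OF linear_compose[OF linear_fst linear_Ph] linear_om, unfolded o_def])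
    (auto simp: slit_def)

lemma differentiable_cform:
  assumes x: "x \<in> slit" shows "(\<lambda>y. cform i l y X) differentiable (at x)"
proof -
  have 1: "(\<lambda>y::'n slit. Gam (snd y) i l k) differentiable (at x)" for k
    by (rule differentiable_compose[OF differentiable_Gam])
      (use x in \<open>auto simp: slit_def intro: bounded_linear_imp_differentiable bounded_linear_snd\<close>)
  have 2: "(\<lambda>y. Ph (fst y) (fst X) $ k) differentiable (at x)" for k
    by (rule differentiable_compose[of "\<lambda>v. v $ k" "\<lambda>y. Ph (fst y) (fst X)"])
      (use has_derivative_Ph_fst[OF x] in \<open>auto simp: differentiable_def intro: bounded_linear_imp_has_derivative bounded_linear_vec_nth\<close>)
  show ?thesis unfolding cform_def om_def conn_def
    using 1 2 by (auto intro!: differentiable_sum differentiable_diff differentiable_mult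
        iffD2[OF differentiable_cnj_iff])
qed

lemma has_derivative_cform:
  "x \<in> slit \<Longrightarrow> ((\<lambda>y. cform i l y X) has_derivative frechet_derivative (\<lambda>y. cform i l y X) (at x)) (at x)"
  by (rule frechet_derivative_has_derivative[OF differentiable_cform])

lemma curv_alt: "curv i l x X Y = - curv i l x Y X"
  by (simp add: curv_def ext_d_def wedge_def sum_subtractf)

lemma linear_curv: assumes x: "x \<in> slit" shows "linear (\<lambda>X. curv i l x X Y)"
proof -
  have 1: "linear (\<lambda>X. ext_d (cform i l) x X Y)"
    by (rule linear_ext_d[OF open_slit_bundle x linear_cform differentiable_cform[OF x]])
  have 2: "linear (\<lambda>X. wedge (cform k l x) (cform i k x) X Y)" for k
    by (rule linearI)
      (simp_all add: wedge_def linear_add[OF linear_cform[OF x]] linear_cmul[OF linear_cform[OF x]] algebra_simps)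
  show ?thesis unfolding curv_def
    by (rule linear_compose_sub[OF 1 linear_compose_sum]) (use 2 in auto)
qed

text \<open>The contraction of the connection forms with \<open>v\<close>, by
  \<open>om_contract\<close>. It is only real linear in \<open>y\<close>, since \<open>N v\<close>
  is complex linear but \<open>mixed_br v\<close> conjugate linear.\<close>

definition Th :: "complex^'n \<Rightarrow> complex^'n \<Rightarrow> complex^'n" where
  "Th v y = N v y - mixed_br v y"

lemma linear_Th: assumes "v \<noteq> 0" shows "linear (Th v)"
proof (rule linearI)
  show "Th v (a + b) = Th v a + Th v b" for a b
    using assms by (simp add: Th_def N_add mixed_br_add)
  have sc: "r *\<^sub>R a = complex_of_real r *s a" for r and a :: "complex^'n"
    by (simp add: vec_eq_iff scaleR_conv_of_real[where 'a=complex])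
  then show "Th v (r *\<^sub>R a) = r *\<^sub>R Th v a" for r a
    unfolding sc Th_def by (simp add: N_scale[OF assms] mixed_br_scale vector_ssub_ldistrib)
qed

lemma om_contract:
  assumes v: "v \<noteq> 0"
  shows "(\<Sum>l\<in>UNIV. v $ l * om (conn v) i l y) = Th v y $ i"
proof -
  have "(\<Sum>l\<in>UNIV. v $ l * om (conn v) i l y)
    = (\<Sum>k\<in>UNIV. \<Sum>l\<in>UNIV. v $ l * (Gam v i l k * y $ k - mixed_br (axis l 1) (axis k 1) $ i * cnj (y $ k)))"
    unfolding om_def conn_def sum_distrib_left by (subst sum.swap) simp
  also have "\<dots> = (\<Sum>k\<in>UNIV. y $ k * (\<Sum>l\<in>UNIV. v $ l * Gam v i l k)
       - cnj (y $ k) * (\<Sum>l\<in>UNIV. v $ l * mixed_br (axis l 1) (axis k 1) $ i))"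
    by (simp add: sum_distrib_left right_diff_distrib sum_subtractf mult_ac)
  also have "\<dots> = Th v y $ i"
    by (simp add: Gam_contract[OF v] mixed_br_expand(1)[symmetric] sum_subtractf N_expand[OF v, symmetric]
        mixed_br_expand(2)[symmetric] Th_def)
  finally show ?thesis .
qed

text \<open>The hypotheses say that the vertical coframe vanishes on \<open>X\<close> and
  \<open>Y\<close>. Under them the terms in which the product rule differentiates \<open>v\<close>
  are exactly the contracted wedge terms of the curvature.\<close>

lemma curv_contract:
  assumes x: "x \<in> slit" and X: "snd X = - Th (snd x) (Ph (fst x) (fst X))" "snd Y = - Th (snd x) (Ph (fst x) (fst Y))"
  shows "(\<Sum>l\<in>UNIV. snd x $ l * curv i l x X Y) = ext_d (\<lambda>y X. Th (snd y) (Ph (fst y) (fst X)) $ i) x X Y"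
proof -
  let ?th = "\<lambda>i y X. Th (snd y) (Ph (fst y) (fst X)) $ i"
  let ?D = "\<lambda>i l X. frechet_derivative (\<lambda>y. cform i l y X) (at x)"
  have v: "snd x \<noteq> 0" using x by (auto simp: slit_def)
  have th: "?th i y X = (\<Sum>l\<in>UNIV. snd y $ l * cform i l y X)" if "y \<in> slit" for i y X
    unfolding cform_def by (rule om_contract[symmetric]) (use that in \<open>auto simp: slit_def\<close>)
  have Dth: "frechet_derivative (\<lambda>y. ?th i y Y) (at x) X
     = (\<Sum>l\<in>UNIV. snd x $ l * ?D i l Y X + snd X $ l * cform i l x Y)" for X Y
  proof -
    have "((\<lambda>y. \<Sum>l\<in>UNIV. snd y $ l * cform i l y Y) has_derivative
      (\<lambda>X. \<Sum>l\<in>UNIV. snd x $ l * ?D i l Y X + snd X $ l * cform i l x Y)) (at x)"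
      by (intro has_derivative_sum has_derivative_mult has_derivative_cform[OF x]
          bounded_linear.has_derivative[OF bounded_linear_vec_nth] has_derivative_snd has_derivative_ident)
    then have "((\<lambda>y. ?th i y Y) has_derivative
      (\<lambda>X. \<Sum>l\<in>UNIV. snd x $ l * ?D i l Y X + snd X $ l * cform i l x Y)) (at x)"
      by (rule has_derivative_transform_within_open[OF _ open_slit_bundle x]) (simp add: th)
    then show ?thesis by (simp add: frechet_derivative_eqI)
  qed
  have w: "(\<Sum>l\<in>UNIV. snd x $ l * (\<Sum>k\<in>UNIV. wedge (cform k l x) (cform i k x) X Y))
    = (\<Sum>k\<in>UNIV. ?th k x X * cform i k x Y - ?th k x Y * cform i k x X)"
    unfolding th[OF x] sum_distrib_left wedge_def sum_distrib_right sum_subtractf[symmetric]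
    by (subst sum.swap) (simp add: algebra_simps)
  have s: "snd X $ k = - ?th k x X" "snd Y $ k = - ?th k x Y" for k
    unfolding X by simp_all
  have "(\<Sum>l\<in>UNIV. snd x $ l * curv i l x X Y)
    = (\<Sum>l\<in>UNIV. snd x $ l * (?D i l Y X - ?D i l X Y))
     - (\<Sum>l\<in>UNIV. snd x $ l * (\<Sum>k\<in>UNIV. wedge (cform k l x) (cform i k x) X Y))"
    by (simp only: curv_def ext_d_def right_diff_distrib sum_subtractf)
  also have "\<dots> = ext_d (?th i) x X Y"
    unfolding w ext_d_def Dth sum_subtractf[symmetric]
    by (rule sum.cong) (simp_all only: s, simp_all add: algebra_simps)
  finally show ?thesis .
qed

text \<open>The form depends on \<open>v\<close> through \<open>Th\<close> and on \<open>z\<close>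
  through \<open>Ph\<close>. Differentiation in \<open>v\<close> gives the first four terms;
  differentiation in \<open>z\<close> gives the last one by the Maurer--Cartan equation.\<close>

lemma ext_d_Th:
  assumes x: "x \<in> slit"
  shows "ext_d (\<lambda>y X. Th (snd y) (Ph (fst y) (fst X)) $ i) x X Y
    = frechet_derivative (\<lambda>v. N v (Ph (fst x) (fst Y)) $ i) (at (snd x)) (snd X)
      - mixed_br (snd X) (Ph (fst x) (fst Y)) $ i
      - frechet_derivative (\<lambda>v. N v (Ph (fst x) (fst X)) $ i) (at (snd x)) (snd Y)
      + mixed_br (snd Y) (Ph (fst x) (fst X)) $ i
      - Th (snd x) (br (Ph (fst x) (fst X)) (Ph (fst x) (fst Y))) $ i"
proof -
  let ?z = "fst x" and ?v = "snd x"
  have v: "?v \<noteq> 0" and z: "?z \<in> U" using x by (auto simp: slit_def)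
  let ?DN = "\<lambda>a. frechet_derivative (\<lambda>v. N v a $ i) (at ?v)"
  let ?DP = "\<lambda>Y. frechet_derivative (\<lambda>z. Ph z Y) (at ?z)"
  have Aml: "linear (\<lambda>u. mixed_br u a $ i)" for a
  proof (rule linearI)
    show "mixed_br (u + u') a $ i = mixed_br u a $ i + mixed_br u' a $ i" for u u' by (simp add: mixed_br_add)
    have "r *\<^sub>R u = complex_of_real r *s u" for r and u :: "complex^'n"
      by (simp add: vec_eq_iff scaleR_conv_of_real[where 'a=complex])
    then show "mixed_br (r *\<^sub>R u) a $ i = r *\<^sub>R mixed_br u a $ i" for r u
      by (simp add: mixed_br_scale scaleR_conv_of_real[where 'a=complex])
  qed
  have L': "((\<lambda>y. Th (snd y) a $ i) has_derivative (\<lambda>X. ?DN a (snd X) - mixed_br (snd X) a $ i)) (at x)" for a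
  proof -
    have "((\<lambda>v. Th v a $ i) has_derivative (\<lambda>h. ?DN a h - mixed_br h a $ i)) (at ?v)"
      unfolding Th_def vector_minus_component
      by (intro has_derivative_diff frechet_derivative_has_derivative differentiable_N[OF v]
          linear_imp_has_derivative Aml)
    then show ?thesis
      by (rule has_derivative_compose[OF has_derivative_snd[OF has_derivative_ident]])
  qed
  have lin: "linear (\<lambda>a. Th (snd y) a $ i)" if "y \<in> slit" for y
    by (rule linear_compose[OF linear_Th, of _ "\<lambda>v. v $ i", unfolded o_def])
      (use that in \<open>auto simp: slit_def bounded_linear_vec_nth bounded_linear.linear\<close>)
  have D: "frechet_derivative (\<lambda>y. Th (snd y) (Ph (fst y) (fst Y)) $ i) (at x) X
    = ?DN (Ph ?z (fst Y)) (snd X) - mixed_br (snd X) (Ph ?z (fst Y)) $ i + Th ?v (?DP (fst Y) (fst X)) $ i" for X Y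
    using has_derivative_linear_apply[OF open_slit_bundle x lin L' has_derivative_Ph_fst[OF x], of "fst Y"]
    by (simp add: frechet_derivative_eqI)
  have "Th ?v (?DP (fst Y) (fst X)) - Th ?v (?DP (fst X) (fst Y)) = - Th ?v (br (Ph ?z (fst X)) (Ph ?z (fst Y)))"
    by (simp add: linear_diff[OF linear_Th[OF v], symmetric] maurer_cartan[OF z] linear_neg[OF linear_Th[OF v]])
  then have "Th ?v (?DP (fst Y) (fst X)) $ i - Th ?v (?DP (fst X) (fst Y)) $ i
     = - Th ?v (br (Ph ?z (fst X)) (Ph ?z (fst Y))) $ i"
    by (simp add: vec_eq_iff)
  then show ?thesis unfolding ext_d_def D by (simp add: algebra_simps)
qed

text \<open>Passing from \<open>w\<close> to \<open>\<i> *s w\<close> multiplies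
  \<open>N v w\<close> by \<open>\<i>\<close> but \<open>mixed_br v w\<close> by
  \<open>-\<i>\<close>. When the two lifts are combined, the (1,0)-derivatives therefore keep only
  the bracket, the (0,1)-derivatives keep only \<open>N v w\<close>, and the iterated bracket
  \<open>mixed_br (mixed_br v w) w\<close> cancels.\<close>

lemma curv_hor_lift:
  assumes x: "x \<in> slit"
  defines "H \<equiv> hor_lift (T (fst x)) (Th (snd x))"
  shows "(\<Sum>l\<in>UNIV. snd x $ l * curv i l x (H w) (H (\<i> *s w))) = 2 * \<i> * curv_vec (snd x) w i"
proof -
  let ?z = "fst x" and ?v = "snd x"
  have v: "?v \<noteq> 0" and z: "?z \<in> U" using x by (auto simp: slit_def)
  define n a where "n = N ?v w" and "a = mixed_br ?v w"
  define W Wb where "W l = wd l (\<lambda>u. N u w $ i) ?v" and "Wb l = wdbar l (\<lambda>u. N u w $ i) ?v" for l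
  have PH: "Ph ?z (fst (H y)) = y" "snd (H y) = - Th ?v y" for y
    by (simp_all add: H_def hor_lift_def Ph_T[OF z])
  have T1: "Th ?v w = n - a" and T2: "Th ?v (\<i> *s w) = \<i> *s (n + a)"
    by (simp_all add: Th_def n_def a_def N_scale[OF v] mixed_br_scale vec_eq_iff algebra_simps)
  have DN: "frechet_derivative (\<lambda>u. N u w $ i) (at ?v) h = (\<Sum>l\<in>UNIV. h $ l * W l + cnj (h $ l) * Wb l)" for h
    unfolding W_def Wb_def by (rule frechet_derivative_wirtinger[OF differentiable_N[OF v]])
  have DiN: "frechet_derivative (\<lambda>u. N u (\<i> *s w) $ i) (at ?v) h
    = \<i> * frechet_derivative (\<lambda>u. N u w $ i) (at ?v) h" for h
  proof -
    have "frechet_derivative (\<lambda>u. N u (\<i> *s w) $ i) (at ?v) = frechet_derivative (\<lambda>u. \<i> * N u w $ i) (at ?v)"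
      by (rule frechet_derivative_cong_open[OF open_slit]) (use v in \<open>auto simp: N_scale\<close>)
    also have "\<dots> = (\<lambda>h. \<i> * frechet_derivative (\<lambda>u. N u w $ i) (at ?v) h)"
      by (intro frechet_derivative_eqI has_derivative_mult_right frechet_derivative_has_derivative differentiable_N[OF v])
    finally show ?thesis by simp
  qed
  have br: "br w (\<i> *s w) = (- 2 * \<i>) *s mixed_br w w"
    unfolding mixed_br_alt by (simp add: vec_eq_iff)
  \<comment> \<open>The scalar leaves \<open>mixed_br v\<close> conjugated, which compensates the
    minus sign in \<open>Th\<close>; both terms end up with the same sign.\<close>
  have Tb: "Th ?v (br w (\<i> *s w)) $ i = - 2 * \<i> * (N ?v (mixed_br w w) $ i + mixed_br ?v (mixed_br w w) $ i)"
    unfolding br Th_def N_scale[OF v] mixed_br_scale by (simp add: algebra_simps)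
  have neg: "mixed_br (- u) y = - mixed_br u y" for u y
    using mixed_br_scale(1)[of "-1" u y] by (simp add: vec_eq_iff)
  have sub: "mixed_br (u - u') y = mixed_br u y - mixed_br u' y" for u u' y
    using mixed_br_add(1)[of u "- u'" y] neg by simp
  have "(\<Sum>l\<in>UNIV. ?v $ l * curv i l x (H w) (H (\<i> *s w)))
    = ext_d (\<lambda>y X. Th (snd y) (Ph (fst y) (fst X)) $ i) x (H w) (H (\<i> *s w))"
    by (rule curv_contract[OF x]) (simp_all add: PH)
  also have "\<dots> = \<i> * (\<Sum>l\<in>UNIV. (- (n - a)) $ l * W l + cnj ((- (n - a)) $ l) * Wb l)
      - mixed_br (- (n - a)) (\<i> *s w) $ i
      - (\<Sum>l\<in>UNIV. (- (\<i> *s (n + a))) $ l * W l + cnj ((- (\<i> *s (n + a))) $ l) * Wb l)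
      + mixed_br (- (\<i> *s (n + a))) w $ i
      + 2 * \<i> * (N ?v (mixed_br w w) $ i + mixed_br ?v (mixed_br w w) $ i)"
    unfolding ext_d_Th[OF x] PH T1 T2 DiN DN Tb by simp
  also have "\<dots> = (\<i> * (\<Sum>l\<in>UNIV. (- (n - a)) $ l * W l + cnj ((- (n - a)) $ l) * Wb l)
      - (\<Sum>l\<in>UNIV. (- (\<i> *s (n + a))) $ l * W l + cnj ((- (\<i> *s (n + a))) $ l) * Wb l))
      + 2 * \<i> * (N ?v (mixed_br w w) $ i + mixed_br ?v (mixed_br w w) $ i - mixed_br n w $ i)"
    unfolding neg sub mixed_br_scale mixed_br_add by (simp add: algebra_simps)
  also have "\<i> * (\<Sum>l\<in>UNIV. (- (n - a)) $ l * W l + cnj ((- (n - a)) $ l) * Wb l)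
      - (\<Sum>l\<in>UNIV. (- (\<i> *s (n + a))) $ l * W l + cnj ((- (\<i> *s (n + a))) $ l) * Wb l)
      = 2 * \<i> * ((\<Sum>l\<in>UNIV. a $ l * W l) - (\<Sum>l\<in>UNIV. cnj (n $ l) * Wb l))"
    unfolding sum_distrib_left sum_subtractf[symmetric]
    by (rule sum.cong) (simp_all add: algebra_simps)
  finally show ?thesis
    unfolding curv_vec_def n_def a_def W_def Wb_def by (simp add: algebra_simps)
qed

text \<open>By sesquilinearity of \<open>p11\<close> the sum over \<open>k\<close> and
  \<open>j\<close> collapses to one value at \<open>w\<close>, which is the curvature on the lifts
  of \<open>w\<close> and \<open>\<i> *s w\<close>.\<close>

lemma curvature_sum:
  assumes x: "x \<in> slit"
    and \<phi>: "\<And>i X. \<phi> i X = Ph (fst x) (fst X) $ i"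
    and \<psi>: "\<And>i X. \<psi> i X = snd X $ i + Th (snd x) (Ph (fst x) (fst X)) $ i"
  shows "(\<Sum>l\<in>UNIV. \<Sum>k\<in>UNIV. \<Sum>j\<in>UNIV. snd x $ l * w $ k * cnj (w $ j)
      * - coeff2 (full_coframe \<phi> \<psi>) (curv i l x) (Hor k) (HorBar j)) = curv_vec (snd x) w i"
proof -
  let ?H = "hor_lift (T (fst x)) (Th (snd x))"
  have v: "snd x \<noteq> 0" and z: "fst x \<in> U" using x by (auto simp: slit_def)
  let ?B = "\<lambda>l a b. curv i l x (?H a) (?H b)"
  have c: "coeff2 (full_coframe \<phi> \<psi>) (curv i l x) (Hor k) (HorBar j) = p11 (?B l) (axis k 1) (axis j 1)" for l k j
    by (rule coeff2_full_coframe[OF linear_T[OF z] Ph_T[OF z] T_Ph[OF z] linear_Th[OF v] \<phi> \<psi> linear_curv[OF x] curv_alt])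
  have Hl: "linear ?H" unfolding hor_lift_def
    by (intro linearI) (simp_all add: linear_add[OF linear_T[OF z]] linear_add[OF linear_Th[OF v]]
        linear_cmul[OF linear_T[OF z]] linear_cmul[OF linear_Th[OF v]])
  have lin2: "linear (\<lambda>Y. curv i l x X Y)" for l X
    using linear_compose_neg[OF linear_curv[OF x, of i l X]] by (subst curv_alt) simp
  have B: "bilinear (?B l)" for l
    unfolding bilinear_def
    using linear_compose[OF Hl linear_curv[OF x]] linear_compose[OF Hl lin2] by (simp add: o_def)
  have "(\<Sum>k\<in>UNIV. \<Sum>j\<in>UNIV. snd x $ l * w $ k * cnj (w $ j) * - p11 (?B l) (axis k 1) (axis j 1))
    = - (snd x $ l * p11 (?B l) w w)" for l
  proof -
    have e: "p11 (?B l) (axis k 1) w = (\<Sum>j\<in>UNIV. cnj (w $ j) * p11 (?B l) (axis k 1) (axis j 1))" for k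
      by (rule p11_expand(2)[OF B])
    show ?thesis
      by (simp add: p11_expand(1)[OF B, of l w w] e sum_distrib_left sum_negf mult_ac)
  qed
  then have "(\<Sum>l\<in>UNIV. \<Sum>k\<in>UNIV. \<Sum>j\<in>UNIV. snd x $ l * w $ k * cnj (w $ j)
      * - coeff2 (full_coframe \<phi> \<psi>) (curv i l x) (Hor k) (HorBar j))
    = - (\<Sum>l\<in>UNIV. snd x $ l * p11 (?B l) w w)"
    unfolding c by (simp only: sum_negf)
  \<comment> \<open>The minus sign, inherited from \<open>curv_coeff\<close>, the factor
    \<open>\<i>/2\<close> and the factor \<open>2 * \<i>\<close> of \<open>curv_hor_lift\<close>
    multiply to 1.\<close>
  also have "\<dots> = - ((\<i> / 2) * (\<Sum>l\<in>UNIV. snd x $ l * curv i l x (?H w) (?H (\<i> *s w))))"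
    by (simp add: p11_alternating[OF B curv_alt] sum_distrib_left mult_ac)
  also have "\<dots> = curv_vec (snd x) w i"
    unfolding curv_hor_lift[OF x] by simp
  finally show ?thesis .
qed

section \<open>Identification of the Chern-Rund connection in the model\<close>

lemma om_conn_form:
  assumes "\<And>i. \<phi> i X = y $ i"
  shows "conn_form \<phi> \<Gamma> i l X = om \<Gamma> i l y"
  by (simp add: conn_form_def om_def assms)

lemma ext_d_cong_open:
  fixes \<alpha> \<beta> :: "'v::real_normed_vector \<Rightarrow> 'v \<Rightarrow> complex"
  assumes "open S" "x \<in> S" "\<And>y X. y \<in> S \<Longrightarrow> \<alpha> y X = \<beta> y X"
  shows "ext_d \<alpha> x X Y = ext_d \<beta> x X Y"
proof -
  have "frechet_derivative (\<lambda>y. \<alpha> y X) (at x) = frechet_derivative (\<lambda>y. \<beta> y X) (at x)" for X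
    by (rule frechet_derivative_cong_open[OF assms(1,2)]) (simp add: assms(3))
  then show ?thesis by (simp add: ext_d_def)
qed

lemma has_derivative_Ph_comp:
  assumes "x \<in> slit"
  shows "((\<lambda>y. Ph (fst y) h $ i) has_derivative
    (\<lambda>X. frechet_derivative (\<lambda>z. Ph z h) (at (fst x)) (fst X) $ i)) (at x)"
  by (rule bounded_linear.has_derivative[OF bounded_linear_vec_nth has_derivative_Ph_fst[OF assms]])

lemma ext_d_Ph:
  assumes x: "x \<in> slit"
  shows "ext_d (\<lambda>y X. Ph (fst y) (fst X) $ i) x X Y = - br (Ph (fst x) (fst X)) (Ph (fst x) (fst Y)) $ i"
proof -
  have z: "fst x \<in> U" using x by (auto simp: slit_def)
  show ?thesis
    unfolding ext_d_def frechet_derivative_eqI[OF has_derivative_Ph_comp[OF x]]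
    using arg_cong[OF maurer_cartan[OF z, of "fst Y" "fst X"], of "\<lambda>u. u $ i"] by simp
qed

text \<open>By the Maurer--Cartan equation the exterior derivative of the coframe contributes minus
  the bracket. In the wedge terms a (1,0)-form meets a conjugate one only through the second family
  of coefficients.\<close>

lemma torsion_coeff:
  assumes x: "x \<in> slit" and \<phi>: "\<And>i X. \<phi> i X = Ph (fst x) (fst X) $ i"
    and cof: "\<And>i y X. y \<in> slit \<Longrightarrow> cof i y X = Ph (fst y) (fst X) $ i"
  shows "coeff2 (full_coframe \<phi> (vert_form \<phi> \<Gamma> (snd x)))
      (\<lambda>X Y. ext_d (cof i) x X Y - (\<Sum>j\<in>UNIV. wedge (\<phi> j) (conn_form \<phi> \<Gamma> i j) X Y)) (Hor k) (HorBar j)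
    = - mixed_br (axis k 1) (axis j 1) $ i - snd \<Gamma> i k j"
proof -
  let ?z = "fst x" and ?v = "snd x"
  have z: "?z \<in> U" using x by (auto simp: slit_def)
  define th where "th y = (\<chi> i. \<Sum>j\<in>UNIV. ?v $ j * om \<Gamma> i j y)" for y
  let ?\<tau> = "\<lambda>X Y. - br (Ph ?z (fst X)) (Ph ?z (fst Y)) $ i
     - (\<Sum>m\<in>UNIV. Ph ?z (fst X) $ m * om \<Gamma> i m (Ph ?z (fst Y)) - Ph ?z (fst Y) $ m * om \<Gamma> i m (Ph ?z (fst X)))"
  have \<tau>: "(\<lambda>X Y. ext_d (cof i) x X Y - (\<Sum>j\<in>UNIV. wedge (\<phi> j) (conn_form \<phi> \<Gamma> i j) X Y)) = ?\<tau>"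
  proof (intro ext)
    fix X Y
    have "ext_d (cof i) x X Y = ext_d (\<lambda>y X. Ph (fst y) (fst X) $ i) x X Y"
      by (rule ext_d_cong_open[OF open_slit_bundle x cof])
    then show "ext_d (cof i) x X Y - (\<Sum>j\<in>UNIV. wedge (\<phi> j) (conn_form \<phi> \<Gamma> i j) X Y) = ?\<tau> X Y"
      by (simp add: ext_d_Ph[OF x] wedge_def \<phi> om_conn_form[OF \<phi>])
  qed
  have lth: "linear th"
    by (rule linearI) (simp_all add: th_def vec_eq_iff linear_add[OF linear_om] linear_cmul[OF linear_om]
        sum.distrib sum_distrib_left scaleR_conv_of_real[where 'a=complex] algebra_simps)
  have alt: "?\<tau> X Y = - ?\<tau> Y X" for X Y
    using arg_cong[OF br_alt[of "Ph ?z (fst X)" "Ph ?z (fst Y)"], of "\<lambda>u. u $ i"] by (simp add: sum_subtractf)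
  have lin: "linear (\<lambda>X. ?\<tau> X Y)" for Y
    by (rule linearI) (simp_all add: linear_add[OF linear_Ph[OF z]] linear_cmul[OF linear_Ph[OF z]]
        linear_add[OF linear_om] linear_cmul[OF linear_om] bilinear_ladd[OF bilinear_br] bilinear_lmul[OF bilinear_br]
        sum.distrib sum_distrib_left sum_subtractf scaleR_conv_of_real[where 'a=complex] algebra_simps)
  have \<psi>: "vert_form \<phi> \<Gamma> ?v i X = snd X $ i + th (Ph ?z (fst X)) $ i" for i X
    by (simp add: vert_form_def om_conn_form[OF \<phi>] th_def)
  have "coeff2 (full_coframe \<phi> (vert_form \<phi> \<Gamma> ?v)) ?\<tau> (Hor k) (HorBar j)
    = p11 (\<lambda>a b. ?\<tau> (hor_lift (T ?z) th a) (hor_lift (T ?z) th b)) (axis k 1) (axis j 1)"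
    by (rule coeff2_full_coframe[OF linear_T[OF z] Ph_T[OF z] T_Ph[OF z] lth \<phi> \<psi> lin alt])
  also have "\<dots> = p11 (\<lambda>a b. - br a b $ i - (\<Sum>m\<in>UNIV. a $ m * om \<Gamma> i m b - b $ m * om \<Gamma> i m a)) (axis k 1) (axis j 1)"
    by (simp add: hor_lift_def Ph_T[OF z])
  also have "\<dots> = - mixed_br (axis k 1) (axis j 1) $ i
     - p11 (\<lambda>a b. (\<Sum>m\<in>UNIV. a $ m * om \<Gamma> i m b - b $ m * om \<Gamma> i m a)) (axis k 1) (axis j 1)"
    by (simp add: mixed_br_def p11_def field_simps)
  also have "p11 (\<lambda>a b. (\<Sum>m\<in>UNIV. a $ m * om \<Gamma> i m b - b $ m * om \<Gamma> i m a)) (axis k 1) (axis j 1) = snd \<Gamma> i k j"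
  proof -
    have ax: "(\<Sum>m\<in>UNIV. axis k c $ m * om \<Gamma> i m b) = c * om \<Gamma> i k b" for k c b
    proof -
      have "(\<Sum>m\<in>UNIV. axis k c $ m * om \<Gamma> i m b) = (\<Sum>m\<in>UNIV. if m = k then c * om \<Gamma> i m b else 0)"
        by (rule sum.cong) (auto simp: axis_def)
      then show ?thesis by simp
    qed
    have i1: "\<i> *s axis i 1 = axis i \<i>" for i :: 'n
      by (simp add: vec_eq_iff axis_def)
    show ?thesis unfolding p11_def sum_subtractf i1 ax unfolding om_axis by (simp add: field_simps)
  qed
  finally show ?thesis unfolding \<tau> .
qed

text \<open>Here \<open>g\<close> is a function of \<open>v\<close> alone, so the terms of its
  differential cancel the \<open>dv\<close> terms of the vertical forms. What is left depends on
  \<open>X\<close> only through \<open>Ph\<close> of its base component, which takes every value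
  \<open>y\<close>.\<close>

lemma chern_rund_iff:
  assumes x: "x \<in> slit" and \<phi>: "\<And>i X. \<phi> i X = Ph (fst x) (fst X) $ i"
    and cof: "\<And>i y X. y \<in> slit \<Longrightarrow> cof i y X = Ph (fst y) (fst X) $ i"
  shows "(\<forall>i k j. coeff2 (full_coframe \<phi> (vert_form \<phi> \<Gamma> (snd x)))
        (\<lambda>X Y. ext_d (cof i) x X Y - (\<Sum>j\<in>UNIV. wedge (\<phi> j) (conn_form \<phi> \<Gamma> i j) X Y)) (Hor k) (HorBar j) = 0)
     \<and> (\<forall>i j X. frechet_derivative (\<lambda>y. gb i j (snd y)) (at x) X
          = (\<Sum>l\<in>UNIV. gb l j (snd x) * conn_form \<phi> \<Gamma> l i X + gb i l (snd x) * cnj (conn_form \<phi> \<Gamma> l j X)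
               + Ch i j l (snd x) * vert_form \<phi> \<Gamma> (snd x) l X
               + Cb i j l (snd x) * cnj (vert_form \<phi> \<Gamma> (snd x) l X)))
    \<longleftrightarrow> \<Gamma> = conn (snd x)"
    (is "?A \<and> ?B \<longleftrightarrow> _")
proof -
  let ?z = "fst x" and ?v = "snd x"
  have v: "?v \<noteq> 0" and z: "?z \<in> U" using x by (auto simp: slit_def)
  let ?L = "\<lambda>i j y. \<Sum>l\<in>UNIV. gb l j ?v * om \<Gamma> l i y + gb i l ?v * cnj (om \<Gamma> l j y)
          + Ch i j l ?v * (\<Sum>m\<in>UNIV. ?v $ m * om \<Gamma> l m y)
          + Cb i j l ?v * cnj (\<Sum>m\<in>UNIV. ?v $ m * om \<Gamma> l m y)"
  have A: "?A \<longleftrightarrow> (\<forall>l i k. snd \<Gamma> l i k = - mixed_br (axis i 1) (axis k 1) $ l)"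
  proof -
    have "- a - b = 0 \<longleftrightarrow> b = - a" for a b :: complex
      by (metis add_diff_cancel_left' diff_0_right diff_eq_diff_eq eq_iff_diff_eq_0 minus_diff_eq)
    then show ?thesis
      by (simp only: torsion_coeff[where \<phi> = \<phi> and cof = cof and \<Gamma> = \<Gamma>, OF x \<phi> cof])
  qed
  have D: "frechet_derivative (\<lambda>y. gb i j (snd y)) (at x) X
      = (\<Sum>l\<in>UNIV. Ch i j l ?v * snd X $ l + Cb i j l ?v * cnj (snd X $ l))" for i j X
  proof -
    have "((\<lambda>y. gb i j (snd y)) has_derivative (\<lambda>X. frechet_derivative (gb i j) (at ?v) (snd X))) (at x)"
      by (rule has_derivative_compose[OF has_derivative_snd[OF has_derivative_ident]
          frechet_derivative_has_derivative[OF diff_slit[OF smooth_second(1) v]]])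
    then show ?thesis by (simp add: frechet_derivative_eqI gb_deriv[OF v])
  qed
  have R: "(\<Sum>l\<in>UNIV. gb l j ?v * conn_form \<phi> \<Gamma> l i X + gb i l ?v * cnj (conn_form \<phi> \<Gamma> l j X)
               + Ch i j l ?v * vert_form \<phi> \<Gamma> ?v l X + Cb i j l ?v * cnj (vert_form \<phi> \<Gamma> ?v l X))
    = ?L i j (Ph ?z (fst X)) + (\<Sum>l\<in>UNIV. Ch i j l ?v * snd X $ l + Cb i j l ?v * cnj (snd X $ l))" for i j X
    unfolding vert_form_def om_conn_form[OF \<phi>] sum.distrib[symmetric]
    by (rule sum.cong) (simp_all only: distrib_left complex_cnj_add add_ac)
  have B: "?B \<longleftrightarrow> (\<forall>i j y. ?L i j y = 0)"
  proof
    assume B: ?B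
    show "\<forall>i j y. ?L i j y = 0"
    proof (intro allI)
      fix i j y
      show "?L i j y = 0"
        using B[rule_format, of i j "(T ?z y, 0)"] unfolding D R by (simp add: Ph_T[OF z])
    qed
  next
    assume "\<forall>i j y. ?L i j y = 0"
    then show ?B unfolding D R by (simp only: add_0 simp_thms)
  qed
  show ?thesis unfolding A B by (rule connection_equation_iff[OF v])
qed

end

section \<open>Left translations in charts\<close>

lemma is_chartD:
  assumes "is_chart c"
  shows "open (fst c)" "open (snd c ` fst c)" "continuous_on (fst c) (snd c)"
    "continuous_on (snd c ` fst c) (chart_inv c)"
    "p \<in> fst c \<Longrightarrow> chart_inv c (snd c p) = p"
    "z \<in> snd c ` fst c \<Longrightarrow> snd c (chart_inv c z) = z"
    "z \<in> snd c ` fst c \<Longrightarrow> chart_inv c z \<in> fst c"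
  using assms unfolding is_chart_def homeomorphism_def by auto

definition chart_rep :: "('m, 'e) chart \<Rightarrow> ('m, 'f) chart \<Rightarrow> ('m \<Rightarrow> 'm) \<Rightarrow> 'e \<Rightarrow> 'f" where
  "chart_rep c d h = snd d \<circ> h \<circ> chart_inv c"

text \<open>The maps \<open>from_chart\<close>, \<open>to_chart\<close> and
  \<open>tangent_map\<close> are all of this form, so the single chain rule
  \<open>chart_deriv_comp\<close> covers them.\<close>

definition chart_deriv ::
  "('m, 'e::real_normed_vector) chart \<Rightarrow> ('m, 'f::real_normed_vector) chart \<Rightarrow> ('m \<Rightarrow> 'm) \<Rightarrow> 'e \<Rightarrow> 'e \<Rightarrow> 'f" where
  "chart_deriv c d h z = frechet_derivative (chart_rep c d h) (at z)"

locale complex_manifold =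
  fixes A :: "('g::topological_space, complex^'n) chart set"
  assumes atlas: "complex_atlas A"
begin

lemma chart: "c \<in> A \<Longrightarrow> is_chart c"
  using atlas by (simp add: complex_atlas_def)

lemmas chartD = is_chartD[OF chart]

lemma chart_at: "chart_at A p \<in> A" "p \<in> fst (chart_at A p)"
proof -
  have "\<exists>c. c \<in> A \<and> p \<in> fst c" using atlas unfolding complex_atlas_def by blast
  from someI_ex[OF this] show "chart_at A p \<in> A" "p \<in> fst (chart_at A p)"
    by (auto simp: chart_at_def)
qed

lemma open_chart_dom:
  assumes c: "c \<in> A" and d: "d \<in> A" and h: "continuous_on UNIV h"
  shows "open (snd c ` (fst c \<inter> h -` fst d))"
proof -
  have o: "open (h -` fst d)" using h chartD(1)[OF d] by (simp add: continuous_on_open_vimage)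
  have "snd c ` (fst c \<inter> h -` fst d) = snd c ` fst c \<inter> chart_inv c -` (h -` fst d)"
    using chartD(5-7)[OF c] by force
  also have "open \<dots>"
    by (rule continuous_open_preimage[OF chartD(4)[OF c] chartD(2)[OF c] o])
  finally show ?thesis .
qed

lemma chart_rep_smooth:
  assumes h: "holo_map A A h" and c: "c \<in> A" and d: "d \<in> A"
  shows "smooth_on (snd c ` (fst c \<inter> h -` fst d)) (chart_rep c d h)"
  using h c d unfolding holo_map_def holo_on_def chart_rep_def by blast

lemma chart_dom_iff:
  assumes c: "c \<in> A"
  shows "z \<in> snd c ` (fst c \<inter> h -` fst d) \<longleftrightarrow> z \<in> snd c ` fst c \<and> h (chart_inv c z) \<in> fst d"
  using chartD(5-7)[OF c] by force

lemma chart_rep_deriv: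
  assumes h: "holo_map A A h" and c: "c \<in> A" and d: "d \<in> A"
    and z: "z \<in> snd c ` fst c" "h (chart_inv c z) \<in> fst d"
  shows "(chart_rep c d h has_derivative chart_deriv c d h z) (at z)"
    and "linear (chart_deriv c d h z)"
    and "chart_deriv c d h z (a *s y) = a *s chart_deriv c d h z y"
proof -
  have mem: "z \<in> snd c ` (fst c \<inter> h -` fst d)" using chart_dom_iff[OF c] z by blast
  show D: "(chart_rep c d h has_derivative chart_deriv c d h z) (at z)"
    unfolding chart_deriv_def
    by (rule frechet_derivative_has_derivative[OF smooth_on_differentiable[OF chart_rep_smooth[OF h c d] mem]])
  then show "linear (chart_deriv c d h z)" by (rule has_derivative_linear)
  show "chart_deriv c d h z (a *s y) = a *s chart_deriv c d h z y"
    using h c d mem unfolding holo_map_def holo_on_def chart_rep_def chart_deriv_def by blast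
qed

lemma chart_deriv_comp:
  assumes h: "holo_map A A h" and k: "holo_map A A k" and c: "c \<in> A" and d: "d \<in> A" and e: "e \<in> A"
    and z: "z \<in> snd c ` fst c" "h (chart_inv c z) \<in> fst d" "k (h (chart_inv c z)) \<in> fst e"
  shows "chart_deriv c e (\<lambda>x. k (h x)) z y = chart_deriv d e k (snd d (h (chart_inv c z))) (chart_deriv c d h z y)"
proof -
  let ?z' = "snd d (h (chart_inv c z))"
  let ?S = "snd c ` (fst c \<inter> h -` fst d)"
  have z': "?z' \<in> snd d ` fst d" "k (chart_inv d ?z') \<in> fst e"
    using z chartD(5)[OF d] by auto
  have S: "open ?S" "z \<in> ?S"
    using open_chart_dom[OF c d, of h] h chart_dom_iff[OF c, of z h d] z by (simp_all add: holo_map_def)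
  have rz: "chart_rep c d h z = ?z'" by (simp add: chart_rep_def)
  have 1: "((\<lambda>y. chart_rep d e k (chart_rep c d h y)) has_derivative
      (\<lambda>y. chart_deriv d e k ?z' (chart_deriv c d h z y))) (at z)"
    by (rule has_derivative_compose[OF chart_rep_deriv(1)[OF h c d z(1,2)]])
      (use chart_rep_deriv(1)[OF k d e z'] in \<open>simp add: rz\<close>)
  have "(chart_rep c e (\<lambda>x. k (h x)) has_derivative
      (\<lambda>y. chart_deriv d e k ?z' (chart_deriv c d h z y))) (at z)"
  proof (rule has_derivative_transform_within_open[OF 1 S])
    fix w assume "w \<in> ?S"
    then have "h (chart_inv c w) \<in> fst d" using chart_dom_iff[OF c, of w h d] by simp
    then show "chart_rep d e k (chart_rep c d h w) = chart_rep c e (\<lambda>x. k (h x)) w"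
      by (simp add: chart_rep_def chartD(5)[OF d])
  qed
  then show ?thesis unfolding chart_deriv_def[of c e] by (simp add: frechet_derivative_eqI)
qed

lemma chart_deriv_id:
  assumes c: "c \<in> A" and z: "z \<in> snd c ` fst c"
  shows "chart_deriv c c (\<lambda>x. x) z y = y"
proof -
  have "(chart_rep c c (\<lambda>x. x) has_derivative (\<lambda>y. y)) (at z)"
    by (rule has_derivative_transform_within_open[OF has_derivative_ident chartD(2)[OF c] z])
      (simp add: chart_rep_def chartD(6)[OF c])
  then show ?thesis unfolding chart_deriv_def by (simp add: frechet_derivative_eqI)
qed

lemma from_chart_eq: "from_chart A c z = chart_deriv c (chart_at A (chart_inv c z)) (\<lambda>x. x) z"
  by (simp add: from_chart_def chart_deriv_def chart_rep_def comp_def)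

lemma to_chart_eq: "to_chart A c p = chart_deriv (chart_at A p) c (\<lambda>x. x) (snd (chart_at A p) p)"
  by (simp add: to_chart_def chart_deriv_def chart_rep_def comp_def)

lemma tangent_map_eq:
  "tangent_map A h p = chart_deriv (chart_at A p) (chart_at A (h p)) h (snd (chart_at A p) p)"
  by (simp add: tangent_map_def chart_deriv_def chart_rep_def)

end

section \<open>Left-invariant fields in charts\<close>

locale complex_lie_group = complex_manifold A for A :: "('g::topological_space, complex^'n) chart set" +
  fixes G :: "'g monoid"
  assumes lie: "lie_group G A" and left: "left_invariant_complex_structure G A"
begin

abbreviation one :: 'g where "one \<equiv> \<one>\<^bsub>G\<^esub>"
abbreviation L :: "'g \<Rightarrow> 'g \<Rightarrow> 'g" where "L p \<equiv> (\<lambda>q. p \<otimes>\<^bsub>G\<^esub> q)"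

lemma grp: "group G" "carrier G = UNIV" using lie by (auto simp: lie_group_def)

lemma L_simps: "L one p = p" "L p one = p" "L (L p q) r = L p (L q r)"
  "L (inv\<^bsub>G\<^esub> p) (L p q) = q" "L p (L (inv\<^bsub>G\<^esub> p) q) = q"
proof -
  interpret group G by (rule grp)
  show "L one p = p" "L p one = p" "L (L p q) r = L p (L q r)"
    by (simp_all add: grp(2) m_assoc)
  show "L (inv\<^bsub>G\<^esub> p) (L p q) = q" "L p (L (inv\<^bsub>G\<^esub> p) q) = q"
    by (simp_all add: grp(2) m_assoc[symmetric])
qed

lemma holo_L: "holo_map A A (L p)"
  using left by (simp add: left_invariant_complex_structure_def)

abbreviation c0 where "c0 \<equiv> chart_at A one"
abbreviation y0 where "y0 \<equiv> snd c0 one"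

lemma c0: "c0 \<in> A" "one \<in> fst c0" "y0 \<in> snd c0 ` fst c0" "chart_inv c0 y0 = one"
  using chart_at[of one] chartD(5) by auto

text \<open>The components in the chart \<open>c\<close> of the left-invariant frame at the point with coordinates \<open>z\<close>.\<close>

definition T0 :: "('g, complex^'n) chart \<Rightarrow> complex^'n \<Rightarrow> complex^'n \<Rightarrow> complex^'n" where
  "T0 c z = chart_deriv c0 c (L (chart_inv c z)) y0"

lemma T0_deriv:
  assumes c: "c \<in> A" and z: "z \<in> snd c ` fst c"
  shows "(chart_rep c0 c (L (chart_inv c z)) has_derivative T0 c z) (at y0)"
    "linear (T0 c z)" "T0 c z (a *s y) = a *s T0 c z y"
proof -
  have m: "L (chart_inv c z) (chart_inv c0 y0) \<in> fst c"
    by (simp add: c0(4) L_simps chartD(7)[OF c z])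
  note * = chart_rep_deriv[OF holo_L c0(1) c c0(3) m]
  show "(chart_rep c0 c (L (chart_inv c z)) has_derivative T0 c z) (at y0)" unfolding T0_def by (rule *)
  show "linear (T0 c z)" unfolding T0_def by (rule *)
  show "T0 c z (a *s y) = a *s T0 c z y" unfolding T0_def by (rule *)
qed

text \<open>Chain rule for two successive left translations. With \<open>g\<close> the neutral
  element it becomes the change of charts, with \<open>g\<close> the inverse of the base point it
  inverts the frame.\<close>

lemma T0_translate:
  assumes c: "c \<in> A" and d: "d \<in> A" and z: "z \<in> snd c ` fst c" and m: "L g (chart_inv c z) \<in> fst d"
  shows "T0 d (snd d (L g (chart_inv c z))) y = chart_deriv c d (L g) z (T0 c z y)"
proof -
  have 1: "L (chart_inv c z) (chart_inv c0 y0) = chart_inv c z" by (simp add: c0(4) L_simps)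
  have "chart_deriv c0 d (\<lambda>x. L g (L (chart_inv c z) x)) y0 y
      = chart_deriv c d (L g) (snd c (L (chart_inv c z) (chart_inv c0 y0)))
          (chart_deriv c0 c (L (chart_inv c z)) y0 y)"
    by (rule chart_deriv_comp[OF holo_L holo_L c0(1) c d c0(3)])
      (simp_all only: 1 chartD(7)[OF c z] m)
  then show ?thesis
    by (simp only: T0_def 1 chartD(5)[OF d m] chartD(6)[OF c z] L_simps)
qed

lemma T0_change:
  assumes c: "c \<in> A" and d: "d \<in> A" and z: "z \<in> snd c ` fst c" and m: "chart_inv c z \<in> fst d"
  shows "T0 d (snd d (chart_inv c z)) y = chart_deriv c d (\<lambda>x. x) z (T0 c z y)"
proof -
  have "(\<lambda>x. L one x) = (\<lambda>x. x)" by (simp add: L_simps)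
  then show ?thesis using T0_translate[OF c d z, of one y] m by (simp add: L_simps)
qed

lemma T0_y0: "T0 c0 y0 y = y"
proof -
  have "L (chart_inv c0 y0) = (\<lambda>x. x)" by (simp add: c0(4) L_simps)
  then show ?thesis unfolding T0_def by (simp add: chart_deriv_id[OF c0(1,3)])
qed

definition T0inv :: "('g, complex^'n) chart \<Rightarrow> complex^'n \<Rightarrow> complex^'n \<Rightarrow> complex^'n" where
  "T0inv c z = chart_deriv c c0 (L (inv\<^bsub>G\<^esub> (chart_inv c z))) z"

lemma inv_L: "L (inv\<^bsub>G\<^esub> p) p = one"
  using L_simps(4)[of p one] L_simps(2) by simp

lemma T0inv:
  assumes c: "c \<in> A" and z: "z \<in> snd c ` fst c"
  shows "T0inv c z (T0 c z y) = y" "T0 c z (T0inv c z y) = y"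
proof -
  let ?p = "chart_inv c z"
  show "T0inv c z (T0 c z y) = y"
    using T0_translate[OF c c0(1) z, of "inv\<^bsub>G\<^esub> ?p" y] c0(2)
    by (simp add: inv_L T0_y0 T0inv_def)
  have "chart_deriv c c (\<lambda>x. L ?p (L (inv\<^bsub>G\<^esub> ?p) x)) z y
    = chart_deriv c0 c (L ?p) (snd c0 (L (inv\<^bsub>G\<^esub> ?p) ?p)) (chart_deriv c c0 (L (inv\<^bsub>G\<^esub> ?p)) z y)"
    by (rule chart_deriv_comp[OF holo_L holo_L c c0(1) c z])
      (simp_all add: inv_L c0(2) L_simps(2) chartD(7)[OF c z])
  then have "chart_deriv c c (\<lambda>x. x) z y = T0 c z (T0inv c z y)"
    by (simp only: L_simps(5) inv_L T0_def T0inv_def)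
  then show "T0 c z (T0inv c z y) = y" by (simp only: chart_deriv_id[OF c z])
qed

lemma left_field_eq: "left_field G A x p = T0 (chart_at A p) (snd (chart_at A p) p) x"
  by (simp add: left_field_def tangent_map_eq T0_def L_simps chartD(5)[OF chart_at])

lemma from_chart_T0:
  assumes c: "c \<in> A" and z: "z \<in> snd c ` fst c"
  shows "from_chart A c z (T0 c z x) = left_field G A x (chart_inv c z)"
  unfolding from_chart_eq left_field_eq by (rule T0_change[OF c chart_at(1) z chart_at(2), symmetric])

lemma field_in_chart_left_field:
  assumes c: "c \<in> A" and z: "z \<in> snd c ` fst c"
  shows "field_in_chart A c (left_field G A x) z = T0 c z x"
proof -
  let ?p = "chart_inv c z" let ?d = "chart_at A ?p"
  have p: "chart_inv ?d (snd ?d ?p) = ?p" by (rule chartD(5)[OF chart_at])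
  have "T0 c (snd c (chart_inv ?d (snd ?d ?p))) x = chart_deriv ?d c (\<lambda>x. x) (snd ?d ?p) (T0 ?d (snd ?d ?p) x)"
    by (rule T0_change[OF chart_at(1) c]) (use chart_at(2) chartD(7)[OF c z] in \<open>auto simp: p\<close>)
  then show ?thesis
    by (simp only: field_in_chart_def to_chart_eq left_field_eq p chartD(6)[OF c z])
qed

lemma linear_left_field: "linear (\<lambda>x. left_field G A x p)"
    and left_field_scale: "left_field G A (a *s x) p = a *s left_field G A x p"
proof -
  have z: "snd (chart_at A p) p \<in> snd (chart_at A p) ` fst (chart_at A p)"
    using chart_at(2) by auto
  show "linear (\<lambda>x. left_field G A x p)"
    unfolding left_field_eq using T0_deriv(2)[OF chart_at(1) z] .
  show "left_field G A (a *s x) p = a *s left_field G A x p"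
    unfolding left_field_eq by (rule T0_deriv(3)[OF chart_at(1) z])
qed

lemma left_field_inj: "left_field G A x p = left_field G A y p \<Longrightarrow> x = y"
proof -
  have z: "snd (chart_at A p) p \<in> snd (chart_at A p) ` fst (chart_at A p)"
    using chart_at(2) by auto
  show "left_field G A x p = left_field G A y p \<Longrightarrow> x = y"
    unfolding left_field_eq using T0inv(1)[OF chart_at(1) z] by metis
qed

lemma prod_chart_inv:
  assumes c: "c \<in> A" and d: "d \<in> A" and z: "z \<in> snd c ` fst c" and y: "y \<in> snd d ` fst d"
  shows "chart_inv (fst c \<times> fst d, map_prod (snd c) (snd d)) (z, y) = (chart_inv c z, chart_inv d y)"
proof -
  have "inj_on (snd c) (fst c)" "inj_on (snd d) (fst d)"
    using chartD(5)[OF c] chartD(5)[OF d] by (metis inj_onI)+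
  then have "inj_on (map_prod (snd c) (snd d)) (fst c \<times> fst d)" by (rule map_prod_inj_on)
  then have "inv_into (fst c \<times> fst d) (map_prod (snd c) (snd d)) (map_prod (snd c) (snd d) (chart_inv c z, chart_inv d y))
    = (chart_inv c z, chart_inv d y)"
    by (rule inv_into_f_f) (simp add: chartD(7)[OF c z] chartD(7)[OF d y])
  then show ?thesis by (simp add: chart_inv_def[of "(_, _)"] chartD(6)[OF c z] chartD(6)[OF d y])
qed

text \<open>\<open>T0 c z x\<close> is a partial derivative of the multiplication in charts, hence smooth in \<open>z\<close>.\<close>

lemma differentiable_T0:
  assumes c: "c \<in> A" and z1: "z1 \<in> snd c ` fst c"
  shows "(\<lambda>z. T0 c z x) differentiable (at z1)"
proof -
  define cc where "cc = (fst c \<times> fst c0, map_prod (snd c) (snd c0))"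
  define mm where "mm = snd c \<circ> (\<lambda>(x, y). x \<otimes>\<^bsub>G\<^esub> y) \<circ> chart_inv cc"
  define W where "W = snd cc ` (fst cc \<inter> (\<lambda>(x, y). x \<otimes>\<^bsub>G\<^esub> y) -` fst c)"
  have "cc \<in> prod_atlas A A" using c c0(1) unfolding cc_def prod_atlas_def by blast
  then have sm: "smooth_on W mm"
    using lie c unfolding lie_group_def smooth_map_def mm_def W_def by blast
  have W: "(z, y0) \<in> W" if "z \<in> snd c ` fst c" for z
  proof -
    have "(z, y0) = snd cc (chart_inv c z, one)"
      by (simp add: cc_def chartD(6)[OF c that])
    moreover have "(chart_inv c z, one) \<in> fst cc \<inter> (\<lambda>(x, y). x \<otimes>\<^bsub>G\<^esub> y) -` fst c"
      using chartD(7)[OF c that] c0(2) by (simp add: cc_def L_simps)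
    ultimately show ?thesis unfolding W_def by blast
  qed
  have T: "T0 c z x = frechet_derivative mm (at (z, y0)) (0, x)" if z: "z \<in> snd c ` fst c" for z
  proof -
    have p: "((\<lambda>y. (z, y)) has_derivative (\<lambda>h. (0, h))) (at y0)"
      by (intro has_derivative_Pair has_derivative_const has_derivative_ident)
    have m: "(mm has_derivative frechet_derivative mm (at (z, y0))) (at (z, y0))"
      by (rule frechet_derivative_has_derivative[OF smooth_on_differentiable[OF sm W[OF z]]])
    have 1: "((\<lambda>y. mm (z, y)) has_derivative (\<lambda>h. frechet_derivative mm (at (z, y0)) (0, h))) (at y0)"
      by (rule has_derivative_compose[OF p m])
    have "(chart_rep c0 c (L (chart_inv c z)) has_derivative
        (\<lambda>h. frechet_derivative mm (at (z, y0)) (0, h))) (at y0)"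
      by (rule has_derivative_transform_within_open[OF 1 chartD(2)[OF c0(1)] c0(3)])
        (simp add: mm_def cc_def chart_rep_def prod_chart_inv[OF c c0(1) z])
    then show ?thesis
      using has_derivative_unique[OF T0_deriv(1)[OF c z]] by metis
  qed
  have d: "(\<lambda>w. frechet_derivative mm (at w) (0, x)) differentiable (at (z1, y0))"
    by (rule smooth_on_differentiable[OF smooth_on_frechet_derivative[OF sm] W[OF z1]])
  have p: "((\<lambda>z. (z, y0)) has_derivative (\<lambda>h. (h, 0))) (at z1)"
    by (intro has_derivative_Pair has_derivative_const has_derivative_ident)
  have "(\<lambda>z. frechet_derivative mm (at (z, y0)) (0, x)) differentiable (at z1)"
    using has_derivative_compose[OF p frechet_derivative_has_derivative[OF d]] by (rule differentiableI)
  then show ?thesis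
    using differentiable_cong_open[OF chartD(2)[OF c] z1, of "\<lambda>z. T0 c z x" "\<lambda>z. frechet_derivative mm (at (z, y0)) (0, x)"] T
    by blast
qed

lemma lie_bracket_eq:
  "lie_bracket G A x y = frechet_derivative (\<lambda>z. T0 c0 z y) (at y0) x - frechet_derivative (\<lambda>z. T0 c0 z x) (at y0) y"
proof -
  have "frechet_derivative (field_in_chart A c0 (left_field G A x)) (at y0) = frechet_derivative (\<lambda>z. T0 c0 z x) (at y0)" for x
    by (rule frechet_derivative_cong_open[OF chartD(2)[OF c0(1)] c0(3)]) (rule field_in_chart_left_field[OF c0(1)])
  then show ?thesis
    by (simp add: lie_bracket_def field_bracket_def Let_def field_in_chart_left_field[OF c0(1,3)] T0_y0)
qed

text \<open>Translation by \<open>g\<close> carries the frame near the neutral element to the frame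
  near \<open>z1\<close>. Differentiating this relation brings in a second derivative of the
  translation, which is symmetric in \<open>x\<close> and \<open>y\<close> and cancels in the
  bracket.\<close>

lemma T0_bracket:
  assumes c: "c \<in> A" and z1: "z1 \<in> snd c ` fst c"
  shows "frechet_derivative (\<lambda>z. T0 c z y) (at z1) (T0 c z1 x) - frechet_derivative (\<lambda>z. T0 c z x) (at z1) (T0 c z1 y)
    = T0 c z1 (lie_bracket G A x y)"
proof -
  define g where "g = chart_inv c z1"
  define fg where "fg = chart_rep c0 c (L g)"
  define V where "V = snd c0 ` (fst c0 \<inter> L g -` fst c)"
  have g: "g \<in> fst c" using chartD(7)[OF c z1] by (simp add: g_def)
  have V: "open V" unfolding V_def
    by (rule open_chart_dom[OF c0(1) c]) (use holo_L in \<open>simp add: holo_map_def\<close>)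
  have yV: "y0 \<in> V" unfolding V_def using c0(2) g by (auto simp: L_simps)
  have sm: "smooth_on V fg" unfolding V_def fg_def by (rule chart_rep_smooth[OF holo_L c0(1) c])
  have inV: "z \<in> snd c0 ` fst c0 \<and> L g (chart_inv c0 z) \<in> fst c" if "z \<in> V" for z
    using that chart_dom_iff[OF c0(1), of z "L g" c] unfolding V_def by blast
  have fg0: "fg y0 = z1" by (simp add: fg_def chart_rep_def c0(4) L_simps g_def chartD(6)[OF c z1])
  have Dfg: "frechet_derivative fg (at y0) = T0 c z1"
    by (simp add: T0_def chart_deriv_def fg_def g_def)
  let ?DT = "\<lambda>x. frechet_derivative (\<lambda>z. T0 c z x) (at z1)"
  let ?D0 = "\<lambda>x. frechet_derivative (\<lambda>z. T0 c0 z x) (at y0)"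
  let ?D2 = "\<lambda>x. frechet_derivative (\<lambda>z. frechet_derivative fg (at z) x) (at y0)"
  have key: "?DT x (T0 c z1 h) = ?D2 x h + T0 c z1 (?D0 x h)" for x h
  proof -
    have eq: "T0 c (fg z) x = frechet_derivative fg (at z) (T0 c0 z x)" if "z \<in> V" for z
      using T0_translate[OF c0(1) c, of z g x] inV[OF that] by (simp add: fg_def chart_deriv_def chart_rep_def)
    have f: "(fg has_derivative T0 c z1) (at y0)"
      using frechet_derivative_has_derivative[OF smooth_on_differentiable[OF sm yV]] by (simp add: Dfg)
    have "((\<lambda>z. T0 c z x) has_derivative ?DT x) (at (fg y0))"
      using frechet_derivative_has_derivative[OF differentiable_T0[OF c z1]] by (simp add: fg0)
    from has_derivative_compose[OF f this]
    have 1: "((\<lambda>z. T0 c (fg z) x) has_derivative (\<lambda>h. ?DT x (T0 c z1 h))) (at y0)" .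
    have lin: "linear (frechet_derivative fg (at z))" if "z \<in> V" for z
      by (rule linear_frechet_derivative[OF smooth_on_differentiable[OF sm that]])
    have d2: "((\<lambda>z. frechet_derivative fg (at z) a) has_derivative ?D2 a) (at y0)" for a
      by (rule frechet_derivative_has_derivative[OF smooth_on_differentiable[OF smooth_on_frechet_derivative[OF sm] yV]])
    have d0: "((\<lambda>z. T0 c0 z x) has_derivative ?D0 x) (at y0)"
      by (rule frechet_derivative_has_derivative[OF differentiable_T0[OF c0(1,3)]])
    have "((\<lambda>z. frechet_derivative fg (at z) (T0 c0 z x)) has_derivative
        (\<lambda>h. ?D2 (T0 c0 y0 x) h + frechet_derivative fg (at y0) (?D0 x h))) (at y0)"
      by (rule has_derivative_linear_apply[OF V yV lin d2 d0])
    then have "((\<lambda>z. T0 c (fg z) x) has_derivative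
        (\<lambda>h. ?D2 (T0 c0 y0 x) h + frechet_derivative fg (at y0) (?D0 x h))) (at y0)"
      by (rule has_derivative_transform_within_open[OF _ V yV]) (simp add: eq)
    from has_derivative_unique[OF 1 this] show ?thesis by (simp add: T0_y0 Dfg fun_eq_iff)
  qed
  have sym: "?D2 y x = ?D2 x y" by (rule frechet_derivative_commute[OF V yV sm])
  show ?thesis
    unfolding key sym lie_bracket_eq by (simp add: linear_diff[OF T0_deriv(2)[OF c z1]])
qed

lemma lie_bracket_alt: "lie_bracket G A x y = - lie_bracket G A y x"
  by (simp add: lie_bracket_eq)

lemma bilinear_lie_bracket: "bilinear (lie_bracket G A)"
proof -
  have S: "open (snd c0 ` fst c0)" "y0 \<in> snd c0 ` fst c0" using chartD(2)[OF c0(1)] c0(3) by auto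
  have comp: "((\<lambda>z. T0 c0 z x $ k) has_derivative (\<lambda>h. frechet_derivative (\<lambda>z. T0 c0 z x) (at y0) h $ k)) (at y0)" for x k
    by (rule bounded_linear.has_derivative[OF bounded_linear_vec_nth
          frechet_derivative_has_derivative[OF differentiable_T0[OF c0(1,3)]]])
  \<comment> \<open>Formally the bracket at the neutral element is an exterior derivative, so
    \<open>linear_ext_d\<close> gives linearity in \<open>x\<close>; linearity in \<open>y\<close>
    follows by antisymmetry.\<close>
  have e: "lie_bracket G A x y $ k = ext_d (\<lambda>z a. T0 c0 z a $ k) y0 x y" for x y k
    by (simp add: ext_d_def frechet_derivative_eqI[OF comp] lie_bracket_eq)
  have "linear (\<lambda>x. ext_d (\<lambda>z a. T0 c0 z a $ k) y0 x y)" for y k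
    by (rule linear_ext_d[OF S])
      (use comp in \<open>auto intro!: linearI differentiableI simp: linear_add[OF T0_deriv(2)[OF c0(1)]] linear_cmul[OF T0_deriv(2)[OF c0(1)]]\<close>)
  then have l: "linear (\<lambda>x. lie_bracket G A x y $ k)" for y k unfolding e .
  have lin: "linear (\<lambda>x. lie_bracket G A x y)" for y
    by (rule linearI) (simp_all add: vec_eq_iff linear_add[OF l] linear_cmul[OF l])
  have "linear (\<lambda>y. lie_bracket G A x y)" for x
    using linear_compose_neg[OF lin[of x]] by (subst lie_bracket_alt) simp
  with lin show ?thesis by (simp add: bilinear_def)
qed

end

section \<open>The theorem\<close>

lemma vec10_eq: "vec10 a = ((1/2) *\<^sub>R a, - ((1/2) *\<^sub>R (\<i> *s a)))"
  by (simp add: vec10_def part10_def cscale_def cx_ext_def Icx_def)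

text \<open>The projection to type (1,0) turns the formal imaginary unit of the complexification
  into the complex structure.\<close>

lemma part10_eq: "part10 (x, y) = vec10 (x + \<i> *s y)"
  by (simp add: vec10_eq part10_def cscale_def cx_ext_def Icx_def vec_eq_iff complex_eq_iff field_simps)

lemma vec10_inj: "vec10 a = vec10 b \<longleftrightarrow> a = b"
  by (simp add: vec10_eq)

lemma vec10_add: "vec10 (a + b) = vec10 a + vec10 b"
  by (simp add: vec10_eq vec_eq_iff complex_eq_iff field_simps)

lemma vec10_diff: "vec10 (a - b) = vec10 a - vec10 b"
  by (simp add: vec10_eq vec_eq_iff complex_eq_iff field_simps)

lemma cscale_vec10: "cscale a (vec10 b) = vec10 (a *s b)"
  by (simp add: vec10_eq cscale_def vec_eq_iff complex_eq_iff algebra_simps)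

lemma vec10_0: "vec10 0 = 0"
  by (simp add: vec10_eq zero_prod_def)

lemma vec10_sum: "vec10 (\<Sum>i\<in>S. h i) = (\<Sum>i\<in>S. vec10 (h i))"
  by (induction S rule: infinite_finite_induct) (simp_all add: vec10_add vec10_0)

lemma vec10_in_T10: "vec10 a \<in> T10"
  unfolding vec10_def by (rule part10_in_T10)

lemma T10_vec10: assumes "\<xi> \<in> T10" shows "\<xi> = vec10 (2 *\<^sub>R fst \<xi>)"
proof -
  have y: "\<i> *s fst \<xi> = - snd \<xi>"
    using assms by (cases \<xi>) (simp add: T10_def cscale_def cx_ext_def Icx_def)
  have "(1/2) *\<^sub>R (\<i> *s (2 *\<^sub>R fst \<xi>)) = \<i> *s fst \<xi>"
    by (simp add: vec_eq_iff)
  then show ?thesis by (simp add: vec10_eq y prod_eq_iff)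
qed

lemma cx_ext_vec10:
  assumes "linear h" "\<And>a y. h (a *s y) = a *s h y"
  shows "cx_ext h (vec10 y) = vec10 (h y)"
  by (simp add: cx_ext_def vec10_eq linear_cmul[OF assms(1)] linear_neg[OF assms(1)] assms(2))

lemma cbar_vec10: "cbar (vec10 a) = ((1/2) *\<^sub>R a, (1/2) *\<^sub>R (\<i> *s a))"
  by (simp add: cbar_def vec10_eq)

lemma cbar_cbar: "cbar (cbar \<xi>) = \<xi>"
  by (simp add: cbar_def)

lemma part01_cbar: "part01 (cbar \<xi>) = cbar (part10 \<xi>)"
  by (cases \<xi>) (simp add: part01_def part10_def cbar_def cscale_def cx_ext_def Icx_def vec_eq_iff complex_eq_iff field_simps)

section \<open>Components with respect to a basis\<close>

locale basis10 =
  fixes e :: "'n \<Rightarrow> (complex^'n) cplx"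
  assumes basis: "is_basis10 e"
begin

text \<open>The factor 2 undoes the 1/2 in \<open>vec10\<close>.\<close>

definition be :: "'n \<Rightarrow> complex^'n" where
  "be i = 2 *\<^sub>R fst (e i)"

lemma e_vec10: "e i = vec10 (be i)"
  using basis T10_vec10 unfolding is_basis10_def be_def by blast

definition Bm :: "complex^'n^'n" where
  "Bm = (\<chi> k i. be i $ k)"

lemma Bm_mult: "Bm *v u = (\<Sum>i\<in>UNIV. u $ i *s be i)"
  by (simp add: Bm_def vec_eq_iff matrix_vector_mult_def mult.commute)

lemma comb_eq: "comb e u = vec10 (Bm *v u)"
  by (simp add: comb_def e_vec10 cscale_vec10 Bm_mult vec10_sum)

lemma comb_comps: "\<xi> \<in> T10 \<Longrightarrow> comb e (comps e \<xi>) = \<xi>"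
  unfolding comps_def by (rule theI') (use basis in \<open>auto simp: is_basis10_def\<close>)

lemma comb_in_T10: "comb e u \<in> T10"
  by (simp add: comb_eq vec10_in_T10)

lemma comb_inj: "comb e u = comb e u' \<longleftrightarrow> u = u'"
  using basis comb_in_T10 unfolding is_basis10_def by metis

lemma comps_comb: "comps e (comb e u) = u"
  using comb_comps[OF comb_in_T10] comb_inj by blast

definition Bi :: "complex^'n \<Rightarrow> complex^'n" where
  "Bi a = comps e (vec10 a)"

lemma Bm_Bi: "Bm *v Bi a = a"
  using comb_comps[OF vec10_in_T10[of a]] by (simp add: Bi_def comb_eq vec10_inj)

lemma Bi_Bm: "Bi (Bm *v u) = u"
  using comps_comb[of u] by (simp add: Bi_def comb_eq)

lemma Bm_inj: "Bm *v u = Bm *v u' \<longleftrightarrow> u = u'"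
  by (metis Bi_Bm)

lemma Bm_0: "Bm *v u = 0 \<longleftrightarrow> u = 0"
  using Bm_inj[of u 0] by simp

lemma Bm_scale: "Bm *v (a *s u) = a *s (Bm *v u)"
  by (simp add: vec_eq_iff matrix_vector_mult_def sum_distrib_left mult_ac)

lemma Bm_scaleR: "Bm *v (r *\<^sub>R u) = r *\<^sub>R (Bm *v u)"
  by (rule linear_cmul[OF matrix_vector_mul_linear])

lemma comb_add: "comb e (u + u') = comb e u + comb e u'"
  by (simp add: comb_eq vec10_add matrix_vector_right_distrib)

lemma comb_diff: "comb e (u - u') = comb e u - comb e u'"
  by (simp add: comb_eq vec10_diff matrix_vector_mult_diff_distrib)

lemma comb_scale: "comb e (a *s u) = cscale a (comb e u)"
  by (simp add: comb_eq cscale_vec10 Bm_scale)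

lemma comb_0: "comb e u = 0 \<longleftrightarrow> u = 0"
  using comb_inj[of u 0] by (simp add: comb_eq vec10_0)

end

section \<open>Reduction to the fibre over the neutral element\<close>

locale finsler_lie_group = complex_lie_group A G + basis10 e
  for A :: "('g::topological_space, complex^'n) chart set" and G :: "'g monoid"
    and e :: "'n \<Rightarrow> (complex^'n) cplx" +
  fixes F :: "'g \<Rightarrow> (complex^'n) cplx \<Rightarrow> real"
  assumes finsler: "complex_finsler_metric A F" and pseudoconvex: "strongly_pseudoconvex F"
    and invariant: "left_invariant_metric G A F"
begin

abbreviation E where "E \<equiv> left_frame G A e"

lemma cx_left_field_vec10: "cx_left_field G A (vec10 a) p = vec10 (left_field G A a p)"
  unfolding cx_left_field_def by (rule cx_ext_vec10[OF linear_left_field left_field_scale])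

lemma comb_frame: "comb (frame_at E p) u = cx_left_field G A (comb e u) p"
proof -
  have "frame_at E p i = vec10 (left_field G A (be i) p)" for i
    by (simp add: frame_at_def left_frame_def e_vec10 cx_left_field_vec10)
  then have "comb (frame_at E p) u = vec10 (\<Sum>i\<in>UNIV. left_field G A (u $ i *s be i) p)"
    by (simp add: comb_def cscale_vec10 vec10_sum left_field_scale)
  also have "(\<Sum>i\<in>UNIV. left_field G A (u $ i *s be i) p) = left_field G A (Bm *v u) p"
    by (simp only: Bm_mult linear_sum[OF linear_left_field])
  finally show ?thesis by (simp add: comb_eq cx_left_field_vec10)
qed

lemma comps_frame: "comps (frame_at E p) (cx_left_field G A (comb e u) p) = u"
  unfolding comps_def
  by (rule the_equality)
    (auto simp: comb_frame comb_eq cx_left_field_vec10 vec10_inj Bm_inj dest!: left_field_inj)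

lemma F_left_field: "\<xi> \<in> T10 \<Longrightarrow> F p (cx_left_field G A \<xi> p) = F one \<xi>"
  using invariant[unfolded left_invariant_metric_def, rule_format, of \<xi> p one]
  by (simp add: L_simps cx_left_field_def left_field_def[abs_def])

text \<open>Left invariance of \<open>F\<close> makes the metric the same function of the frame
  coordinates over every point, so a single fibre function \<open>f\<close> determines all metric
  coefficients.\<close>

lemma fsq_frame: "fsq (F p) (frame_at E p) = fsq (F one) e"
  by (simp add: fsq_def fun_eq_iff comb_frame F_left_field comb_in_T10)

abbreviation f where "f \<equiv> fsq (F one) e"

text \<open>The metric in the chart \<open>c0\<close> is restricted along the affine embedding of
  \<open>v\<close> as \<open>(y0, v)\<close>.\<close>

lemma smooth_fibre: "smooth_on (UNIV - {0}) (\<lambda>v. complex_of_real ((F one (vec10 v))\<^sup>2))"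
proof -
  let ?S = "snd c0 ` fst c0"
  have S: "open (?S \<times> (UNIV - {0::complex^'n}))"
    by (intro open_Times chartD(2)[OF c0(1)]) (simp add: open_delete)
  have R: "open (UNIV - {0::complex^'n})" by (simp add: open_delete)
  have "smooth_on (?S \<times> (UNIV - {0})) (metric_in_chart A F c0)"
    using finsler c0(1) by (simp add: complex_finsler_metric_def)
  then have "smooth_on (UNIV - {0}) (\<lambda>v. metric_in_chart A F c0 ((y0, 0) + (0, v)))"
    by (rule smooth_on_affine[of "\<lambda>v. (0, v)", OF _ S R, rotated 2])
      (use c0(3) in \<open>auto intro!: linear_conv_bounded_linear[THEN iffD1] linearI\<close>)
  moreover have "metric_in_chart A F c0 ((y0, 0) + (0, v)) = F one (vec10 v)" for v
  proof -
    \<comment> \<open>The chart selected at the neutral element is \<open>c0\<close> itself.\<close>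
    have "from_chart A c0 y0 = id"
      by (rule ext) (simp add: from_chart_eq c0(4) chart_deriv_id[OF c0(1,3)])
    then show ?thesis by (simp add: metric_in_chart_def c0(4) cx_ext_def prod.map_id)
  qed
  ultimately have "smooth_on (UNIV - {0}) (\<lambda>v. F one (vec10 v))" by simp
  then show ?thesis
    unfolding power2_eq_square
    by (intro smooth_on_bounded_linear[OF bounded_linear_of_real R] smooth_on_mult R)
qed

lemma fsq_basis: "f = (\<lambda>v. complex_of_real ((F one (vec10 (Bm *v v)))\<^sup>2))"
  by (rule ext) (simp add: fsq_def comb_eq)

sublocale finsler_fibre f
proof
  let ?h = "\<lambda>v. complex_of_real ((F one (vec10 v))\<^sup>2)"
  have R: "open (UNIV - {0::complex^'n})" by (simp add: open_delete)
  have "smooth_on (UNIV - {0}) (\<lambda>v. ?h (0 + Bm *v v))"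
    by (rule smooth_on_affine[OF _ R R _ smooth_fibre])
      (auto simp: Bm_0 intro: linear_conv_bounded_linear[THEN iffD1] matrix_vector_mul_linear)
  then show "smooth_on (UNIV - {0}) f" by (simp add: fsq_basis)
  show "cnj (f v) = f v" for v by (simp add: fsq_def)
  show "f (a *s v) = a * cnj a * f v" for a v
  proof -
    have "F one (cscale a (comb e v)) = cmod a * F one (comb e v)"
      using finsler comb_in_T10 by (simp add: complex_finsler_metric_def)
    then show ?thesis
      by (simp add: fsq_def comb_scale power_mult_distrib complex_norm_square[unfolded of_real_power])
  qed
  show "(\<Sum>i\<in>UNIV. \<Sum>j\<in>UNIV. wd i (wdbar j f) v * u $ i * cnj (u $ j)) \<noteq> 0" if "v \<noteq> 0" "u \<noteq> 0" for v u
  proof -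
    \<comment> \<open>Pseudoconvexity is stated for the coordinate basis; \<open>Bm\<close> passes
      from components in \<open>e\<close> to coordinates.\<close>
    have comb_std: "comb (\<lambda>k. vec10 (axis k 1)) a = vec10 a" for a :: "complex^'n"
      by (simp only: comb_def cscale_vec10 vec10_sum[symmetric] basis_expansion)
    have h: "fsq (F one) (\<lambda>k. vec10 (axis k 1)) = ?h"
      by (rule ext) (simp add: fsq_def comb_std)
    have "Bm *v v \<noteq> 0" "Bm *v u \<noteq> 0" using that by (simp_all add: Bm_0)
    then have "0 < Re (\<Sum>i\<in>UNIV. \<Sum>j\<in>UNIV.
        g_bar (F one) (\<lambda>k. vec10 (axis k 1)) i j (Bm *v v) * (Bm *v u) $ i * cnj ((Bm *v u) $ j))"
      using pseudoconvex unfolding strongly_pseudoconvex_def Let_def by blast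
    then have "(\<Sum>i\<in>UNIV. \<Sum>j\<in>UNIV. wd i (wdbar j ?h) (Bm *v v) * (Bm *v u) $ i * cnj ((Bm *v u) $ j)) \<noteq> 0"
      unfolding g_bar_def[abs_def] h by (metis less_irrefl zero_complex.sel(1))
    moreover have "Bm *v a \<noteq> 0" if "a \<noteq> 0" for a using that by (simp add: Bm_0)
    ultimately show ?thesis
      using levi_linear_change[OF smooth_fibre _ that(1), of Bm u] unfolding fsq_basis by metis
  qed
qed

definition br :: "complex^'n \<Rightarrow> complex^'n \<Rightarrow> complex^'n" where
  "br x y = Bi (lie_bracket G A (Bm *v x) (Bm *v y))"

lemma Bm_br: "Bm *v br x y = lie_bracket G A (Bm *v x) (Bm *v y)"
  by (simp add: br_def Bm_Bi)

sublocale lie_fibre f br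
proof
  have "linear (\<lambda>x. br x y)" for y
    by (rule linearI; rule Bm_inj[THEN iffD1])
      (simp_all add: Bm_br matrix_vector_right_distrib Bm_scaleR
        bilinear_ladd[OF bilinear_lie_bracket] bilinear_lmul[OF bilinear_lie_bracket])
  moreover have "linear (\<lambda>y. br x y)" for x
    by (rule linearI; rule Bm_inj[THEN iffD1])
      (simp_all add: Bm_br matrix_vector_right_distrib Bm_scaleR
        bilinear_radd[OF bilinear_lie_bracket] bilinear_rmul[OF bilinear_lie_bracket])
  ultimately show "bilinear br" by (simp add: bilinear_def)
  show "br a b = - br b a" for a b
  proof -
    have "Bm *v br a b = Bm *v (- br b a)"
      using lie_bracket_alt[of "Bm *v a" "Bm *v b"]
      by (simp add: Bm_br linear_neg[OF matrix_vector_mul_linear])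
    then show ?thesis by (simp only: Bm_inj)
  qed
qed

text \<open>Each argument carries a factor 1/2, and expanding the complexified bracket in real and
  imaginary parts gives the four terms of \<open>p11\<close>.\<close>

lemma part10_bracket: "part10 (cx_bracket G A (comb e u) (cbar (comb e w))) = comb e (mixed_br u w)"
proof -
  let ?b = "lie_bracket G A" and ?u = "Bm *v u" and ?w = "Bm *v w"
  have "part10 (cx_bracket G A (comb e u) (cbar (comb e w)))
    = vec10 ((1/4) *\<^sub>R (?b ?u ?w + ?b (\<i> *s ?u) (\<i> *s ?w) + \<i> *s ?b ?u (\<i> *s ?w) - \<i> *s ?b (\<i> *s ?u) ?w))"
    unfolding comb_eq cbar_vec10 unfolding vec10_eq[of ?u]
    by (simp add: cx_bracket_def part10_eq vec10_inj bilinear_lmul[OF bilinear_lie_bracket]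
        bilinear_rmul[OF bilinear_lie_bracket] bilinear_lneg[OF bilinear_lie_bracket]
        bilinear_rneg[OF bilinear_lie_bracket] vec_eq_iff scaleR_conv_of_real[where 'a=complex] algebra_simps)
  moreover have "mixed_br u w = (1/4) *\<^sub>R (br u w + br (\<i> *s u) (\<i> *s w) + \<i> *s br u (\<i> *s w) - \<i> *s br (\<i> *s u) w)"
    by (simp add: mixed_br_def p11_def vec_eq_iff scaleR_conv_of_real[where 'a=complex] field_simps)
  moreover have "Bm *v ((1/4) *\<^sub>R (br u w + br (\<i> *s u) (\<i> *s w) + \<i> *s br u (\<i> *s w) - \<i> *s br (\<i> *s u) w))
    = (1/4) *\<^sub>R (?b ?u ?w + ?b (\<i> *s ?u) (\<i> *s ?w) + \<i> *s ?b ?u (\<i> *s ?w) - \<i> *s ?b (\<i> *s ?u) ?w)"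
    by (simp only: Bm_scaleR matrix_vector_right_distrib matrix_vector_mult_diff_distrib Bm_br Bm_scale)
  ultimately show ?thesis by (simp only: comb_eq)
qed

lemma cbar_bracket: "cbar (cx_bracket G A \<xi> \<eta>) = cx_bracket G A (cbar \<xi>) (cbar \<eta>)"
  by (simp add: cbar_def cx_bracket_def bilinear_lneg[OF bilinear_lie_bracket] bilinear_rneg[OF bilinear_lie_bracket])

text \<open>The bracket is real, hence commutes with conjugation, which exchanges the two
  types.\<close>

lemma part01_bracket: "part01 (cx_bracket G A (cbar (comb e u)) (comb e w)) = cbar (comb e (mixed_br u w))"
proof -
  have "cx_bracket G A (cbar (comb e u)) (comb e w) = cbar (cx_bracket G A (comb e u) (cbar (comb e w)))"
    by (simp add: cbar_bracket cbar_cbar)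
  then show ?thesis by (simp add: part01_cbar part10_bracket)
qed

lemma g_bar_eq: "g_bar (F one) e i j = gb i j" by (simp add: g_bar_def fun_eq_iff)
lemma g_hol_eq: "g_hol (F one) e i j = gh i j" by (simp add: g_hol_def fun_eq_iff)

lemma conn_op_eq:
  assumes v: "v \<noteq> 0"
  shows "conn_op G A F e (comb e v) (comb e w) = comb e (N v w)"
proof -
  let ?P = "\<lambda>\<nu>. \<forall>u\<in>T10. gform (F one) e (comb e v) \<nu> u =
           gform (F one) e (comb e v) (comb e v) (part10 (cx_bracket G A u (cbar (comb e w))))
           + cnj (sform (F one) e (comb e v) u (part10 (cx_bracket G A (comb e v) (cbar (comb e w)))))"
  have P: "?P (comb e x) \<longleftrightarrow> x = N v w" for x
  proof -
    have ball: "(\<forall>u\<in>T10. Q u) \<longleftrightarrow> (\<forall>u. Q (comb e u))" for Q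
      using comb_in_T10 comb_comps by metis
    show ?thesis
      unfolding ball part10_bracket gform_def sform_def comps_comb g_bar_eq g_hol_eq
      by (rule connection_operator_iff[OF v])
  qed
  show ?thesis unfolding conn_op_def
  proof (rule the_equality)
    show "comb e (N v w) \<in> T10 \<and> ?P (comb e (N v w))" using P comb_in_T10 by blast
    show "\<nu> = comb e (N v w)" if "\<nu> \<in> T10 \<and> ?P \<nu>" for \<nu>
      using that P[of "comps e \<nu>"] comb_comps[of \<nu>] by simp
  qed
qed

text \<open>The operators \<open>conn_op\<close> and \<open>N\<close> are identified only off the
  zero vector, an open set, which is enough for derivatives at \<open>v\<close>.\<close>

lemma conn_op_comps:
  assumes v: "v \<noteq> 0"
  shows "wd i (\<lambda>u. comps e (conn_op G A F e (comb e u) (comb e w)) $ j) v = wd i (\<lambda>u. N u w $ j) v"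
    "wdbar i (\<lambda>u. comps e (conn_op G A F e (comb e u) (comb e w)) $ j) v = wdbar i (\<lambda>u. N u w $ j) v"
  by (intro cong_slit[OF v]; simp add: conn_op_eq comps_comb)+

end

section \<open>The model in a chart of the group\<close>

locale finsler_lie_chart = finsler_lie_group A G e F
  for A :: "('g::topological_space, complex^'n) chart set" and G :: "'g monoid"
    and e :: "'n \<Rightarrow> (complex^'n) cplx" and F +
  fixes c :: "('g, complex^'n) chart"
  assumes c: "c \<in> A"
begin

abbreviation U where "U \<equiv> snd c ` fst c"
definition T where "T z u = T0 c z (Bm *v u)"
definition Ph where "Ph z h = Bi (T0inv c z h)"

lemma linear_frame: "z \<in> U \<Longrightarrow> linear (T z)"
  unfolding T_def
  by (rule linear_compose[OF matrix_vector_mul_linear T0_deriv(2)[OF c], unfolded o_def])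

sublocale local_model f br U T Ph
proof
  show "open U" by (rule chartD(2)[OF c])
  show "T z (x + y) = T z x + T z y" "T z (r *\<^sub>R x) = r *\<^sub>R T z x" if "z \<in> U" for z x y r
    using linear_frame[OF that] by (simp_all add: linear_add linear_cmul)
  show "T z (a *s y) = a *s T z y" if "z \<in> U" for z a y
    by (simp add: T_def Bm_scale T0_deriv(3)[OF c that])
  show "Ph z (T z y) = y" if "z \<in> U" for z y
    by (simp add: Ph_def T_def T0inv[OF c that] Bi_Bm)
  show "T z (Ph z h) = h" if "z \<in> U" for z h
    by (simp add: Ph_def T_def T0inv[OF c that] Bm_Bi)
  show "(\<lambda>z. T z y) differentiable (at z)" if "z \<in> U" for z y
    unfolding T_def by (rule differentiable_T0[OF c that])
  show "frechet_derivative (\<lambda>z. T z y) (at z) (T z x) - frechet_derivative (\<lambda>z. T z x) (at z) (T z y) = T z (br x y)"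
    if "z \<in> U" for z x y
    unfolding T_def Bm_br by (rule T0_bracket[OF c that])
qed

text \<open>A tangent vector at the base point is the value of a left-invariant field, and its
  components in the left-invariant frame are those of the field at the neutral element. So the
  coframe is the Maurer--Cartan form.\<close>

lemma coframe10_eq:
  assumes y: "y \<in> slit"
  shows "coframe10 A E c i y X = Ph (fst y) (fst X) $ i"
proof -
  have z: "fst y \<in> U" using y by (auto simp: slit_def)
  have "fst X = T0 c (fst y) (Bm *v Ph (fst y) (fst X))"
    using T_Ph[OF z, of "fst X"] by (simp add: T_def)
  then have "from_chart A c (fst y) (fst X) = left_field G A (Bm *v Ph (fst y) (fst X)) (base_pt c y)"
    using from_chart_T0[OF c z] unfolding base_pt_def by metis
  then have "part10 (from_chart A c (fst y) (fst X), 0) = cx_left_field G A (comb e (Ph (fst y) (fst X))) (base_pt c y)"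
    by (simp add: part10_eq cx_left_field_vec10 comb_eq)
  then show ?thesis by (simp add: coframe10_def comps_frame)
qed

lemma chern_rund_eqs_iff:
  assumes y: "y \<in> slit"
  shows "chern_rund_eqs A F E c y \<Gamma> \<longleftrightarrow> \<Gamma> = conn (snd y)"
proof -
  have m: "g_bar (F p) (frame_at E p) i j = gb i j" "C_hol (F p) (frame_at E p) i j l = Ch i j l"
    "C_bar (F p) (frame_at E p) i j l = Cb i j l" for p i j l
    by (simp_all add: g_bar_def C_hol_def C_bar_def fsq_frame fun_eq_iff)
  show ?thesis
    unfolding chern_rund_eqs_def Let_def m
    by (rule chern_rund_iff[OF y, of "\<lambda>i. coframe10 A E c i y" "coframe10 A E c"]) (simp_all add: coframe10_eq y)
qed

lemma chern_rund_coeffs_eq: "y \<in> slit \<Longrightarrow> chern_rund_coeffs A F E c y = conn (snd y)"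
  by (simp add: chern_rund_coeffs_def chern_rund_eqs_iff)

lemma chern_rund_form_eq: "y \<in> slit \<Longrightarrow> chern_rund_form A F E c i l y = cform i l y"
  by (rule ext) (simp add: chern_rund_form_def chern_rund_coeffs_eq cform_def om_conn_form coframe10_eq)

lemma curv_form_eq:
  assumes x: "x \<in> slit"
  shows "curv_form A F E c i l x = curv i l x"
proof (intro ext)
  fix X Y
  have "ext_d (chern_rund_form A F E c i l) x X Y = ext_d (cform i l) x X Y"
    by (rule ext_d_cong_open[OF open_slit_bundle x]) (simp add: chern_rund_form_eq)
  then show "curv_form A F E c i l x X Y = curv i l x X Y"
    by (simp add: curv_form_def curv_def chern_rund_form_eq[OF x])
qed

lemma curv_op_eq:
  assumes p: "p \<in> fst c" and v: "v \<noteq> 0"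
  shows "curv_op A F E c p (cx_left_field G A (comb e v) p) (cx_left_field G A (comb e w) p)
      (cx_left_field G A (comb e w) p) (cx_left_field G A (comb e v) p)
    = cx_left_field G A (comb e (\<chi> i. curv_vec v w i)) p"
proof -
  let ?x = "(snd c p, v)"
  have x: "?x \<in> slit" using p v by (auto simp: slit_def)
  let ?\<phi> = "\<lambda>i. coframe10 A E c i ?x"
  have cof: "chern_rund_coframe A F E c ?x = full_coframe ?\<phi> (vert_form ?\<phi> (conn v) v)"
    by (simp add: chern_rund_coframe_def Let_def chern_rund_coeffs_eq[OF x])
  have \<phi>: "?\<phi> i X = Ph (fst ?x) (fst X) $ i" for i X by (rule coframe10_eq[OF x])
  have \<psi>: "vert_form ?\<phi> (conn v) v i X = snd X $ i + Th (snd ?x) (Ph (fst ?x) (fst X)) $ i" for i X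
    unfolding vert_form_def om_conn_form[of ?\<phi>, OF \<phi>] by (simp add: om_contract[OF v])
  have "(\<Sum>l\<in>UNIV. \<Sum>k\<in>UNIV. \<Sum>j\<in>UNIV. v $ l * w $ k * cnj (w $ j) * curv_coeff A F E c i l j k ?x) = curv_vec v w i" for i
    unfolding curv_coeff_def cof curv_form_eq[OF x]
    using curvature_sum[OF x \<phi> \<psi>, of w i] by simp
  then show ?thesis
    unfolding curv_op_def Let_def comps_frame by (simp only: comb_frame)
qed

end

section \<open>Assembly of the curvature formulas\<close>

context finsler_lie_group
begin

lemma lie_curv_eq:
  assumes v: "v \<noteq> 0"
  shows "lie_curv G A F e (comb e w) (comb e v) = comb e (\<chi> i. curv_vec v w i)"
proof -
  have 1: "dir_deriv e (comb e a) (\<lambda>u. conn_op G A F e u (comb e w)) (comb e v)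
      = comb e (\<chi> j. \<Sum>i\<in>UNIV. a $ i * wd i (\<lambda>u. N u w $ j) v)" for a
    by (simp add: dir_deriv_def comps_comb conn_op_comps[OF v])
  have 2: "dir_deriv_bar e (cbar (comb e a)) (\<lambda>u. conn_op G A F e u (comb e w)) (comb e v)
      = comb e (\<chi> j. \<Sum>i\<in>UNIV. cnj (a $ i) * wdbar i (\<lambda>u. N u w $ j) v)" for a
    by (simp add: dir_deriv_bar_def comps_comb cbar_cbar conn_op_comps[OF v])
  have "lie_curv G A F e (comb e w) (comb e v)
    = comb e ((\<chi> j. \<Sum>i\<in>UNIV. mixed_br v w $ i * wd i (\<lambda>u. N u w $ j) v)
      - (\<chi> j. \<Sum>i\<in>UNIV. cnj (N v w $ i) * wdbar i (\<lambda>u. N u w $ j) v)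
      + N v (mixed_br w w) - mixed_br (N v w) w + mixed_br v (mixed_br w w))"
    by (simp only: lie_curv_def Let_def part10_bracket part01_bracket conn_op_eq[OF v] 1 2 comb_add comb_diff)
  also have "(\<chi> j. \<Sum>i\<in>UNIV. mixed_br v w $ i * wd i (\<lambda>u. N u w $ j) v)
      - (\<chi> j. \<Sum>i\<in>UNIV. cnj (N v w $ i) * wdbar i (\<lambda>u. N u w $ j) v)
      + N v (mixed_br w w) - mixed_br (N v w) w + mixed_br v (mixed_br w w) = (\<chi> i. curv_vec v w i)"
    by (simp add: vec_eq_iff curv_vec_def)
  finally show ?thesis .
qed

lemma gform_frame:
  "gform (F p) (frame_at E p) (cx_left_field G A (comb e a) p) (cx_left_field G A (comb e b) p)
      (cx_left_field G A (comb e d) p)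
    = gform (F one) e (comb e a) (comb e b) (comb e d)"
  by (simp add: gform_def comps_frame comps_comb g_bar_def fsq_frame)

end

theorem theorem1p4:
  fixes G :: "('g::{t2_space, second_countable_topology}) monoid"
    and A :: "('g, complex^'n) chart set"
    and F :: "'g \<Rightarrow> (complex^'n) cplx \<Rightarrow> real"
    and e :: "'n \<Rightarrow> (complex^'n) cplx"
    and c :: "('g, complex^'n) chart"
    and p :: 'g
    and v w :: "(complex^'n) cplx"
  assumes "connected (UNIV :: 'g set)"
    and "complex_atlas A"
    and "lie_group G A"
    and "left_invariant_complex_structure G A"
    and "complex_finsler_metric A F"
    and "strongly_pseudoconvex F"
    and "left_invariant_metric G A F"
    and "is_basis10 e"
    and "c \<in> A" and "p \<in> fst c"
    and "v \<in> T10 - {0}" and "w \<in> T10 - {0}"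
  shows "curv_op A F (left_frame G A e) c p (cx_left_field G A v p)
             (cx_left_field G A w p) (cx_left_field G A w p) (cx_left_field G A v p)
           = cx_left_field G A (lie_curv G A F e w v) p
       \<and> hol_bisectional_curv A F (left_frame G A e) c p (cx_left_field G A v p) (cx_left_field G A w p)
           = gform (F \<one>\<^bsub>G\<^esub>) e v (lie_curv G A F e w v) v
             / (gform (F \<one>\<^bsub>G\<^esub>) e v v v * gform (F \<one>\<^bsub>G\<^esub>) e v w w)
       \<and> hol_sectional_curv A F (left_frame G A e) c p (cx_left_field G A v p)
           = 2 * gform (F \<one>\<^bsub>G\<^esub>) e v (lie_curv G A F e v v) v / complex_of_real ((F \<one>\<^bsub>G\<^esub> v) ^ 4)"
proof -
  interpret finsler_lie_chart A G e F c
    by unfold_locales (use assms in simp_all)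
  obtain v' where v: "v = comb e v'" using comb_comps[of v] assms(11) by (metis DiffD1)
  obtain w' where w: "w = comb e w'" using comb_comps[of w] assms(12) by (metis DiffD1)
  have v': "v' \<noteq> 0" using assms(11) v comb_0 by auto
  \<comment> \<open>Both facts hold for every \<open>w'\<close>; the instance \<open>w' = v'\<close>
    gives the sectional curvature.\<close>
  note R = curv_op_eq[OF assms(10) v'] and K = lie_curv_eq[OF v']
  have Fv: "F p (cx_left_field G A v p) = F one v" using assms(11) by (intro F_left_field) simp
  show ?thesis
    unfolding hol_bisectional_curv_def hol_sectional_curv_def curv4_def Fv
    unfolding v w R K gform_frame by simp
qed

end
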